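(* Let $K$ be a convex body in $\mathbb{R}^n$ and $\tau>0$. If $K$ is strictly convex, then for all $0<\delta<\min(1,\tau^n)\,|K|$ the boundary $\partial K(\delta,\tau)$ of the convolution body $K(\delta,\tau)$ is of class $\mathcal{C}^1$. The partial derivatives of $F(x)=|K\cap(x+\tau K)|$, for $x=(x_1,\dots,x_n)$ in $\{x: F(x)>0\}$, are given, for $j=1,\dots,n$, by $$\frac{\partial F}{\partial x_j}(x)=\int_{K\cap\partial(x+\tau K)}\langle M(y),e_j\rangle\,d\mu(y)=-\int_{(x+\tau K)\cap\partial K}\langle N(y),e_j\rangle\,d\nu(y).$$
   Context: A convex body in $\mathbb{R}^n$ is a compact convex set with non-empty interior; it is not assumed symmetric here. It is strictly convex if its boundary contains no non-degenerate line segment. $|A|$ is the $n$-dimensional Lebesgue measure of $A$. For $\tau>0$ and $0<\delta<\min(1,\tau^n)|K|$, the convolution body of $K$ with parameters $\delta$ and $\tau$ is $K(\delta,\tau)=\{x\in\mathbb{R}^n: |K\cap(x+\tau K)|\ge\delta\}$ (a convex body by the Brunn–Minkowski theorem). $\nu$ and $\mu$ are the surface measures on $\partial K$ and $\partial(x+\tau K)$ respectively. $N(y)$ is the outer unit normal of $K$ at $y\in\partial K$ and $M(y)$ is the outer unit normal of $x+\tau K$ at $y\in\partial(x+\tau K)$; these are well defined almost everywhere with respect to $\nu$, resp. $\mu$. $\langle\cdot,\cdot\rangle$ is the standard scalar product and $e_1,\dots,e_n$ are the coordinate vectors.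
   Formalization: The derivative formula (for strictly convex K) is stated for all x with F(x)>0 except x=0 when τ=1 and, when n=1, x in (1−τ)∂K; at exactly these points F has a kink and no partial derivative, so the claim as printed fails there. *)

theory Defs
  imports "HOL-Analysis.Analysis"
begin

definition convex_body :: "(real^'n) set \<Rightarrow> bool" where
  "convex_body K \<longleftrightarrow> compact K \<and> convex K \<and> interior K \<noteq> {}"

definition strictly_convex :: "(real^'n) set \<Rightarrow> bool" where
  "strictly_convex K \<longleftrightarrow> (\<forall>a b. a \<noteq> b \<longrightarrow> \<not> closed_segment a b \<subseteq> frontier K)"

definition homothet :: "real^'n \<Rightarrow> real \<Rightarrow> (real^'n) set \<Rightarrow> (real^'n) set" where
  "homothet x \<tau> K = (\<lambda>y. x + \<tau> *\<^sub>R y) ` K"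

definition overlap :: "(real^'n) set \<Rightarrow> real \<Rightarrow> real^'n \<Rightarrow> real" where
  "overlap K \<tau> x = measure lebesgue (K \<inter> homothet x \<tau> K)"

text \<open>
  Even for strictly convex \<open>K\<close>, \<open>overlap K \<tau>\<close> need not be differentiable at a point where \<open>K\<close> and
  \<open>homothet x \<tau> K\<close> share boundary points with equal normals on a set of positive surface measure.
  This happens for \<open>\<tau> = 1\<close>, \<open>x = 0\<close> (the covariogram has a conical peak at the origin) and, in
  dimension one, when the two intervals have a common left or right end point,
  i.e. \<open>x = (1 - \<tau>) y\<close> with \<open>y\<close> in the boundary of \<open>K\<close>.
  At these points the overlap takes its maximal value, so they lie on the boundary of no convolution
  body with \<open>\<delta>\<close> in the admissible range.
\<close>

definition convolution_body :: "(real^'n) set \<Rightarrow> real \<Rightarrow> real \<Rightarrow> (real^'n) set" where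
  "convolution_body K \<delta> \<tau> = {x. overlap K \<tau> x \<ge> \<delta>}"


text \<open>
  Surface measure is Hausdorff measure of dimension \<open>n - 1\<close>, normalised to agree with Lebesgue
  measure on hyperplanes. The empty set is given weight \<open>0\<close> separately because
  \<open>diameter {} ^ 0 = 1\<close>; a singleton has weight \<open>1\<close> in dimension \<open>0\<close>, so that \<open>d = 0\<close> yields
  counting measure.
\<close>

definition hausdorff_pre :: "nat \<Rightarrow> real \<Rightarrow> 'a::metric_space set \<Rightarrow> ennreal" where
  "hausdorff_pre d \<epsilon> A =
     (INF U \<in> {U :: nat \<Rightarrow> 'a set. A \<subseteq> (\<Union>i. U i) \<and> (\<forall>i. bounded (U i) \<and> diameter (U i) \<le> \<epsilon>)}.
        \<Sum>i. if U i = {} then 0 else ennreal (diameter (U i) ^ d))"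

definition hausdorff_outer :: "nat \<Rightarrow> 'a::metric_space set \<Rightarrow> ennreal" where
  "hausdorff_outer d A = (SUP \<epsilon> \<in> {0<..}. hausdorff_pre d \<epsilon> A)"

text \<open>
  A facet of the unit cube is an \<open>(n - 1)\<close>-dimensional unit cube. All facets are congruent, so
  the choice of the coordinate does not matter.
\<close>

definition unit_facet :: "(real^'n) set" where
  "unit_facet = {x. (\<forall>i. 0 \<le> x $ i \<and> x $ i \<le> 1) \<and> x $ (SOME k. True) = 0}"

text \<open>
  Dividing by the value at a facet replaces the usual constant
  \<open>unit_ball_vol (n - 1) / 2 ^ (n - 1)\<close> in the definition of Hausdorff measure. Being a metric
  outer measure, \<open>hausdorff_outer\<close> is countably additive on Borel sets, so \<open>measure_of\<close>
  takes the given values there.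
\<close>

definition hausdorff_surface :: "(real^'n) measure" where
  "hausdorff_surface = measure_of UNIV (sets borel)
     (\<lambda>A. hausdorff_outer (CARD('n) - 1) A / hausdorff_outer (CARD('n) - 1) (unit_facet :: (real^'n) set))"

definition surface_measure :: "(real^'n) set \<Rightarrow> (real^'n) measure" where
  "surface_measure K = restrict_space hausdorff_surface (frontier K)"


definition is_outer_unit_normal :: "(real^'n) set \<Rightarrow> real^'n \<Rightarrow> real^'n \<Rightarrow> bool" where
  "is_outer_unit_normal K y u \<longleftrightarrow> norm u = 1 \<and> (\<forall>z\<in>K. u \<bullet> (z - y) \<le> 0)"

text \<open>
  For a convex body the normal is unique at almost every boundary point. At the remaining points the
  value is set to \<open>0\<close>; leaving it to \<open>THE\<close> there could make the function non-measurable.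
\<close>

definition outer_normal :: "(real^'n) set \<Rightarrow> real^'n \<Rightarrow> real^'n" where
  "outer_normal K y =
     (if \<exists>!u. is_outer_unit_normal K y u then THE u. is_outer_unit_normal K y u else 0)"


text \<open>
  The boundary of \<open>S\<close> is of class \<open>C\<^sup>1\<close>: near each of its points it is the zero set of a
  continuously differentiable function with non-vanishing gradient, with \<open>S\<close> lying on one side.
\<close>

definition C1_boundary :: "(real^'n) set \<Rightarrow> bool" where
  "C1_boundary S \<longleftrightarrow>
     (\<forall>p \<in> frontier S. \<exists>U g (g' :: real^'n \<Rightarrow> real^'n).
        open U \<and> p \<in> U \<and>
        (\<forall>y\<in>U. (g has_derivative (\<lambda>h. g' y \<bullet> h)) (at y)) \<and>
        continuous_on U g' \<and> (\<forall>y\<in>U. g' y \<noteq> 0) \<and>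
        S \<inter> U = {y \<in> U. g y \<le> (0::real)} \<and>
        frontier S \<inter> U = {y \<in> U. g y = 0})"

end

theory Submission
  imports Defs
begin

text \<open>
  Surface measure enters through projections. For a unit vector \<open>e\<close>, the points of the boundary of a
  body \<open>K\<close> that end a line section of \<open>K\<close> in direction \<open>\<plusminus> e\<close> carry the area of their projection along
  \<open>e\<close>; the difference of the two measures, the signed area \<open>\<gamma>\<^sub>e\<close>, is the boundary term of Fubini's
  theorem and the fundamental theorem of calculus along lines: moving \<open>K\<close> in direction \<open>e\<close>
  changes the integral of a function \<open>\<phi>\<close> over \<open>K\<close> at the rate \<open>\<integral> \<phi> d\<gamma>\<^sub>e\<close>.

  The rate is a directional derivative, so \<open>\<gamma>\<^sub>e\<close> is linear in \<open>e\<close>. Projections do not increase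
  Hausdorff measure \<open>\<sigma>\<close>, so \<open>\<bar>\<gamma>\<^sub>e\<bar> \<le> \<sigma>\<close> for every \<open>e\<close>; and on a set with normals within \<open>\<epsilon>\<close> of \<open>u\<close> the
  projection along \<open>u\<close> is almost isometric, so \<open>\<gamma>\<^sub>u \<ge> (1 - O(\<epsilon>\<^sup>2)) \<sigma>\<close>. A vector of length at most
  \<open>\<sigma>\<close> with such a component is within \<open>O(\<epsilon>) \<sigma>\<close> of \<open>\<sigma> u\<close>. This gives \<open>\<gamma>\<^sub>e = \<langle>N, e\<rangle> \<sigma>\<close>, and it shows that
  points with two normals form a null set. Applied to \<open>K \<inter> (x + \<tau> K)\<close>, the last fact makes the common
  boundary points of the two bodies negligible, up to points with a common normal, of which
  strict convexity leaves at most one.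

  The gradient of the overlap does not vanish below the maximal value, because the overlap grows at
  least linearly on the way to a position where one body contains the other.
\<close>

subsection \<open>Hausdorff measure\<close>


text \<open>Two notions of area have to meet: Hausdorff measure is defined by covers, while
  differentiating a volume along a direction yields projected area. They are compared by Lipschitz
  bounds alone, without almost everywhere differentiability of convex functions: a projection has
  Lipschitz constant \<open>1\<close>, its inverse on a patch at most
  \<open>1 / (1 - \<epsilon>\<^sup>2)\<close>. Such bounds decide nothing while the constant of
  Hausdorff measure is unknown, so that measure is first identified on hyperplanes, where
  translation invariance leaves one factor and the unit facet fixes it.

  The defect must be of second order in \<epsilon> because passing from one component of a vector to
  the vector itself costs a square root. The resulting error is proportional to the area of the
  patch, so the number of patches, which grows as \<epsilon> shrinks, does not matter.

  Strict convexity acts through fixed points: a contact point with a common normal satisfies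
  \<open>y = x + \<tau> y\<close>. This equation has one solution at most unless
  \<open>\<tau> = 1\<close> and \<open>x = 0\<close>, and one point has no area unless the dimension
  is one; hence the positions excluded from the derivative formula.\<close>

abbreviation cover_weight :: "nat \<Rightarrow> 'a::metric_space set \<Rightarrow> ennreal" where
  "cover_weight d U \<equiv> (if U = {} then 0 else ennreal (diameter U ^ d))"

lemma hausdorff_pre_le:
  assumes "A \<subseteq> (\<Union>i. U i)" "\<And>i. bounded (U i)" "\<And>i. diameter (U i) \<le> \<epsilon>"
  shows "hausdorff_pre d \<epsilon> A \<le> (\<Sum>i. cover_weight d (U i))"
  unfolding hausdorff_pre_def by (rule INF_lower) (use assms in auto)

lemma hausdorff_pre_geI:
  assumes "\<And>U. A \<subseteq> (\<Union>i. U i) \<Longrightarrow> (\<And>i. bounded (U i)) \<Longrightarrow> (\<And>i. diameter (U i) \<le> \<epsilon>)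
    \<Longrightarrow> x \<le> (\<Sum>i. cover_weight d (U i))"
  shows "x \<le> hausdorff_pre d \<epsilon> A"
  unfolding hausdorff_pre_def by (rule INF_greatest) (use assms in auto)

lemma hausdorff_pre_empty: "\<epsilon> \<ge> 0 \<Longrightarrow> hausdorff_pre d \<epsilon> {} = 0"
  using hausdorff_pre_le[of "{}" "\<lambda>_. {}" \<epsilon> d] by (simp add: diameter_def)

lemma hausdorff_pre_mono: "A \<subseteq> B \<Longrightarrow> hausdorff_pre d \<epsilon> A \<le> hausdorff_pre d \<epsilon> B"
  unfolding hausdorff_pre_def by (rule INF_superset_mono) auto

lemma hausdorff_pre_antimono: "\<epsilon> \<le> \<epsilon>' \<Longrightarrow> hausdorff_pre d \<epsilon>' A \<le> hausdorff_pre d \<epsilon> A"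
  unfolding hausdorff_pre_def by (rule INF_superset_mono) (auto intro: order_trans)

lemma hausdorff_pre_UN:
  fixes A :: "nat \<Rightarrow> 'a::metric_space set"
  shows "hausdorff_pre d \<epsilon> (\<Union>i. A i) \<le> (\<Sum>i. hausdorff_pre d \<epsilon> (A i))"
proof (rule ennreal_le_epsilon)
  fix e :: real assume fin: "(\<Sum>i. hausdorff_pre d \<epsilon> (A i)) < top" and e: "0 < e"
  define \<eta> where "\<eta> n = ennreal e * ennreal ((1/2) ^ Suc n)" for n
  have ex: "\<exists>U. A n \<subseteq> (\<Union>i. U i) \<and> (\<forall>i. bounded (U i) \<and> diameter (U i) \<le> \<epsilon>) \<and>
      (\<Sum>i. cover_weight d (U i)) < hausdorff_pre d \<epsilon> (A n) + \<eta> n" for n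
  proof -
    have "hausdorff_pre d \<epsilon> (A n) \<le> (\<Sum>i. hausdorff_pre d \<epsilon> (A i))"
      using sum_le_suminf[of "\<lambda>i. hausdorff_pre d \<epsilon> (A i)" "{n}"] by simp
    then have "hausdorff_pre d \<epsilon> (A n) \<noteq> top" using fin by (auto simp: top_unique)
    then obtain r where "hausdorff_pre d \<epsilon> (A n) = ennreal r" "r \<ge> 0"
      by (cases "hausdorff_pre d \<epsilon> (A n)") auto
    then have "hausdorff_pre d \<epsilon> (A n) < hausdorff_pre d \<epsilon> (A n) + \<eta> n"
      using e by (simp add: \<eta>_def ennreal_mult[symmetric] ennreal_plus[symmetric] ennreal_less_iff del: ennreal_plus power_Suc)
    then show ?thesis
      by (subst (asm) hausdorff_pre_def, subst (asm) INF_less_iff) auto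
  qed
  from choice[OF allI[OF ex]] obtain U where U0: "\<forall>n. A n \<subseteq> (\<Union>i. U n i) \<and> (\<forall>i. bounded (U n i) \<and> diameter (U n i) \<le> \<epsilon>) \<and>
      (\<Sum>i. cover_weight d (U n i)) < hausdorff_pre d \<epsilon> (A n) + \<eta> n" by (rule exE)
  then have U: "\<And>n. A n \<subseteq> (\<Union>i. U n i)" "\<And>n i. bounded (U n i)" "\<And>n i. diameter (U n i) \<le> \<epsilon>"
    "\<And>n. (\<Sum>i. cover_weight d (U n i)) < hausdorff_pre d \<epsilon> (A n) + \<eta> n"
    by auto
  define V where "V k = case_prod U (prod_decode k)" for k
  have "(\<Union>i. A i) \<subseteq> (\<Union>k. V k)"
  proof
    fix x assume "x \<in> (\<Union>i. A i)"
    then obtain n i where "x \<in> U n i" using U(1) by blast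
    then have "x \<in> V (prod_encode (n, i))" by (simp add: V_def)
    then show "x \<in> (\<Union>k. V k)" by blast
  qed
  then have "hausdorff_pre d \<epsilon> (\<Union>i. A i) \<le> (\<Sum>k. cover_weight d (V k))"
    by (rule hausdorff_pre_le) (auto simp: V_def U split: prod.split)
  also have "\<dots> = (\<Sum>k. (\<lambda>p. cover_weight d (case_prod U p)) (prod_decode k))"
    by (simp only: V_def)
  also have "\<dots> = (\<Sum>n. \<Sum>i. cover_weight d (U n i))"
    by (rule suminf_ennreal_2dimen) (simp only: prod.case)
  also have "\<dots> \<le> (\<Sum>n. hausdorff_pre d \<epsilon> (A n) + \<eta> n)"
    by (intro suminf_le less_imp_le U) auto
  also have "\<dots> = (\<Sum>n. hausdorff_pre d \<epsilon> (A n)) + (\<Sum>n. \<eta> n)"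
    by (rule suminf_add[symmetric]) auto
  also have "(\<Sum>n. \<eta> n) = e"
    unfolding \<eta>_def ennreal_suminf_cmult
    by (subst suminf_ennreal_eq[OF zero_le_power power_half_series]) auto
  finally show "hausdorff_pre d \<epsilon> (\<Union>i. A i) \<le> (\<Sum>i. hausdorff_pre d \<epsilon> (A i)) + ennreal e" .
qed

lemma hausdorff_pre_le_outer: "\<epsilon> > 0 \<Longrightarrow> hausdorff_pre d \<epsilon> A \<le> hausdorff_outer d A"
  unfolding hausdorff_outer_def by (rule SUP_upper) auto

lemma hausdorff_outer_empty [simp]: "hausdorff_outer d {} = 0"
  unfolding hausdorff_outer_def using hausdorff_pre_empty[where d=d and 'a='a]
  by (intro antisym SUP_least) auto

lemma hausdorff_outer_mono: "A \<subseteq> B \<Longrightarrow> hausdorff_outer d A \<le> hausdorff_outer d B"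
  unfolding hausdorff_outer_def by (intro SUP_mono) (auto intro: hausdorff_pre_mono)

lemma hausdorff_outer_UN:
  "hausdorff_outer d (\<Union>i. A i) \<le> (\<Sum>i. hausdorff_outer d (A i))" for A :: "nat \<Rightarrow> 'a::metric_space set"
  unfolding hausdorff_outer_def[of _ "\<Union>i. A i"]
proof (rule SUP_least)
  fix \<epsilon> :: real assume "\<epsilon> \<in> {0<..}"
  then show "hausdorff_pre d \<epsilon> (\<Union>i. A i) \<le> (\<Sum>i. hausdorff_outer d (A i))"
    by (intro order_trans[OF hausdorff_pre_UN] suminf_le hausdorff_pre_le_outer) auto
qed

lemma hausdorff_outer_Un: "hausdorff_outer d (A \<union> B) \<le> hausdorff_outer d A + hausdorff_outer d B"
proof -
  have "hausdorff_outer d (A \<union> B) = hausdorff_outer d (\<Union>i::nat. if i = 0 then A else if i = 1 then B else {})"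
    by (rule arg_cong[where f="hausdorff_outer d"]) (auto split: if_splits)
  also have "\<dots> \<le> (\<Sum>i. hausdorff_outer d (if i = 0 then A else if i = 1 then B else {}))"
    by (rule hausdorff_outer_UN)
  also have "\<dots> = (\<Sum>i\<in>{0::nat,1}. hausdorff_outer d (if i = 0 then A else if i = 1 then B else {}))"
    by (rule suminf_finite) auto
  finally show ?thesis by simp
qed

text \<open>A cover set of diameter below \<eta> cannot meet both sets, so a fine cover splits into
  a cover of \<open>A\<close> and a cover of \<open>B\<close>. This property of a metric outer
  measure is what makes Borel sets measurable.\<close>

lemma hausdorff_outer_separated:
  fixes A B :: "'a::metric_space set"
  assumes "\<eta> > 0" and sep: "\<And>a b. a \<in> A \<Longrightarrow> b \<in> B \<Longrightarrow> \<eta> \<le> dist a b"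
  shows "hausdorff_outer d A + hausdorff_outer d B \<le> hausdorff_outer d (A \<union> B)"
proof -
  have pre: "hausdorff_pre d \<epsilon> A + hausdorff_pre d \<epsilon> B \<le> hausdorff_pre d \<epsilon> (A \<union> B)"
    if \<epsilon>: "0 < \<epsilon>" "\<epsilon> < \<eta>" for \<epsilon>
  proof (rule hausdorff_pre_geI)
    fix U :: "nat \<Rightarrow> 'a set"
    assume U: "A \<union> B \<subseteq> (\<Union>i. U i)" "\<And>i. bounded (U i)" "\<And>i. diameter (U i) \<le> \<epsilon>"
    have disj: "U i \<inter> A = {} \<or> U i \<inter> B = {}" for i
      using diameter_bounded_bound[OF U(2)] U(3) sep \<epsilon> by (meson disjoint_iff IntE not_le order_trans)
    have cA: "A \<subseteq> (\<Union>i. if U i \<inter> A = {} then {} else U i)" and cB: "B \<subseteq> (\<Union>i. if U i \<inter> B = {} then {} else U i)"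
      using U(1) by fastforce+
    have "hausdorff_pre d \<epsilon> A \<le> (\<Sum>i. cover_weight d (if U i \<inter> A = {} then {} else U i))"
      by (rule hausdorff_pre_le[OF cA]) (use U \<epsilon> in auto)
    moreover have "hausdorff_pre d \<epsilon> B \<le> (\<Sum>i. cover_weight d (if U i \<inter> B = {} then {} else U i))"
      by (rule hausdorff_pre_le[OF cB]) (use U \<epsilon> in auto)
    ultimately have "hausdorff_pre d \<epsilon> A + hausdorff_pre d \<epsilon> B \<le>
      (\<Sum>i. cover_weight d (if U i \<inter> A = {} then {} else U i)) + (\<Sum>i. cover_weight d (if U i \<inter> B = {} then {} else U i))"
      by (rule add_mono)
    also have "\<dots> = (\<Sum>i. cover_weight d (if U i \<inter> A = {} then {} else U i) + cover_weight d (if U i \<inter> B = {} then {} else U i))"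
      by (rule suminf_add) auto
    also have "\<dots> \<le> (\<Sum>i. cover_weight d (U i))"
      by (intro suminf_le) (use disj in auto)
    finally show "hausdorff_pre d \<epsilon> A + hausdorff_pre d \<epsilon> B \<le> (\<Sum>i. cover_weight d (U i))" .
  qed
  \<comment> \<open>Suprema add because both pre-measures increase as the scale shrinks; for the
    same reason only scales below \<eta> matter.\<close>
  have "hausdorff_outer d A + hausdorff_outer d B =
      (SUP \<epsilon>\<in>{0<..}. hausdorff_pre d \<epsilon> A + hausdorff_pre d \<epsilon> B)"
    unfolding hausdorff_outer_def
  proof (rule SUP_add_directed_ennreal[symmetric])
    fix i j :: real assume "i \<in> {0<..}" "j \<in> {0<..}"
    then show "\<exists>k\<in>{0<..}. hausdorff_pre d i A + hausdorff_pre d j B \<le> hausdorff_pre d k A + hausdorff_pre d k B"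
      by (intro bexI[of _ "min i j"] add_mono hausdorff_pre_antimono) auto
  qed
  also have "\<dots> \<le> hausdorff_outer d (A \<union> B)"
  proof (rule SUP_least)
    fix \<epsilon> :: real assume "\<epsilon> \<in> {0<..}"
    then have "hausdorff_pre d \<epsilon> A + hausdorff_pre d \<epsilon> B \<le> hausdorff_pre d (min \<epsilon> (\<eta>/2)) A + hausdorff_pre d (min \<epsilon> (\<eta>/2)) B"
      by (intro add_mono hausdorff_pre_antimono) auto
    also have "\<dots> \<le> hausdorff_pre d (min \<epsilon> (\<eta>/2)) (A \<union> B)"
      using \<open>\<epsilon> \<in> {0<..}\<close> \<open>\<eta> > 0\<close> by (intro pre) auto
    also have "\<dots> \<le> hausdorff_outer d (A \<union> B)"
      using \<open>\<epsilon> \<in> {0<..}\<close> \<open>\<eta> > 0\<close> by (intro hausdorff_pre_le_outer) auto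
    finally show "hausdorff_pre d \<epsilon> A + hausdorff_pre d \<epsilon> B \<le> hausdorff_outer d (A \<union> B)" .
  qed
  finally show ?thesis .
qed

section \<open>Measurability of Borel sets\<close>

lemma outer_measure_space_hausdorff: "outer_measure_space UNIV (hausdorff_outer d)"
proof -
  have "countably_subadditive UNIV (hausdorff_outer d)"
    unfolding countably_subadditive_def using hausdorff_outer_UN by blast
  then show ?thesis
    by (auto simp: outer_measure_space_def positive_def increasing_def intro: hausdorff_outer_mono)
qed

text \<open>
  Caratheodory's criterion. The sets \<open>X k\<close> of points of \<open>Y\<close> at distance at least \<open>1/(k+1)\<close> from \<open>C\<close>
  exhaust \<open>Y - C\<close>. The difference \<open>X (k+2) - X (k+1)\<close> is separated from \<open>X k\<close>, so the measures of
  the differences have a telescoping bound.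
\<close>

lemma hausdorff_closed_caratheodory:
  fixes C Y :: "'a::metric_space set"
  assumes C: "closed C"
  shows "hausdorff_outer d (Y \<inter> C) + hausdorff_outer d (Y - C) \<le> hausdorff_outer d Y"
proof (cases "C = {} \<or> hausdorff_outer d Y = top")
  case True
  then show ?thesis by auto
next
  case False
  then have ne: "C \<noteq> {}" and fin: "hausdorff_outer d Y \<noteq> top" by auto
  define H where "H = (hausdorff_outer d :: 'a set \<Rightarrow> ennreal)"
  define X where "X k = {y\<in>Y. 1 / real (Suc k) \<le> infdist y C}" for k
  have Xmono: "X k \<subseteq> X l" if "k \<le> l" for k l
  proof -
    have "1 / real (Suc l) \<le> 1 / real (Suc k)" using that by (intro frac_le) auto
    then show ?thesis unfolding X_def by auto
  qed
  have XY: "X k \<subseteq> Y" for k by (auto simp: X_def)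
  have XC: "H (Y \<inter> C) + H (X k) \<le> H Y" for k
  proof -
    have "H (Y \<inter> C) + H (X k) \<le> H (Y \<inter> C \<union> X k)"
      unfolding H_def
    proof (rule hausdorff_outer_separated)
      show "0 < 1 / real (Suc k)" by simp
      fix a b assume "a \<in> Y \<inter> C" "b \<in> X k"
      then show "1 / real (Suc k) \<le> dist a b"
        using infdist_le[of a C b] by (auto simp: X_def dist_commute)
    qed
    also have "\<dots> \<le> H Y" unfolding H_def by (rule hausdorff_outer_mono) (auto simp: X_def)
    finally show ?thesis .
  qed
  define a where "a k = enn2real (H (X k))" for k
  have Hfin: "H (X k) < top" for k
    using hausdorff_outer_mono[OF XY, of d k] fin by (auto simp: H_def less_top[symmetric] top_unique)
  have Ha: "H (X k) = ennreal (a k)" for k using Hfin[of k] by (simp add: a_def)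
  have a0: "0 \<le> a k" for k by (simp add: a_def)
  define R where "R k = X (Suc k) - X k" for k
  have Rle: "H (R (Suc k)) \<le> ennreal (a (k+2) - a k)" for k
  proof -
    have "H (R (Suc k)) + H (X k) \<le> H (R (Suc k) \<union> X k)"
      unfolding H_def
    proof (rule hausdorff_outer_separated)
      show "0 < 1 / real (Suc k) - 1 / real (Suc (Suc k))" by (simp add: field_simps add_pos_nonneg)
      fix x y assume "x \<in> R (Suc k)" "y \<in> X k"
      then have "infdist x C \<le> 1 / real (Suc (Suc k))" "1 / real (Suc k) \<le> infdist y C"
        by (auto simp: R_def X_def)
      moreover have "infdist y C \<le> infdist x C + dist y x" by (rule infdist_triangle)
      ultimately show "1 / real (Suc k) - 1 / real (Suc (Suc k)) \<le> dist x y"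
        by (simp add: dist_commute)
    qed
    also have "\<dots> \<le> H (X (k+2))" unfolding H_def using Xmono[of k "k+2"]
      by (intro hausdorff_outer_mono) (auto simp: R_def)
    finally have *: "H (R (Suc k)) + ennreal (a k) \<le> ennreal (a (k+2))" by (simp only: Ha)
    then obtain r where r: "H (R (Suc k)) = ennreal r" "r \<ge> 0"
      by (cases "H (R (Suc k))") (auto simp: top_unique)
    show ?thesis using * a0 r by (simp add: ennreal_plus[symmetric] del: ennreal_plus)
  qed
  have amono: "a k \<le> a l" if "k \<le> l" for k l
    using hausdorff_outer_mono[OF Xmono[OF that], of d] a0 by (simp add: Ha H_def[symmetric])
  have abd: "a k \<le> enn2real (H Y)" for k
    unfolding a_def using fin hausdorff_outer_mono[OF XY, of d k] by (intro enn2real_mono) (auto simp: H_def less_top)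
  obtain s where s: "a \<longlonglongrightarrow> s" "\<And>k. a k \<le> s"
    using incseq_convergent[of a] amono abd by (metis incseq_def)
  have out: "H (Y - C) \<le> ennreal (a (Suc k) + 2 * (s - a k))" for k
  proof -
    have sub: "Y - C \<subseteq> X (Suc k) \<union> (\<Union>j. R (Suc (k + j)))"
    proof
      fix y assume y: "y \<in> Y - C"
      then have "0 < infdist y C" using C ne by (intro infdist_pos_not_in_closed) auto
      then obtain m where "inverse (real (Suc m)) < infdist y C" using reals_Archimedean by blast
      then have "y \<in> X m" using y by (auto simp: X_def inverse_eq_divide)
      then have ex: "\<exists>m. y \<in> X m" by blast
      define m where "m = (LEAST m. y \<in> X m)"
      have m: "y \<in> X m" "\<And>j. j < m \<Longrightarrow> y \<notin> X j" unfolding m_def using LeastI_ex[OF ex] not_less_Least by auto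
      show "y \<in> X (Suc k) \<union> (\<Union>j. R (Suc (k + j)))"
      proof (cases "m \<le> Suc k")
        case True then show ?thesis using m Xmono by blast
      next
        case False
        then obtain j where j: "m = Suc (Suc (k + j))" by (metis add_Suc less_natE not_le)
        then have "y \<in> R (Suc (k + j))" using m(1) m(2)[of "Suc (k + j)"] by (auto simp: R_def)
        then show ?thesis by blast
      qed
    qed
    have "H (Y - C) \<le> H (X (Suc k)) + H (\<Union>j. R (Suc (k + j)))"
      unfolding H_def using hausdorff_outer_mono[OF sub] hausdorff_outer_Un order_trans by blast
    also have "\<dots> \<le> H (X (Suc k)) + (\<Sum>j. H (R (Suc (k + j))))"
      unfolding H_def by (intro add_left_mono hausdorff_outer_UN)
    also have "(\<Sum>j. H (R (Suc (k + j)))) \<le> ennreal (2 * (s - a k))"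
    proof (rule suminf_le_const)
      fix m
      have "(\<Sum>j<m. H (R (Suc (k + j)))) \<le> (\<Sum>j<m. ennreal (a (k + j + 2) - a (k + j)))"
        by (intro sum_mono Rle)
      also have "\<dots> = ennreal (\<Sum>j<m. a (k + j + 2) - a (k + j))"
        by (rule sum_ennreal) (simp add: amono)
      also have "(\<Sum>j<m. a (k + j + 2) - a (k + j)) = a (k + m) + a (k + m + 1) - a k - a (Suc k)"
        by (induction m) auto
      also have "ennreal \<dots> \<le> ennreal (2 * (s - a k))"
        using s(2)[of "k+m"] s(2)[of "k+m+1"] amono[of k "Suc k"] by (intro ennreal_leI) auto
      finally show "(\<Sum>j<m. H (R (Suc (k + j)))) \<le> ennreal (2 * (s - a k))" .
    qed auto
    finally show ?thesis using a0[of "Suc k"] s(2)[of k]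
      by (simp add: Ha ennreal_plus[symmetric] del: ennreal_plus)
  qed
  \<comment> \<open>The tail \<open>2 * (s - a k)\<close> vanishes in the limit, so the sets
    \<open>X k\<close> exhaust \<open>Y - C\<close> in measure as well: its measure is at most the
    limit \<open>s\<close>.\<close>
  have "(\<lambda>k. a (Suc k) + 2 * (s - a k)) \<longlonglongrightarrow> s + 2 * (s - s)"
    by (intro tendsto_intros LIMSEQ_Suc s)
  then have "(\<lambda>k. ennreal (a (Suc k) + 2 * (s - a k))) \<longlonglongrightarrow> ennreal s"
    using tendsto_ennrealI by fastforce
  then have Hs: "H (Y - C) \<le> ennreal s" by (rule LIMSEQ_le_const) (use out in blast)
  have "(\<lambda>k. H (Y \<inter> C) + ennreal (a k)) \<longlonglongrightarrow> H (Y \<inter> C) + ennreal s"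
    by (intro tendsto_intros tendsto_ennrealI s)
  then have "H (Y \<inter> C) + ennreal s \<le> H Y"
    by (rule LIMSEQ_le_const2) (use XC in \<open>auto simp: Ha\<close>)
  then show ?thesis using Hs unfolding H_def by (meson add_left_mono order_trans)
qed

text \<open>\<open>measure_of\<close> takes the prescribed values only if they are countably
  additive. Caratheodory's measurable sets form a sigma-algebra on which this holds, and since it
  contains the closed sets it contains all Borel sets.\<close>

lemma measure_space_hausdorff_outer:
  "measure_space UNIV (sets borel) (hausdorff_outer d :: 'a::metric_space set \<Rightarrow> ennreal)"
proof -
  interpret sigma_algebra "UNIV :: 'a set" UNIV
    using sigma_algebra_Pow[of "UNIV :: 'a set"] by simp
  define L where "L = lambda_system (UNIV::'a set) UNIV (hausdorff_outer d)"
  have ms: "measure_space UNIV L (hausdorff_outer d)"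
    unfolding L_def by (rule caratheodory_lemma[OF outer_measure_space_hausdorff])
  have closed: "C \<in> L" if "closed C" for C
    unfolding L_def lambda_system_eq
  proof (intro CollectI conjI ballI)
    fix x
    show "hausdorff_outer d (x \<inter> C) + hausdorff_outer d (x - C) = hausdorff_outer d x"
    proof (rule antisym)
      show "hausdorff_outer d x \<le> hausdorff_outer d (x \<inter> C) + hausdorff_outer d (x - C)"
        using hausdorff_outer_Un[of d "x \<inter> C" "x - C"] by (simp add: Int_Diff_Un)
    qed (rule hausdorff_closed_caratheodory[OF that])
  qed simp
  interpret L: sigma_algebra UNIV L using ms by (simp add: measure_space_def)
  have "sets borel \<subseteq> L"
    unfolding borel_eq_closed by (subst sets_measure_of) (use closed in \<open>auto intro!: L.sigma_sets_subset\<close>)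
  then show ?thesis
    using ms unfolding measure_space_def
    by (auto simp: countably_additive_def positive_def sets.sigma_algebra_axioms[of borel, simplified])
qed

section \<open>Lipschitz images and isometries\<close>

text \<open>Images of cover sets cover the image, with diameters stretched by at most
  \<open>C\<close> and weights by at most \<open>C ^ d\<close>. Each cover set is first cut down to
  \<open>A\<close>, since \<open>f\<close> is controlled only there.\<close>

lemma hausdorff_outer_lipschitz:
  fixes f :: "'a::metric_space \<Rightarrow> 'b::metric_space"
  assumes C: "C > 0" and f: "\<And>x y. x \<in> A \<Longrightarrow> y \<in> A \<Longrightarrow> dist (f x) (f y) \<le> C * dist x y"
  shows "hausdorff_outer d (f ` A) \<le> ennreal (C ^ d) * hausdorff_outer d A"
proof -
  have pre: "hausdorff_pre d \<epsilon> (f ` A) \<le> ennreal (C ^ d) * hausdorff_pre d (\<epsilon> / C) A" if "\<epsilon> > 0" for \<epsilon>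
  proof -
    have "hausdorff_pre d \<epsilon> (f ` A) / ennreal (C ^ d) \<le> hausdorff_pre d (\<epsilon> / C) A"
    proof (rule hausdorff_pre_geI)
      fix U :: "nat \<Rightarrow> 'a set"
      assume U: "A \<subseteq> (\<Union>i. U i)" "\<And>i. bounded (U i)" "\<And>i. diameter (U i) \<le> \<epsilon> / C"
      have d: "dist x y \<le> C * diameter (U i)" if "x \<in> f ` (A \<inter> U i)" "y \<in> f ` (A \<inter> U i)" for x y i
      proof -
        obtain a b where ab: "a \<in> A \<inter> U i" "b \<in> A \<inter> U i" "x = f a" "y = f b" using \<open>x \<in> _\<close> \<open>y \<in> _\<close> by blast
        have "dist x y \<le> C * dist a b" using ab f by auto
        also have "\<dots> \<le> C * diameter (U i)"
          using diameter_bounded_bound[OF U(2)] ab C by (intro mult_left_mono) auto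
        finally show ?thesis .
      qed
      have bd: "bounded (f ` (A \<inter> U i))" for i unfolding bounded_two_points using d by blast
      have diam: "diameter (f ` (A \<inter> U i)) \<le> C * diameter (U i)" for i
        using d diameter_ge_0[OF U(2)] C by (auto simp: diameter_def[of "f ` _"] intro!: cSUP_least)
      have "hausdorff_pre d \<epsilon> (f ` A) \<le> (\<Sum>i. cover_weight d (f ` (A \<inter> U i)))"
      proof (rule hausdorff_pre_le)
        show "diameter (f ` (A \<inter> U i)) \<le> \<epsilon>" for i
          using diam[of i] U(3)[of i] C by (simp add: field_simps mult.commute)
        show "f ` A \<subseteq> (\<Union>i. f ` (A \<inter> U i))" using U(1) by blast
      qed (use bd in auto)
      also have "\<dots> \<le> (\<Sum>i. ennreal (C ^ d) * cover_weight d (U i))"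
      proof (intro suminf_le)
        fix i
        have "diameter (f ` (A \<inter> U i)) ^ d \<le> C ^ d * diameter (U i) ^ d"
          using diam[of i] diameter_ge_0[OF bd] by (simp add: power_mult_distrib[symmetric] power_mono)
        then show "cover_weight d (f ` (A \<inter> U i)) \<le> ennreal (C ^ d) * cover_weight d (U i)"
          using C diameter_ge_0[OF U(2)] by (auto simp: ennreal_mult[symmetric] intro!: ennreal_leI)
      qed auto
      also have "\<dots> = ennreal (C ^ d) * (\<Sum>i. cover_weight d (U i))" by (rule ennreal_suminf_cmult)
      finally show "hausdorff_pre d \<epsilon> (f ` A) / ennreal (C ^ d) \<le> (\<Sum>i. cover_weight d (U i))"
        using C by (simp add: divide_le_posI_ennreal mult.commute)
    qed
    then have "ennreal (C ^ d) * (hausdorff_pre d \<epsilon> (f ` A) / ennreal (C ^ d)) \<le> ennreal (C ^ d) * hausdorff_pre d (\<epsilon> / C) A"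
      by (rule mult_left_mono) simp
    moreover have "ennreal (C ^ d) * (hausdorff_pre d \<epsilon> (f ` A) / ennreal (C ^ d)) = hausdorff_pre d \<epsilon> (f ` A)"
      using C by (simp add: ennreal_times_divide mult.commute[of "ennreal _"] mult_divide_eq_ennreal)
    ultimately show ?thesis by simp
  qed
  show ?thesis
    unfolding hausdorff_outer_def[of _ "f ` A"]
  proof (rule SUP_least)
    fix \<epsilon> :: real assume "\<epsilon> \<in> {0<..}"
    then show "hausdorff_pre d \<epsilon> (f ` A) \<le> ennreal (C ^ d) * hausdorff_outer d A"
      using C by (intro order_trans[OF pre] mult_left_mono hausdorff_pre_le_outer) auto
  qed
qed


lemma hausdorff_outer_isometry:
  fixes f :: "'a::metric_space \<Rightarrow> 'b::metric_space"
  assumes f: "\<And>x y. x \<in> A \<Longrightarrow> y \<in> A \<Longrightarrow> dist (f x) (f y) = dist x y"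
  shows "hausdorff_outer d (f ` A) = hausdorff_outer d A"
proof (rule antisym)
  show "hausdorff_outer d (f ` A) \<le> hausdorff_outer d A"
    using hausdorff_outer_lipschitz[of 1 A f d] f by simp
  have inj: "inj_on f A" using f by (metis dist_eq_0_iff inj_onI)
  have "hausdorff_outer d (inv_into A f ` (f ` A)) \<le> ennreal (1 ^ d) * hausdorff_outer d (f ` A)"
  proof (rule hausdorff_outer_lipschitz)
    fix x y assume "x \<in> f ` A" "y \<in> f ` A"
    then show "dist (inv_into A f x) (inv_into A f y) \<le> 1 * dist x y" using inj f by auto
  qed simp
  then show "hausdorff_outer d A \<le> hausdorff_outer d (f ` A)"
    using inj by (simp add: image_comp o_def)
qed

section \<open>Normalisation by a facet of the cube\<close>

lemma hausdorff_pre_finite_cover: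
  fixes A :: "'a::metric_space set"
  assumes I: "finite I" "A \<subseteq> (\<Union>i\<in>I. U i)" and r: "r \<ge> 0"
    and U: "\<And>i. i \<in> I \<Longrightarrow> bounded (U i)" "\<And>i. i \<in> I \<Longrightarrow> diameter (U i) \<le> r"
  shows "hausdorff_pre d r A \<le> of_nat (card I) * ennreal (r ^ d)"
proof -
  obtain h where h: "bij_betw h {0..<card I} I" using ex_bij_betw_nat_finite[OF I(1)] by blast
  define V where "V n = (if n < card I then U (h n) else {})" for n
  have hI: "h n \<in> I" if "n < card I" for n using h that by (auto simp: bij_betw_def)
  have "A \<subseteq> (\<Union>n. V n)"
  proof
    fix x assume "x \<in> A"
    then obtain i where "i \<in> I" "x \<in> U i" using I by blast
    then have "i \<in> h ` {0..<card I}" using h by (simp add: bij_betw_def)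
    then obtain n where "n < card I" "h n = i" by auto
    then show "x \<in> (\<Union>n. V n)" using \<open>x \<in> U i\<close> by (auto simp: V_def intro!: exI[of _ n])
  qed
  then have "hausdorff_pre d r A \<le> (\<Sum>n. cover_weight d (V n))"
    by (rule hausdorff_pre_le) (use U hI r in \<open>auto simp: V_def\<close>)
  also have "\<dots> = (\<Sum>n<card I. cover_weight d (V n))"
    by (rule suminf_finite) (auto simp: V_def)
  also have "\<dots> \<le> (\<Sum>n<card I. ennreal (r ^ d))"
    by (intro sum_mono) (use U hI diameter_ge_0 in \<open>auto simp: V_def intro!: ennreal_leI power_mono\<close>)
  also have "\<dots> = of_nat (card I) * ennreal (r ^ d)" by simp
  finally show ?thesis .
qed

text \<open>A grid of mesh \<open>1 / N\<close> needs about \<open>N ^ (n - 1)\<close> cells of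
  diameter at most \<open>n / N\<close>. The powers of \<open>N\<close> cancel, which leaves a bound
  independent of the scale.\<close>

lemma hausdorff_unit_facet_finite:
  "hausdorff_outer (CARD('n) - 1) (unit_facet :: (real^'n) set) \<noteq> top"
proof -
  define k where "k = (SOME k::'n. True)"
  define n where "n = CARD('n)"
  have pre: "hausdorff_pre (n - 1) (real n / real N) (unit_facet :: (real^'n) set) \<le> ennreal ((2 * real n) ^ (n - 1))"
    if N: "N > 0" for N
  proof -
    \<comment> \<open>The index \<open>N\<close> serves coordinates equal to \<open>1\<close>, hence
      \<open>N + 1\<close> values. The coordinate \<open>k\<close> is constantly \<open>0\<close>
      and keeps a single value, which makes the exponent \<open>n - 1\<close>.\<close>
    define I where "I = (PiE UNIV (\<lambda>i::'n. if i = k then {0} else {..N}))"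
    define U where "U q = {x::real^'n. \<forall>i. real (q i) / N \<le> x$i \<and> x$i \<le> (real (q i) + 1) / N}" for q
    have card: "card I = (N + 1) ^ (n - 1)"
    proof -
      have "card I = (\<Prod>i\<in>UNIV. if i = k then 1 else N + 1)"
        unfolding I_def by (subst card_PiE) (auto intro!: prod.cong)
      also have "\<dots> = (N + 1) ^ (n - 1)"
        by (subst prod.remove[of _ k]) (auto simp: n_def)
      finally show ?thesis .
    qed
    have dU: "dist x y \<le> real n / real N" if "x \<in> U q" "y \<in> U q" for x y q
    proof -
      have "\<bar>(x - y)$i\<bar> \<le> 1 / N" for i
      proof -
        have "real (q i) / N \<le> x$i" "x$i \<le> real (q i) / N + 1 / N" "real (q i) / N \<le> y$i" "y$i \<le> real (q i) / N + 1 / N"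
          using that by (auto simp: U_def add_divide_distrib)
        then show ?thesis by simp
      qed
      then have "(\<Sum>i\<in>UNIV. \<bar>(x - y)$i\<bar>) \<le> (\<Sum>i\<in>(UNIV::'n set). 1 / N)" by (intro sum_mono) auto
      then show ?thesis using norm_le_l1_cart[of "x - y"] by (simp add: dist_norm n_def)
    qed
    have "hausdorff_pre (n - 1) (real n / N) (unit_facet :: (real^'n) set) \<le> of_nat (card I) * ennreal ((real n / N) ^ (n - 1))"
    proof (rule hausdorff_pre_finite_cover)
      show "finite I" unfolding I_def by (intro finite_PiE) auto
      show "bounded (U q)" for q unfolding bounded_two_points using dU by blast
      show "diameter (U q) \<le> real n / N" for q
        using dU N by (intro diameter_le) (auto simp: dist_norm)
      show "unit_facet \<subseteq> (\<Union>q\<in>I. U q)"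
      proof
        fix x :: "real^'n" assume x: "x \<in> unit_facet"
        define q where "q i = nat \<lfloor>N * x$i\<rfloor>" for i
        have x': "0 \<le> x$i" "x$i \<le> 1" for i using x by (auto simp: unit_facet_def)
        have xk: "x$k = 0" using x by (auto simp: unit_facet_def k_def)
        have q: "real (q i) = of_int \<lfloor>N * x$i\<rfloor>" for i using x'[of i] by (simp add: q_def)
        have "q i \<le> N" for i
        proof -
          have "real (q i) \<le> N * x$i" unfolding q by linarith
          also have "\<dots> \<le> N" using x'[of i] by (simp add: mult_left_le)
          finally show ?thesis by simp
        qed
        moreover have "q k = 0" by (simp add: q_def xk)
        ultimately have "q \<in> I" by (auto simp: I_def)
        moreover have "x \<in> U q"
          unfolding U_def
        proof (intro CollectI allI)
          fix i
          have "real (q i) \<le> N * x$i" "N * x$i \<le> real (q i) + 1" unfolding q by linarith+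
          then show "real (q i) / N \<le> x$i \<and> x$i \<le> (real (q i) + 1) / N" using N by (simp add: field_simps)
        qed
        ultimately show "x \<in> (\<Union>q\<in>I. U q)" by blast
      qed
    qed simp
    also have "\<dots> = ennreal (real (card I) * (real n / N) ^ (n - 1))"
      by (simp add: ennreal_of_nat_eq_real_of_nat ennreal_mult)
    also have "real (card I) * (real n / N) ^ (n - 1) = ((real N + 1) * (real n / N)) ^ (n - 1)"
      by (simp only: card power_mult_distrib of_nat_power of_nat_add of_nat_1)
    also have "ennreal \<dots> \<le> ennreal ((2 * real n) ^ (n - 1))"
      using N mult_right_mono[of 1 "real N" "real n"] by (intro ennreal_leI power_mono) (auto simp: field_simps)
    finally show ?thesis .
  qed
  have "hausdorff_outer (n - 1) (unit_facet :: (real^'n) set) \<le> ennreal ((2 * real n) ^ (n - 1))"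
    unfolding hausdorff_outer_def
  proof (rule SUP_least)
    fix \<epsilon> :: real assume "\<epsilon> \<in> {0<..}"
    obtain N where N': "real n / \<epsilon> < real N" using reals_Archimedean2 by blast
    moreover have "0 \<le> real n / \<epsilon>" using \<open>\<epsilon> \<in> _\<close> by simp
    ultimately have N: "N > 0" by (metis gr0I not_le of_nat_0)
    with N' have "real n / real N \<le> \<epsilon>" using \<open>\<epsilon> \<in> _\<close> by (simp add: field_simps)
    then show "hausdorff_pre (n - 1) \<epsilon> (unit_facet :: (real^'n) set) \<le> ennreal ((2 * real n) ^ (n - 1))"
      by (intro order_trans[OF hausdorff_pre_antimono pre[OF N]])
  qed
  then show ?thesis by (auto simp: n_def top_unique)
qed

lemma prod_if_eq: "(\<Prod>j\<in>(UNIV::'n::finite set). if j = k then 1 else c) = (c::real) ^ (CARD('n) - 1)"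
  by (subst prod.remove[of _ k]) auto

lemma emeasure_cbox_cart:
  fixes a b :: "real^'n"
  assumes "\<And>i. a$i \<le> b$i"
  shows "emeasure lborel (cbox a b) = ennreal (\<Prod>i\<in>UNIV. b$i - a$i)"
proof -
  have "cbox a b \<noteq> {}" using assms by (simp add: interval_ne_empty_cart)
  then have "measure lborel (cbox a b) = (\<Prod>i\<in>UNIV. b$i - a$i)" by (rule content_cbox_cart)
  then show ?thesis
    using emeasure_lborel_cbox_finite[of a b] by (simp add: emeasure_eq_ennreal_measure)
qed

text \<open>Thickening by unit length in the missing direction \<open>k\<close> turns a cover of the
  facet into a cover of the unit cube by boxes. Their volumes are at most \<open>2 ^ m\<close> times
  the weights of the cover sets, and the cube has volume \<open>1\<close>.\<close>

lemma hausdorff_unit_facet_pos: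
  "hausdorff_outer (CARD('n) - 1) (unit_facet :: (real^'n) set) \<noteq> 0"
proof -
  define k where "k = (SOME k::'n. True)"
  define m where "m = CARD('n) - 1"
  have "1 / ennreal (2 ^ m) \<le> hausdorff_pre m 1 (unit_facet :: (real^'n) set)"
  proof (rule hausdorff_pre_geI)
    fix U :: "nat \<Rightarrow> (real^'n) set"
    assume U: "unit_facet \<subseteq> (\<Union>i. U i)" "\<And>i. bounded (U i)" "\<And>i. diameter (U i) \<le> 1"
    define p where "p i = (SOME x. x \<in> U i)" for i
    define Z where "Z i = (if U i = {} then {} else cbox (\<chi> j. if j = k then 0 else p i$j - diameter (U i))
       (\<chi> j. if j = k then 1 else p i$j + diameter (U i)))" for i
    have p: "p i \<in> U i" if "U i \<noteq> {}" for i using that unfolding p_def by (simp add: some_in_eq)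
    have eZ: "emeasure lborel (Z i) \<le> ennreal (2 ^ m) * cover_weight m (U i)" for i
    proof (cases "U i = {}")
      case False
      have d: "0 \<le> diameter (U i)" by (rule diameter_ge_0[OF U(2)])
      have "emeasure lborel (Z i) = ennreal (\<Prod>j\<in>UNIV. if j = k then 1 else 2 * diameter (U i))"
        using False d unfolding Z_def
        by (simp, subst emeasure_cbox_cart) (auto intro!: arg_cong[where f=ennreal] prod.cong split: if_splits)
      then show ?thesis using False d
        by (simp add: prod_if_eq m_def power_mult_distrib ennreal_mult[symmetric])
    qed (simp add: Z_def)
    have cov: "cbox 0 (\<chi> j. 1) \<subseteq> (\<Union>i. Z i)"
    proof
      fix z :: "real^'n" assume "z \<in> cbox 0 (\<chi> j. 1)"
      then have z: "0 \<le> z$j" "z$j \<le> 1" for j by (auto simp: mem_box_cart)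
      define x where "x = (\<chi> j. if j = k then 0 else z$j)"
      have "x \<in> unit_facet" using z by (auto simp: unit_facet_def x_def k_def)
      then obtain i where i: "x \<in> U i" using U by blast
      then have "dist x (p i) \<le> diameter (U i)" using p[of i] by (intro diameter_bounded_bound[OF U(2)]) auto
      then have xp: "\<bar>x$j - p i$j\<bar> \<le> diameter (U i)" for j
        using component_le_norm_cart[of "x - p i" j] by (simp add: dist_norm)
      have "p i $ j - diameter (U i) \<le> z$j \<and> z$j \<le> p i $ j + diameter (U i)" if "j \<noteq> k" for j
        using xp[of j] that unfolding x_def abs_le_iff by simp
      then have "z \<in> Z i" using i z unfolding Z_def by (auto simp: mem_box_cart)
      then show "z \<in> (\<Union>i. Z i)" by blast
    qed
    have "1 = emeasure lborel (cbox 0 (\<chi> j. 1) :: (real^'n) set)"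
      by (subst emeasure_cbox_cart) auto
    also have "\<dots> \<le> emeasure lborel (\<Union>i. Z i)"
      by (rule emeasure_mono[OF cov]) (auto simp: Z_def intro!: sets.countable_UN)
    also have "\<dots> \<le> (\<Sum>i. emeasure lborel (Z i))"
      by (rule emeasure_subadditive_countably) (auto simp: Z_def)
    also have "\<dots> \<le> (\<Sum>i. ennreal (2 ^ m) * cover_weight m (U i))"
      by (intro suminf_le eZ) auto
    also have "\<dots> = ennreal (2 ^ m) * (\<Sum>i. cover_weight m (U i))" by (rule ennreal_suminf_cmult)
    finally show "1 / ennreal (2 ^ m) \<le> (\<Sum>i. cover_weight m (U i))"
      by (simp add: divide_le_posI_ennreal mult.commute)
  qed
  also have "\<dots> \<le> hausdorff_outer m (unit_facet :: (real^'n) set)" by (rule hausdorff_pre_le_outer) simp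
  finally show ?thesis
    by (auto simp: m_def ennreal_divide_eq_0_iff)
qed

section \<open>Surface measure on Borel sets\<close>

lemma sets_hausdorff_surface [simp, measurable_cong]: "sets hausdorff_surface = sets borel"
  by (simp add: hausdorff_surface_def sets.sigma_sets_eq[of borel, simplified])

lemma space_hausdorff_surface [simp]: "space hausdorff_surface = UNIV"
  by (simp add: hausdorff_surface_def)

lemma emeasure_hausdorff_surface:
  fixes A :: "(real^'n) set"
  assumes "A \<in> sets borel"
  shows "emeasure hausdorff_surface A =
    hausdorff_outer (CARD('n) - 1) A / hausdorff_outer (CARD('n) - 1) (unit_facet :: (real^'n) set)"
proof -
  let ?H = "hausdorff_outer (CARD('n) - 1) :: (real^'n) set \<Rightarrow> ennreal"
  have ms: "sigma_algebra UNIV (sets (borel :: (real^'n) measure))" "countably_additive (sets borel) ?H"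
    using measure_space_hausdorff_outer[of "CARD('n) - 1"] by (auto simp: measure_space_def)
  show ?thesis
    unfolding hausdorff_surface_def
  proof (rule emeasure_measure_of_sigma[OF ms(1) _ _ assms])
    show "positive (sets borel) (\<lambda>A. ?H A / ?H unit_facet)" by (simp add: positive_def)
    show "countably_additive (sets borel) (\<lambda>A. ?H A / ?H unit_facet)"
      unfolding countably_additive_def
    proof (intro allI impI)
      fix A :: "nat \<Rightarrow> (real^'n) set"
      assume A: "range A \<subseteq> sets borel" "disjoint_family A" "(\<Union>i. A i) \<in> sets borel"
      have "(\<Sum>i. ?H (A i) / ?H unit_facet) = (\<Sum>i. ?H (A i)) / ?H unit_facet"
        by (simp add: divide_ennreal_def)
      then show "(\<Sum>i. ?H (A i) / ?H unit_facet) = ?H (\<Union>i. A i) / ?H unit_facet"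
        using ms(2) A by (simp add: countably_additive_def)
    qed
  qed
qed

lemma emeasure_hausdorff_surface_lipschitz:
  fixes f :: "real^'n \<Rightarrow> real^'n"
  assumes C: "C > 0" and f: "\<And>x y. x \<in> A \<Longrightarrow> y \<in> A \<Longrightarrow> dist (f x) (f y) \<le> C * dist x y"
    and A: "A \<in> sets borel" "f ` A \<in> sets borel"
  shows "emeasure hausdorff_surface (f ` A) \<le> ennreal (C ^ (CARD('n) - 1)) * emeasure hausdorff_surface A"
  using hausdorff_outer_lipschitz[OF C f, of A "CARD('n) - 1"]
  by (simp add: emeasure_hausdorff_surface A divide_right_mono_ennreal ennreal_times_divide)

lemma emeasure_hausdorff_surface_isometry:
  fixes f :: "real^'n \<Rightarrow> real^'n"
  assumes f: "\<And>x y. x \<in> A \<Longrightarrow> y \<in> A \<Longrightarrow> dist (f x) (f y) = dist x y"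
    and A: "A \<in> sets borel" "f ` A \<in> sets borel"
  shows "emeasure hausdorff_surface (f ` A) = emeasure hausdorff_surface A"
  using hausdorff_outer_isometry[OF f, of A "CARD('n) - 1"]
  by (simp add: emeasure_hausdorff_surface A)

text \<open>
  Two translation invariant measures on a group are proportional: integrate
  \<open>indicator A x * indicator B (x + y)\<close> in both orders.
\<close>

lemma invariant_measures_proportional:
  fixes M N :: "'a::euclidean_space measure"
  assumes "sigma_finite_measure M" "sigma_finite_measure N"
    and [measurable_cong, simp]: "sets M = sets borel" "sets N = sets borel"
    and V: "AE x in M. x \<in> V" "AE x in N. x \<in> V" "\<And>p. p \<in> V \<Longrightarrow> - p \<in> V"
    and M: "\<And>p. p \<in> V \<Longrightarrow> distr M borel (\<lambda>x. x + p) = M"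
    and N: "\<And>p. p \<in> V \<Longrightarrow> distr N borel (\<lambda>x. x + p) = N"
    and [measurable]: "A \<in> sets borel" "B \<in> sets borel"
  shows "emeasure M A * emeasure N B = emeasure M B * emeasure N (uminus -` A)"
proof -
  interpret M: sigma_finite_measure M by fact
  interpret N: sigma_finite_measure N by fact
  interpret pair_sigma_finite M N ..
  have shift: "(\<integral>\<^sup>+x. f (x + p) \<partial>L) = (\<integral>\<^sup>+x. f x \<partial>L)"
    if "distr L borel (\<lambda>x. x + p) = L" "f \<in> borel_measurable borel" and [measurable_cong, simp]: "sets L = sets borel"
    for L :: "'a measure" and f and p
  proof -
    have "(\<integral>\<^sup>+x. f x \<partial>distr L borel (\<lambda>x. x + p)) = (\<integral>\<^sup>+x. f (x + p) \<partial>L)"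
      using that(2) by (subst nn_integral_distr) auto
    then show ?thesis using that(1) by simp
  qed
  have "emeasure M A * emeasure N B = (\<integral>\<^sup>+x. indicator A x * emeasure N B \<partial>M)"
    by (subst nn_integral_multc) auto
  also have "\<dots> = (\<integral>\<^sup>+x. \<integral>\<^sup>+y. indicator A x * indicator B (y + x) \<partial>N \<partial>M)"
  proof (rule nn_integral_cong_AE, use V(1) in eventually_elim)
    fix x assume "x \<in> V"
    have "(\<integral>\<^sup>+y. indicator A x * indicator B (y + x) \<partial>N) = indicator A x * (\<integral>\<^sup>+y. indicator B (y + x) \<partial>N)"
      by (rule nn_integral_cmult) measurable
    also have "(\<integral>\<^sup>+y. indicator B (y + x) \<partial>N) = (\<integral>\<^sup>+y. indicator B y \<partial>N)"
      by (rule shift[OF N[OF \<open>x \<in> V\<close>]]) auto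
    finally show "indicator A x * emeasure N B = (\<integral>\<^sup>+y. indicator A x * indicator B (y + x) \<partial>N)" by simp
  qed
  also have "\<dots> = (\<integral>\<^sup>+y. \<integral>\<^sup>+x. indicator A x * indicator B (y + x) \<partial>M \<partial>N)"
    by (rule Fubini'[symmetric]) measurable
  also have "\<dots> = (\<integral>\<^sup>+y. \<integral>\<^sup>+x. indicator A (x - y) * indicator B x \<partial>M \<partial>N)"
  proof (rule nn_integral_cong_AE, use V(2) in eventually_elim)
    fix y assume "y \<in> V"
    have "(\<integral>\<^sup>+x. indicator A x * indicator B (y + x) \<partial>M) = (\<integral>\<^sup>+x. indicator A ((x + y) - y) * indicator B (x + y) \<partial>M)"
      by (simp add: add.commute)
    also have "\<dots> = (\<integral>\<^sup>+x. indicator A (x - y) * indicator B x \<partial>M)"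
      by (rule shift[OF M[OF \<open>y \<in> V\<close>]]) auto
    finally show "(\<integral>\<^sup>+x. indicator A x * indicator B (y + x) \<partial>M) = (\<integral>\<^sup>+x. indicator A (x - y) * indicator B x \<partial>M)" .
  qed
  also have "\<dots> = (\<integral>\<^sup>+x. \<integral>\<^sup>+y. indicator A (x - y) * indicator B x \<partial>N \<partial>M)"
    by (rule Fubini') measurable
  also have "\<dots> = (\<integral>\<^sup>+x. indicator B x * emeasure N (uminus -` A) \<partial>M)"
  proof (rule nn_integral_cong_AE, use V(1) in eventually_elim)
    fix x assume "x \<in> V"
    have "(\<integral>\<^sup>+y. indicator A (x - y) * indicator B x \<partial>N) = (\<integral>\<^sup>+y. indicator A (x - y) \<partial>N) * indicator B x"
      by (rule nn_integral_multc) measurable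
    also have "(\<integral>\<^sup>+y. indicator A (x - y) \<partial>N) = (\<integral>\<^sup>+y. indicator A (- (y + - x)) \<partial>N)"
      by simp
    also have "\<dots> = (\<integral>\<^sup>+y. indicator A (- y) \<partial>N)"
      by (rule shift[OF N[OF V(3)[OF \<open>x \<in> V\<close>]]]) auto
    also have "\<dots> = (\<integral>\<^sup>+y. indicator (uminus -` A) y \<partial>N)"
      by (rule nn_integral_cong) (auto simp: indicator_def)
    also have "\<dots> = emeasure N (uminus -` A)"
      using measurable_sets[of "uminus :: 'a \<Rightarrow> 'a" borel borel A] by (intro nn_integral_indicator) auto
    finally show "(\<integral>\<^sup>+y. indicator A (x - y) * indicator B x \<partial>N) = indicator B x * emeasure N (uminus -` A)"
      by (simp add: mult.commute)
  qed
  also have "\<dots> = emeasure M B * emeasure N (uminus -` A)"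
    by (subst nn_integral_multc) auto
  finally show ?thesis .
qed

subsection \<open>Projection along a direction\<close>


lemma nn_integral_lborel_shift:
  assumes [measurable]: "f \<in> borel_measurable borel"
  shows "(\<integral>\<^sup>+x. f (x + c) \<partial>lborel) = (\<integral>\<^sup>+x. f x \<partial>(lborel :: 'a::euclidean_space measure))"
proof -
  have "(\<integral>\<^sup>+x. f x \<partial>distr lborel borel ((+) c)) = (\<integral>\<^sup>+x. f (c + x) \<partial>lborel)"
    by (rule nn_integral_distr) auto
  then show ?thesis by (simp add: lborel_distr_plus add.commute)
qed

lemma distr_lborel_shift: "distr lborel borel (\<lambda>x. x + c) = (lborel :: 'a::euclidean_space measure)"
proof -
  have "(\<lambda>x. x + c) = (+) c" by (simp add: fun_eq_iff add.commute)
  then show ?thesis by (simp add: lborel_distr_plus)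
qed

lemma integral_lborel_shift:
  fixes f :: "'a::euclidean_space \<Rightarrow> real"
  assumes "f \<in> borel_measurable borel"
  shows "(LINT x|lborel. f (x + c)) = (LINT x|lborel. f x)"
proof -
  have "(LINT x|distr lborel borel (\<lambda>x. x + c). f x) = (LINT x|lborel. f (x + c))"
    by (rule integral_distr) (use assms in auto)
  then show ?thesis by (simp only: distr_lborel_shift)
qed

lemma sigma_finite_if_finite_on_balls:
  fixes M :: "'a::euclidean_space measure"
  assumes M: "sets M = sets borel" and fin: "\<And>n::nat. emeasure M (cball 0 (real n)) \<noteq> \<infinity>"
  shows "sigma_finite_measure M"
proof
  have "\<exists>n::nat. x \<in> cball 0 (real n)" for x :: 'a
    using real_arch_simple[of "norm x"] by auto
  then show "\<exists>A. countable A \<and> A \<subseteq> sets M \<and> \<Union>A = space M \<and> (\<forall>a\<in>A. emeasure M a \<noteq> \<infinity>)"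
    using fin M sets_eq_imp_space_eq[OF M]
    by (intro exI[of _ "range (\<lambda>n::nat. cball 0 (real n))"]) auto
qed

lemma orthogonal_transformation_measurable:
  "orthogonal_transformation f \<Longrightarrow> f \<in> borel_measurable borel" for f :: "'a::euclidean_space \<Rightarrow> 'a"
  by (rule borel_measurable_continuous_onI)
    (simp add: linear_continuous_on linear_conv_bounded_linear[symmetric] orthogonal_transformation_linear)

text \<open>The image measure is again translation invariant, because \<open>f\<close> is additive
  and onto, and it agrees with Lebesgue measure on balls around \<open>0\<close>; so the factor of
  proportionality is \<open>1\<close>. Proportionality comes with a reflected set on one side;
  comparing Lebesgue measure with itself removes the reflection.\<close>

lemma distr_lborel_orthogonal_transformation:
  fixes f :: "'a::euclidean_space \<Rightarrow> 'a"
  assumes f: "orthogonal_transformation f"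
  shows "distr lborel borel f = lborel"
proof (rule measure_eqI)
  note [measurable] = orthogonal_transformation_measurable[OF f]
  let ?N = "distr lborel borel f"
  have ball: "emeasure ?N (cball 0 r) = emeasure lborel (cball (0::'a) r)" for r
  proof -
    have "f -` cball 0 r = cball 0 r"
      using orthogonal_transformation_norm[OF f] by auto
    then show ?thesis by (simp add: emeasure_distr)
  qed
  have shiftN: "distr ?N borel (\<lambda>x. x + p) = ?N" for p
  proof -
    obtain q where q: "f q = p" using orthogonal_transformation_surj[OF f] by (metis surjD)
    have "distr ?N borel (\<lambda>x. x + p) = distr lborel borel (\<lambda>x. f (x + q))"
      using orthogonal_transformation_linear[OF f] by (subst distr_distr) (auto simp: o_def linear_add q)
    also have "\<dots> = distr (distr lborel borel (\<lambda>x. x + q)) borel f"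
      by (subst distr_distr) (auto simp: o_def)
    finally show ?thesis by (simp only: distr_lborel_shift)
  qed
  have c: "0 < emeasure lborel (cball (0::'a) 1)" "emeasure lborel (cball (0::'a) 1) < top"
    using content_cball_pos[of 1 "0::'a"] emeasure_lborel_cball_finite[of "0::'a" 1]
    by (auto simp: measure_def zero_less_iff_neq_zero)
  have sN: "sigma_finite_measure ?N"
    by (rule sigma_finite_if_finite_on_balls) (use ball emeasure_lborel_cball_finite in \<open>auto simp: less_top\<close>)
  show sets: "sets ?N = sets lborel" by simp
  fix A assume "A \<in> sets ?N"
  then have A: "A \<in> sets borel" "uminus -` A \<in> sets borel"
    using measurable_sets[of "uminus :: 'a \<Rightarrow> 'a" borel borel A] by auto
  have unique: "emeasure lborel A = emeasure L (uminus -` A)"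
    if A: "A \<in> sets borel" and L: "sigma_finite_measure L" "sets L = sets borel" "\<And>p. distr L borel (\<lambda>x. x + p) = L"
      and B: "emeasure L (cball 0 1) = emeasure lborel (cball (0::'a) 1)"
    for L and A :: "'a set"
  proof -
    have "emeasure lborel A * emeasure L (cball 0 1) = emeasure lborel (cball (0::'a) 1) * emeasure L (uminus -` A)"
      by (rule invariant_measures_proportional[where V=UNIV, OF sigma_finite_lborel L(1) _ L(2)])
         (simp_all add: A L distr_lborel_shift)
    then have "emeasure lborel A * emeasure lborel (cball (0::'a) 1) / emeasure lborel (cball (0::'a) 1)
      = emeasure L (uminus -` A) * emeasure lborel (cball (0::'a) 1) / emeasure lborel (cball (0::'a) 1)"
      by (simp add: B mult.commute)
    then show ?thesis
      using c by (simp add: mult_divide_eq_ennreal)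
  qed
  have "emeasure ?N A = emeasure ?N (uminus -` (uminus -` A))" by (simp add: vimage_comp o_def)
  also have "\<dots> = emeasure lborel (uminus -` A)"
    by (rule unique[OF A(2) sN _ shiftN, symmetric]) (simp_all add: ball)
  also have "\<dots> = emeasure lborel A"
    by (rule unique[OF A(1) sigma_finite_lborel _ distr_lborel_shift, symmetric]) simp_all
  finally show "emeasure ?N A = emeasure lborel A" .
qed

section \<open>Slabs and area in hyperplanes\<close>

definition strip :: "'a::euclidean_space \<Rightarrow> 'a set" where
  "strip e = {z. 0 \<le> z \<bullet> e \<and> z \<bullet> e \<le> 1}"

definition orth_proj :: "'a::euclidean_space \<Rightarrow> 'a \<Rightarrow> 'a" where
  "orth_proj e z = z - (z \<bullet> e) *\<^sub>R e"

lemma closed_strip: "closed (strip e)"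
  unfolding strip_def by (intro closed_Collect_conj closed_Collect_le continuous_intros)

lemma strip_borel [measurable]: "strip e \<in> sets borel"
  by (rule borel_closed[OF closed_strip])

lemma orth_proj_measurable [measurable]: "orth_proj e \<in> borel_measurable borel"
  unfolding orth_proj_def by measurable

lemma orth_proj_inner: "norm e = 1 \<Longrightarrow> orth_proj e z \<bullet> e = 0"
  by (simp add: orth_proj_def inner_diff_left dot_square_norm)

lemma orth_proj_shift: "norm e = 1 \<Longrightarrow> orth_proj e (z + s *\<^sub>R e) = orth_proj e z"
  by (simp add: orth_proj_def inner_add_left dot_square_norm algebra_simps)

lemma orth_proj_diff: "orth_proj e x - orth_proj e y = orth_proj e (x - y)"
  by (simp add: orth_proj_def inner_diff_left algebra_simps)

lemma norm_orth_proj: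
  assumes "norm e = 1"
  shows "(norm (orth_proj e z))\<^sup>2 = (norm z)\<^sup>2 - (z \<bullet> e)\<^sup>2"
proof -
  have "e \<bullet> e = 1" using assms by (simp add: norm_eq_1)
  then show ?thesis
    unfolding power2_norm_eq_inner orth_proj_def inner_diff_left inner_diff_right inner_scaleR_left inner_scaleR_right
    by (simp only: inner_commute[of e z] power2_eq_square) simp
qed

lemma norm_orth_proj_le: "norm e = 1 \<Longrightarrow> norm (orth_proj e z) \<le> norm z"
  by (rule power2_le_imp_le) (simp_all add: norm_orth_proj)

lemma orth_proj_id: "z \<bullet> e = 0 \<Longrightarrow> orth_proj e z = z"
  by (simp add: orth_proj_def)

text \<open>For a unit vector \<open>e\<close> this is Lebesgue measure of dimension
  \<open>n - 1\<close> on the hyperplane orthogonal to \<open>e\<close>: the area of a set is the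
  volume of the slab of thickness one above it. In this form area needs no space of lower
  dimension.\<close>

definition flat_measure :: "'a::euclidean_space \<Rightarrow> 'a measure" where
  "flat_measure e = distr (density lborel (indicator (strip e))) borel (orth_proj e)"

lemma sets_flat_measure [simp, measurable_cong]: "sets (flat_measure e) = sets borel"
  by (simp add: flat_measure_def)

lemma emeasure_flat_measure_nn_integral:
  assumes A: "A \<in> sets borel"
  shows "emeasure (flat_measure e) A = (\<integral>\<^sup>+z. indicator (strip e) z * indicator A (orth_proj e z) \<partial>lborel)"
proof -
  have S: "orth_proj e -` A \<in> sets lborel" using measurable_sets[OF orth_proj_measurable A] by simp
  have "emeasure (flat_measure e) A = (\<integral>\<^sup>+z. indicator (strip e) z * indicator (orth_proj e -` A) z \<partial>lborel)"
    unfolding flat_measure_def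
    by (subst emeasure_distr) (use A emeasure_density[OF _ S] in auto)
  then show ?thesis by (simp add: indicator_def)
qed

lemma emeasure_flat_measure:
  assumes [measurable]: "A \<in> sets borel"
  shows "emeasure (flat_measure e) A = emeasure lborel {z \<in> strip e. orth_proj e z \<in> A}"
proof -
  have "emeasure (flat_measure e) A = (\<integral>\<^sup>+z. indicator {z \<in> strip e. orth_proj e z \<in> A} z \<partial>lborel)"
    unfolding emeasure_flat_measure_nn_integral[OF assms]
    by (intro nn_integral_cong) (auto simp: indicator_def)
  also have "\<dots> = emeasure lborel {z \<in> strip e. orth_proj e z \<in> A}"
    by (rule nn_integral_indicator) measurable
  finally show ?thesis .
qed

lemma flat_measure_shift:
  assumes p: "p \<bullet> e = 0"
  shows "distr (flat_measure e) borel (\<lambda>x. x + p) = flat_measure e"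
proof (rule measure_eqI)
  fix A assume "A \<in> sets (distr (flat_measure e) borel (\<lambda>x. x + p))"
  then have [measurable]: "A \<in> sets borel" by simp
  let ?f = "\<lambda>z. indicator (strip e) z * indicator A (orth_proj e z) :: ennreal"
  have "emeasure (distr (flat_measure e) borel (\<lambda>x. x + p)) A = emeasure (flat_measure e) ((\<lambda>x. x + p) -` A)"
    by (subst emeasure_distr) (auto simp: flat_measure_def)
  also have "\<dots> = (\<integral>\<^sup>+z. ?f (z + p) \<partial>lborel)"
    by (subst emeasure_flat_measure_nn_integral)
       (auto intro!: nn_integral_cong measurable_sets_borel[of _ borel] simp: indicator_def strip_def orth_proj_def inner_add_left p algebra_simps)
  also have "\<dots> = (\<integral>\<^sup>+z. ?f z \<partial>lborel)" by (rule nn_integral_lborel_shift) measurable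
  also have "\<dots> = emeasure (flat_measure e) A" by (rule emeasure_flat_measure_nn_integral[symmetric]) measurable
  finally show "emeasure (distr (flat_measure e) borel (\<lambda>x. x + p)) A = emeasure (flat_measure e) A" .
qed simp

lemma bounded_strip_orth_proj:
  assumes e: "norm e = 1" and "z \<in> strip e" "norm (orth_proj e z) \<le> r"
  shows "norm z \<le> r + 1"
proof -
  have "norm z = norm (orth_proj e z + (z \<bullet> e) *\<^sub>R e)" by (simp add: orth_proj_def)
  also have "\<dots> \<le> norm (orth_proj e z) + norm ((z \<bullet> e) *\<^sub>R e)" by (rule norm_triangle_ineq)
  also have "\<dots> \<le> r + 1" using assms by (auto simp: strip_def)
  finally show ?thesis .
qed

lemma sigma_finite_flat_measure:
  assumes e: "norm e = 1"
  shows "sigma_finite_measure (flat_measure e)"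
proof (rule sigma_finite_if_finite_on_balls)
  fix n :: nat
  have "emeasure lborel {z \<in> strip e. orth_proj e z \<in> cball 0 (real n)} \<le> emeasure lborel (cball 0 (real n + 1) :: 'a set)"
    by (rule emeasure_mono) (use bounded_strip_orth_proj[OF e] in auto)
  also have "\<dots> < \<infinity>" using emeasure_lborel_cball_finite by simp
  finally show "emeasure (flat_measure e) (cball 0 (real n)) \<noteq> \<infinity>"
    by (simp add: emeasure_flat_measure)
qed simp

lemma emeasure_density_indicator_le:
  assumes "S \<in> sets M" "A \<in> sets M"
  shows "emeasure (density M (indicator S)) A \<le> emeasure M A"
proof -
  have "emeasure (density M (indicator S)) A = (\<integral>\<^sup>+x. indicator S x * indicator A x \<partial>M)"
    by (rule emeasure_density) (use assms in auto)
  also have "\<dots> \<le> (\<integral>\<^sup>+x. indicator A x \<partial>M)"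
    by (intro nn_integral_mono) (auto simp: indicator_def)
  finally show ?thesis using assms by simp
qed

lemma sigma_finite_strip: "sigma_finite_measure (density lborel (indicator (strip e)) :: 'a::euclidean_space measure)"
proof (rule sigma_finite_if_finite_on_balls)
  fix n :: nat
  show "emeasure (density lborel (indicator (strip e)) :: 'a measure) (cball 0 (real n)) \<noteq> \<infinity>"
    using emeasure_density_indicator_le[of "strip e" lborel "cball 0 (real n)"]
      emeasure_lborel_cball_finite[of "0::'a" "real n"] by (auto simp: top_unique)
qed simp

text \<open>Fubini's theorem for lines in direction \<open>e\<close>, with base points in the slab
  instead of the hyperplane. The parametrisation has one dimension too many, but over a given point
  the admissible \<open>s\<close> fill an interval of length one, so nothing is counted twice. This
  is why the slab has thickness one.\<close>

lemma lborel_fubini_direction: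
  fixes e :: "'a::euclidean_space"
  assumes e: "norm e = 1"
  shows "distr (density lborel (indicator (strip e)) \<Otimes>\<^sub>M lborel) borel (\<lambda>(z, s). z + s *\<^sub>R e) = lborel"
proof (rule measure_eqI)
  let ?D = "density lborel (indicator (strip e)) :: 'a measure"
  interpret D: sigma_finite_measure ?D by (rule sigma_finite_strip)
  interpret pair_sigma_finite ?D "lborel :: real measure" ..
  fix A assume "A \<in> sets (distr (?D \<Otimes>\<^sub>M (lborel :: real measure)) borel (\<lambda>(z, s). z + s *\<^sub>R e))"
  then have [measurable]: "A \<in> sets borel" by simp
  have "emeasure (distr (?D \<Otimes>\<^sub>M (lborel :: real measure)) borel (\<lambda>(z, s). z + s *\<^sub>R e)) A
      = (\<integral>\<^sup>+x. indicator A x \<partial>distr (?D \<Otimes>\<^sub>M (lborel :: real measure)) borel (\<lambda>(z, s). z + s *\<^sub>R e))"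
    by simp
  also have "\<dots> = (\<integral>\<^sup>+p. indicator A (fst p + snd p *\<^sub>R e) \<partial>(?D \<Otimes>\<^sub>M lborel))"
    by (subst nn_integral_distr) (auto simp: split_beta')
  also have "\<dots> = (\<integral>\<^sup>+z. \<integral>\<^sup>+s. indicator A (z + s *\<^sub>R e) \<partial>lborel \<partial>?D)"
    by (subst lborel.nn_integral_fst[symmetric]) auto
  also have "\<dots> = (\<integral>\<^sup>+z. \<integral>\<^sup>+s. indicator (strip e) z * indicator A (z + s *\<^sub>R e) \<partial>lborel \<partial>lborel)"
    by (subst nn_integral_density) (auto simp: nn_integral_cmult)
  also have "\<dots> = (\<integral>\<^sup>+s. \<integral>\<^sup>+z. indicator (strip e) z * indicator A (z + s *\<^sub>R e) \<partial>lborel \<partial>lborel)"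
    by (rule lborel_pair.Fubini') measurable
  also have "\<dots> = (\<integral>\<^sup>+s. \<integral>\<^sup>+z. indicator (strip e) (z - s *\<^sub>R e) * indicator A z \<partial>lborel \<partial>lborel)"
  proof (rule nn_integral_cong)
    fix s :: real
    show "(\<integral>\<^sup>+z. indicator (strip e) z * indicator A (z + s *\<^sub>R e) \<partial>lborel) =
       (\<integral>\<^sup>+z. indicator (strip e) (z - s *\<^sub>R e) * indicator A z \<partial>lborel)"
      using nn_integral_lborel_shift[of "\<lambda>z. indicator (strip e) (z - s *\<^sub>R e) * indicator A z" "s *\<^sub>R e"] by simp
  qed
  also have "\<dots> = (\<integral>\<^sup>+z. \<integral>\<^sup>+s. indicator (strip e) (z - s *\<^sub>R e) * indicator A z \<partial>lborel \<partial>lborel)"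
    by (rule lborel_pair.Fubini') measurable
  also have "\<dots> = (\<integral>\<^sup>+z. indicator A z \<partial>lborel)"
  proof (rule nn_integral_cong)
    fix z :: 'a
    have "(\<integral>\<^sup>+s. indicator (strip e) (z - s *\<^sub>R e) * indicator A z \<partial>lborel) =
        (\<integral>\<^sup>+s. indicator {z \<bullet> e - 1 .. z \<bullet> e} s * indicator A z \<partial>lborel)"
      by (intro nn_integral_cong) (auto simp: indicator_def strip_def inner_diff_left dot_square_norm e)
    also have "\<dots> = indicator A z" by (subst nn_integral_multc) auto
    finally show "(\<integral>\<^sup>+s. indicator (strip e) (z - s *\<^sub>R e) * indicator A z \<partial>lborel) = indicator A z" .
  qed
  finally show "emeasure (distr (?D \<Otimes>\<^sub>M (lborel :: real measure)) borel (\<lambda>(z, s). z + s *\<^sub>R e)) A = emeasure lborel A"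
    by simp
qed simp

lemma unit_facet_eq_cbox:
  "(unit_facet :: (real^'n) set) = cbox 0 (\<chi> i. if i = (SOME k. True) then 0 else 1)"
proof (intro subset_antisym subsetI)
  fix x :: "real^'n" assume "x \<in> cbox 0 (\<chi> i. if i = (SOME k. True) then 0 else 1)"
  then have x: "0 \<le> x $ i" "x $ i \<le> (if i = (SOME k. True) then 0 else 1)" for i
    by (simp_all add: mem_box_cart)
  have "x $ i \<le> 1" for i using x(2)[of i] by (rule order_trans) simp
  moreover have "x $ (SOME k. True) = 0" using x[of "SOME k. True"] by simp
  ultimately show "x \<in> unit_facet" using x(1) by (simp add: unit_facet_def)
qed (simp add: unit_facet_def mem_box_cart)

text \<open>On the hyperplane \<open>V\<close> both measures are sigma-finite and invariant under
  translations by vectors of \<open>V\<close>, hence proportional. A rotated facet \<open>B\<close>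
  has measure \<open>1\<close> for both, which makes them equal.\<close>

lemma hausdorff_surface_hyperplane:
  fixes e :: "real^'n"
  assumes e: "norm e = 1" and A [measurable]: "A \<in> sets borel" and AV: "A \<subseteq> {z. z \<bullet> e = 0}"
  shows "emeasure hausdorff_surface A = emeasure (flat_measure e) A"
proof -
  define k where "k = (SOME k::'n. True)"
  define F where "F = (unit_facet :: (real^'n) set)"
  define d where "d = CARD('n) - 1"
  obtain g :: "real^'n \<Rightarrow> real^'n" where g: "orthogonal_transformation g" "g (axis k 1) = e"
    by (rule orthogonal_transformation_exists_1[of "axis k 1" e]) (simp_all add: e)
  have lin: "linear g" by (rule orthogonal_transformation_linear[OF g(1)])
  have inj: "inj g" by (rule orthogonal_transformation_inj[OF g(1)])
  have surj: "surj g" by (rule orthogonal_transformation_surj[OF g(1)])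
  have dist: "dist (g x) (g y) = dist x y" for x y
    using g(1) by (simp add: orthogonal_transformation_isometry)
  have gmeas [measurable]: "g \<in> borel_measurable borel" by (rule orthogonal_transformation_measurable[OF g(1)])
  have cont: "continuous_on S g" for S using lin by (simp add: linear_continuous_on linear_conv_bounded_linear)
  have ge: "g w \<bullet> e = w $ k" for w
    using g by (metis cart_eq_inner_axis orthogonal_transformation_def)
  define V where "V = {z. z \<bullet> e = 0}"
  have V [measurable]: "V \<in> sets borel"
    unfolding V_def by (intro borel_closed closed_Collect_eq continuous_intros)
  define M where "M = density hausdorff_surface (indicator V)"
  define B where "B = g ` F"
  have Fb [measurable]: "F \<in> sets borel" unfolding F_def unit_facet_eq_cbox by simp
  have Bb [measurable]: "B \<in> sets borel"
    unfolding B_def F_def unit_facet_eq_cbox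
    by (intro borel_closed compact_imp_closed compact_continuous_image cont compact_cbox)
  have BV: "B \<subseteq> V" by (auto simp: B_def V_def F_def unit_facet_def ge k_def)
  have setsM [simp, measurable_cong]: "sets M = sets borel" by (simp add: M_def)
  have M: "emeasure M C = emeasure hausdorff_surface (V \<inter> C)" if [measurable]: "C \<in> sets borel" for C
  proof -
    have "emeasure M C = (\<integral>\<^sup>+x. indicator V x * indicator C x \<partial>hausdorff_surface)"
      unfolding M_def by (rule emeasure_density) auto
    also have "\<dots> = (\<integral>\<^sup>+x. indicator (V \<inter> C) x \<partial>hausdorff_surface)"
      by (intro nn_integral_cong) (auto simp: indicator_def)
    finally show ?thesis by simp
  qed
  have F1: "emeasure hausdorff_surface F = 1"
    using hausdorff_unit_facet_pos[where 'n='n] hausdorff_unit_facet_finite[where 'n='n] Fb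
    by (simp add: emeasure_hausdorff_surface F_def ennreal_divide_self less_top[symmetric])
  have MB: "emeasure M B = 1"
  proof -
    have "emeasure M B = emeasure hausdorff_surface (g ` F)" using BV by (simp add: M Int_absorb1 B_def[symmetric])
    also have "\<dots> = emeasure hausdorff_surface F"
      by (rule emeasure_hausdorff_surface_isometry) (use dist Bb Fb in \<open>auto simp: B_def\<close>)
    finally show ?thesis by (simp add: F1)
  qed
  have NB: "emeasure (flat_measure e) B = 1"
  proof -
    \<comment> \<open>The slab above the rotated facet is the rotated unit cube, and rotations
      preserve volume.\<close>
    have "{z \<in> strip e. orth_proj e z \<in> B} = g ` cbox 0 (\<chi> i. 1)"
    proof (rule set_eqI)
      fix z
      obtain w where z: "z = g w" using surj by (metis surjD)
      have "orth_proj e z = g (w - (w $ k) *\<^sub>R axis k 1)"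
        by (simp add: orth_proj_def z ge linear_diff[OF lin] linear_scale[OF lin] g(2))
      then have "orth_proj e z \<in> B \<longleftrightarrow> w - (w $ k) *\<^sub>R axis k 1 \<in> F"
        unfolding B_def using inj by (simp add: inj_image_mem_iff)
      also have "\<dots> \<longleftrightarrow> (\<forall>i. i \<noteq> k \<longrightarrow> 0 \<le> w $ i \<and> w $ i \<le> 1)"
        by (auto simp: F_def unit_facet_def k_def[symmetric] axis_def)
      finally show "z \<in> {z \<in> strip e. orth_proj e z \<in> B} \<longleftrightarrow> z \<in> g ` cbox 0 (\<chi> i. 1)"
        using inj by (auto simp: z inj_image_mem_iff strip_def ge mem_box_cart)
    qed
    then have "emeasure (flat_measure e) B = emeasure lborel (g ` cbox 0 (\<chi> i. 1))"
      by (simp add: emeasure_flat_measure)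
    also have "\<dots> = emeasure (distr lborel borel g) (g ` cbox 0 (\<chi> i. 1))"
      by (simp add: distr_lborel_orthogonal_transformation[OF g(1)])
    also have "\<dots> = emeasure lborel (g -` g ` cbox 0 (\<chi> i. 1))"
    proof -
      have "g ` cbox 0 (\<chi> i. 1) \<in> sets borel"
        by (intro borel_closed compact_imp_closed compact_continuous_image cont compact_cbox)
      then show ?thesis by (subst emeasure_distr) auto
    qed
    also have "\<dots> = emeasure lborel (cbox 0 (\<chi> i. 1) :: (real^'n) set)"
      using inj by (simp add: inj_vimage_image_eq)
    also have "\<dots> = 1" by (subst emeasure_cbox_cart) auto
    finally show ?thesis .
  qed
  have sM: "sigma_finite_measure M"
  proof (rule sigma_finite_if_finite_on_balls[OF setsM])
    fix m :: nat
    \<comment> \<open>A ball of radius \<open>m\<close> in \<open>V\<close> fits into a facet scaled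
      by \<open>2 * m + 1\<close> and recentred by \<open>c\<close>; the extra \<open>1\<close>
      keeps the factor positive for \<open>m = 0\<close>.\<close>
    define c where "c = (\<chi> i. if i = k then 0 else real m)"
    define h where "h x = g ((2 * real m + 1) *\<^sub>R x - c)" for x
    have sub: "V \<inter> cball 0 (real m) \<subseteq> h ` F"
    proof
      fix z assume z: "z \<in> V \<inter> cball 0 (real m)"
      obtain w where w: "z = g w" using surj by (metis surjD)
      have wk: "w $ k = 0" using z ge by (simp add: V_def w)
      have "norm w \<le> m" using z orthogonal_transformation_norm[OF g(1)] by (simp add: w)
      then have wi: "\<bar>w $ i\<bar> \<le> m" for i using component_le_norm_cart order_trans by blast
      define x where "x = (1 / (2 * real m + 1)) *\<^sub>R (w + c)"
      have "x \<in> F"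
        unfolding F_def unit_facet_def k_def[symmetric]
      proof (intro CollectI conjI allI)
        show "x $ k = 0" by (simp add: x_def wk c_def)
        fix i
        have "- real m \<le> w $ i" "w $ i \<le> m" using wi[of i] by linarith+
        moreover have "x $ i = (w $ i + c $ i) / (2 * real m + 1)" by (simp add: x_def)
        ultimately show "0 \<le> x $ i" "x $ i \<le> 1" using wk
          by (auto simp: c_def divide_le_eq zero_le_divide_iff)
      qed
      moreover have "h x = z" by (simp add: h_def x_def w)
      ultimately show "z \<in> h ` F" by blast
    qed
    have "hausdorff_outer d (h ` F) \<le> ennreal ((2 * real m + 1) ^ d) * hausdorff_outer d F"
    proof (rule hausdorff_outer_lipschitz)
      fix x y
      have "dist (h x) (h y) = norm ((2 * real m + 1) *\<^sub>R (x - y))"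
        unfolding h_def dist by (simp add: dist_norm scaleR_diff_right)
      then show "dist (h x) (h y) \<le> (2 * real m + 1) * dist x y" by (simp add: dist_norm)
    qed simp
    also have "\<dots> < top" using hausdorff_unit_facet_finite[where 'n='n]
      by (simp add: F_def d_def less_top[symmetric] ennreal_mult_eq_top_iff)
    finally have "hausdorff_outer d (V \<inter> cball 0 (real m)) < top"
      using hausdorff_outer_mono[OF sub, of d] by simp
    then show "emeasure M (cball 0 (real m)) \<noteq> \<infinity>"
      using hausdorff_unit_facet_pos[where 'n='n]
      by (auto simp: M emeasure_hausdorff_surface d_def ennreal_divide_eq_top_iff)
  qed
  have shiftM: "distr M borel (\<lambda>x. x + p) = M" if p: "p \<in> V" for p
  proof (rule measure_eqI)
    fix C assume "C \<in> sets (distr M borel (\<lambda>x. x + p))"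
    then have [measurable]: "C \<in> sets borel" by simp
    have [measurable]: "(\<lambda>x. x + p) -` C \<in> sets borel"
      using measurable_sets[of "\<lambda>x. x + p" borel borel C] by simp
    have "emeasure (distr M borel (\<lambda>x. x + p)) C = emeasure M ((\<lambda>x. x + p) -` C)"
      by (subst emeasure_distr) (auto simp: sets_eq_imp_space_eq[OF setsM])
    also have "\<dots> = emeasure hausdorff_surface (V \<inter> (\<lambda>x. x + p) -` C)" by (simp add: M)
    also have "\<dots> = emeasure hausdorff_surface ((\<lambda>x. x + p) ` (V \<inter> (\<lambda>x. x + p) -` C))"
    proof (rule emeasure_hausdorff_surface_isometry[symmetric])
      have "(\<lambda>x. x + p) ` (V \<inter> (\<lambda>x. x + p) -` C) = V \<inter> C"
        using p by (auto simp: V_def inner_add_left inner_diff_left image_iff intro!: bexI[of _ "_ - p"])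
      then show "(\<lambda>x. x + p) ` (V \<inter> (\<lambda>x. x + p) -` C) \<in> sets borel" by simp
    qed auto
    also have "(\<lambda>x. x + p) ` (V \<inter> (\<lambda>x. x + p) -` C) = V \<inter> C"
      using p by (auto simp: V_def inner_add_left inner_diff_left image_iff intro!: bexI[of _ "_ - p"])
    finally show "emeasure (distr M borel (\<lambda>x. x + p)) C = emeasure M C" by (simp add: M)
  qed simp
  have aeM: "AE x in M. x \<in> V"
  proof (rule AE_I')
    show "- V \<in> null_sets M" by (auto simp: null_sets_def M)
  qed auto
  have aeN: "AE x in flat_measure e. x \<in> V"
  proof (rule AE_I')
    have "emeasure (flat_measure e) (- V) = emeasure lborel {z \<in> strip e. orth_proj e z \<in> - V}"
      by (rule emeasure_flat_measure) simp
    also have "{z \<in> strip e. orth_proj e z \<in> - V} = {}" by (auto simp: V_def orth_proj_inner e)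
    finally show "- V \<in> null_sets (flat_measure e)" by (simp add: null_sets_def)
  qed auto
  have negV: "- p \<in> V" if "p \<in> V" for p using that by (simp add: V_def)
  have shiftN: "distr (flat_measure e) borel (\<lambda>x. x + p) = flat_measure e" if "p \<in> V" for p
    using that by (intro flat_measure_shift) (simp add: V_def)
  \<comment> \<open>As for rotations, the second comparison, of \<open>flat_measure\<close> with
    itself, serves to remove the reflection of \<open>A\<close>.\<close>
  have "emeasure M A * emeasure (flat_measure e) B = emeasure M B * emeasure (flat_measure e) (uminus -` A)"
    by (rule invariant_measures_proportional[OF sM sigma_finite_flat_measure[OF e] setsM sets_flat_measure aeM aeN negV shiftM shiftN A Bb])
  moreover have "emeasure (flat_measure e) A * emeasure (flat_measure e) B =
      emeasure (flat_measure e) B * emeasure (flat_measure e) (uminus -` A)"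
    by (rule invariant_measures_proportional[OF sigma_finite_flat_measure[OF e] sigma_finite_flat_measure[OF e]
      sets_flat_measure sets_flat_measure aeN aeN negV shiftN shiftN A Bb])
  moreover have "emeasure M A = emeasure hausdorff_surface A"
    using AV by (simp add: M A V_def Int_absorb1)
  ultimately show ?thesis by (simp add: MB NB)
qed


section \<open>Line sections of a compact set\<close>

text \<open>The union of all lines in direction \<open>e\<close> that meet \<open>K\<close>: a
  cylinder in the whole space rather than a projection to a hyperplane, so that every point of the
  slab can serve as base point of its line.\<close>

definition shadow :: "'a::euclidean_space set \<Rightarrow> 'a \<Rightarrow> 'a set" where
  "shadow K e = {z. \<exists>s. z + s *\<^sub>R e \<in> K}"

definition height :: "'a::euclidean_space set \<Rightarrow> 'a \<Rightarrow> 'a \<Rightarrow> real" where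
  "height K e z = Sup {s. z + s *\<^sub>R e \<in> K}"

definition top_point :: "'a::euclidean_space set \<Rightarrow> 'a \<Rightarrow> 'a \<Rightarrow> 'a" where
  "top_point K e z = z + height K e z *\<^sub>R e"

lemma shadow_uminus: "shadow K (- e) = shadow K e"
  unfolding shadow_def by (intro Collect_cong) (metis scaleR_minus_left scaleR_minus_right minus_minus)

text \<open>The set is the sum of the compact set \<open>K\<close> and a closed subset
  \<open>T\<close> of the line spanned by \<open>e\<close>. The choice \<open>S = UNIV\<close> gives
  the shadow, \<open>S = {c..}\<close> the superlevel sets of the height.\<close>

lemma closed_shadow_over:
  fixes K :: "'a::euclidean_space set"
  assumes K: "compact K" and e: "norm e = 1" and S: "closed S"
  shows "closed {z. \<exists>s\<in>S. z + s *\<^sub>R e \<in> K}"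
proof -
  define T where "T = {y. y = (y \<bullet> e) *\<^sub>R e \<and> - (y \<bullet> e) \<in> S}"
  have ee: "e \<bullet> e = 1" using e by (simp add: norm_eq_1)
  have "closed ((\<lambda>y. - (y \<bullet> e)) -` S)"
    by (intro closed_vimage S continuous_intros)
  then have "closed T" unfolding T_def
    by (intro closed_Collect_conj closed_Collect_eq continuous_intros) (simp add: vimage_def)
  then have "closed (\<Union>x\<in>K. \<Union>y\<in>T. {x + y})" by (rule compact_closed_sums[OF K])
  also have "(\<Union>x\<in>K. \<Union>y\<in>T. {x + y}) = {z. \<exists>s\<in>S. z + s *\<^sub>R e \<in> K}"
  proof (intro subset_antisym subsetI)
    fix z assume "z \<in> (\<Union>x\<in>K. \<Union>y\<in>T. {x + y})"
    then obtain x y where xy: "x \<in> K" "y \<in> T" "z = x + y" by blast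
    then have "z + (- (y \<bullet> e)) *\<^sub>R e = x" by (auto simp: T_def)
    then show "z \<in> {z. \<exists>s\<in>S. z + s *\<^sub>R e \<in> K}" using xy by (auto simp: T_def intro!: bexI[of _ "- (y \<bullet> e)"])
  next
    fix z assume "z \<in> {z. \<exists>s\<in>S. z + s *\<^sub>R e \<in> K}"
    then obtain s where s: "s \<in> S" "z + s *\<^sub>R e \<in> K" by blast
    have "- (s *\<^sub>R e) \<in> T" using s by (simp add: T_def ee)
    moreover have "z = (z + s *\<^sub>R e) + - (s *\<^sub>R e)" by simp
    ultimately show "z \<in> (\<Union>x\<in>K. \<Union>y\<in>T. {x + y})" using s by blast
  qed
  finally show ?thesis .
qed

lemma closed_shadow: "compact K \<Longrightarrow> norm e = 1 \<Longrightarrow> closed (shadow K e)"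
  using closed_shadow_over[of K e UNIV] by (simp add: shadow_def)

lemma compact_line_section:
  assumes K: "compact K" and e: "norm e = 1"
  shows "compact {s. z + s *\<^sub>R e \<in> K}"
proof -
  have "closed ((\<lambda>s. z + s *\<^sub>R e) -` K)"
    using compact_imp_closed[OF K] by (intro closed_vimage continuous_intros)
  moreover obtain B where B: "\<And>y. y \<in> K \<Longrightarrow> norm y \<le> B" using compact_imp_bounded[OF K] by (auto simp: bounded_iff)
  have "norm s \<le> B + norm z" if "z + s *\<^sub>R e \<in> K" for s
    using B[OF that] norm_triangle_ineq4[of "z + s *\<^sub>R e" z] e by simp
  then have "bounded ((\<lambda>s. z + s *\<^sub>R e) -` K)" by (auto simp: bounded_iff)
  ultimately show ?thesis by (simp add: compact_eq_bounded_closed vimage_def)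
qed

lemma height_bounds:
  assumes K: "compact K" "norm e = 1" and z: "z \<in> shadow K e"
  shows top_point_in: "top_point K e z \<in> K"
    and height_ge: "z + s *\<^sub>R e \<in> K \<Longrightarrow> s \<le> height K e z"
proof -
  have c: "compact {s. z + s *\<^sub>R e \<in> K}" by (rule compact_line_section[OF K])
  then have bdd: "bdd_above {s. z + s *\<^sub>R e \<in> K}" by (intro bounded_imp_bdd_above compact_imp_bounded)
  have "Sup {s. z + s *\<^sub>R e \<in> K} \<in> {s. z + s *\<^sub>R e \<in> K}"
    using z by (intro closed_contains_Sup bdd compact_imp_closed c) (auto simp: shadow_def)
  then show "top_point K e z \<in> K" by (simp add: top_point_def height_def)
  show "s \<le> height K e z" if "z + s *\<^sub>R e \<in> K"
    unfolding height_def using that by (intro cSup_upper bdd) auto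
qed

lemma height_eqI: "z + s *\<^sub>R e \<in> K \<Longrightarrow> (\<And>t. z + t *\<^sub>R e \<in> K \<Longrightarrow> t \<le> s) \<Longrightarrow> height K e z = s"
  unfolding height_def by (rule cSup_eq_maximum) auto

lemma top_point_shift:
  assumes K: "compact K" "norm e = 1" and z: "z \<in> shadow K e"
  shows "top_point K e (z + c *\<^sub>R e) = top_point K e z" "z + c *\<^sub>R e \<in> shadow K e"
proof -
  have hs: "height K e (z + c *\<^sub>R e) = height K e z - c"
  proof (rule height_eqI)
    show "z + c *\<^sub>R e + (height K e z - c) *\<^sub>R e \<in> K"
      using top_point_in[OF K z] by (simp add: top_point_def algebra_simps)
    fix t assume "z + c *\<^sub>R e + t *\<^sub>R e \<in> K"
    then have "z + (c + t) *\<^sub>R e \<in> K" by (simp add: algebra_simps)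
    then show "t \<le> height K e z - c" using height_ge[OF K z] by fastforce
  qed
  then show "top_point K e (z + c *\<^sub>R e) = top_point K e z"
    unfolding top_point_def hs by (simp add: scaleR_left_diff_distrib)
  have "(z + c *\<^sub>R e) + (height K e z - c) *\<^sub>R e \<in> K"
    using top_point_in[OF K z] by (simp add: top_point_def algebra_simps)
  then show "z + c *\<^sub>R e \<in> shadow K e" unfolding shadow_def by blast
qed

lemma top_point_frontier:
  assumes K: "compact K" "norm e = 1" and z: "z \<in> shadow K e"
  shows "top_point K e z \<in> frontier K"
proof -
  have "top_point K e z \<notin> interior K"
  proof
    assume "top_point K e z \<in> interior K"
    then obtain r where r: "r > 0" "cball (top_point K e z) r \<subseteq> K" by (auto simp: mem_interior_cball)
    have "top_point K e z + r *\<^sub>R e \<in> K" using r K by (auto simp: dist_norm)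
    then have "z + (height K e z + r) *\<^sub>R e \<in> K" by (simp add: top_point_def algebra_simps)
    then show False using height_ge[OF K z] r by fastforce
  qed
  then show ?thesis using top_point_in[OF K z] by (auto simp: frontier_def closure_def)
qed

lemma height_measurable [measurable]:
  assumes K: "compact K" "norm e = 1"
  shows "height K e \<in> borel_measurable borel"
proof (rule borel_measurable_iff_ge[THEN iffD2], rule allI)
  fix c
  have sh: "shadow K e \<in> sets borel" by (rule borel_closed[OF closed_shadow[OF K]])
  have cl: "{z. \<exists>s\<in>{c..}. z + s *\<^sub>R e \<in> K} \<in> sets borel"
    by (rule borel_closed[OF closed_shadow_over[OF K]]) simp
  have "height K e z \<ge> c \<longleftrightarrow> z \<in> {z. \<exists>s\<in>{c..}. z + s *\<^sub>R e \<in> K}" if z: "z \<in> shadow K e" for z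
    using top_point_in[OF K z] height_ge[OF K z] by (auto simp: top_point_def intro: order_trans)
  \<comment> \<open>Off the shadow the height is the constant \<open>Sup {}\<close>, whose value is
    unspecified, so both outcomes of its comparison with \<open>c\<close> are kept.\<close>
  moreover have "height K e z = Sup {}" if "z \<notin> shadow K e" for z
    using that unfolding height_def shadow_def by (intro arg_cong[where f=Sup]) auto
  ultimately have "{z \<in> space borel. c \<le> height K e z} =
     (shadow K e \<inter> {z. \<exists>s\<in>{c..}. z + s *\<^sub>R e \<in> K}) \<union> (if c \<le> Sup {} then - shadow K e else {})"
    by (intro set_eqI, case_tac "x \<in> shadow K e") auto
  then show "{z \<in> space borel. c \<le> height K e z} \<in> sets borel"
    using sh cl by auto
qed

lemma top_point_measurable [measurable]:
  assumes K: "compact K" "norm e = 1"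
  shows "top_point K e \<in> borel_measurable borel"
proof -
  note [measurable] = height_measurable[OF K]
  show ?thesis unfolding top_point_def by measurable
qed

section \<open>Projected area carried by the boundary\<close>

definition base_measure :: "'a::euclidean_space set \<Rightarrow> 'a \<Rightarrow> 'a measure" where
  "base_measure K e = density lborel (indicator (strip e \<inter> shadow K e))"

text \<open>
  The direction \<open>v\<close> is \<open>e\<close> or \<open>- e\<close>; the measure lives on the part of the boundary that is
  seen from infinity in direction \<open>v\<close> and gives it the area of its projection along \<open>e\<close>.
\<close>

definition boundary_measure :: "'a::euclidean_space set \<Rightarrow> 'a \<Rightarrow> 'a \<Rightarrow> 'a measure" where
  "boundary_measure K e v = distr (base_measure K e) borel (top_point K v)"

lemma sets_base_measure [simp, measurable_cong]: "sets (base_measure K e) = sets borel"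
  by (simp add: base_measure_def)

lemma space_base_measure [simp]: "space (base_measure K e) = UNIV"
  by (simp add: base_measure_def)

lemma sets_boundary_measure [simp, measurable_cong]: "sets (boundary_measure K e v) = sets borel"
  by (simp add: boundary_measure_def)

lemma space_boundary_measure [simp]: "space (boundary_measure K e v) = UNIV"
  by (simp add: boundary_measure_def)

lemma emeasure_base_measure:
  assumes K: "compact K" "norm e = 1" and [measurable]: "A \<in> sets borel"
  shows "emeasure (base_measure K e) A = emeasure lborel (strip e \<inter> shadow K e \<inter> A)"
proof -
  have [measurable]: "shadow K e \<in> sets borel" by (rule borel_closed[OF closed_shadow[OF K]])
  have "emeasure (base_measure K e) A = (\<integral>\<^sup>+x. indicator (strip e \<inter> shadow K e) x * indicator A x \<partial>lborel)"
    unfolding base_measure_def by (rule emeasure_density) auto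
  also have "\<dots> = (\<integral>\<^sup>+x. indicator (strip e \<inter> shadow K e \<inter> A) x \<partial>lborel)"
    by (intro nn_integral_cong) (auto simp: indicator_def)
  finally show ?thesis by simp
qed

lemma finite_base_measure:
  fixes K :: "'a::euclidean_space set"
  assumes K: "compact K" "norm e = 1"
  shows "finite_measure (base_measure K e)"
proof
  obtain B where B: "\<And>y. y \<in> K \<Longrightarrow> norm y \<le> B" using compact_imp_bounded[OF K(1)] by (auto simp: bounded_iff)
  have "strip e \<inter> shadow K e \<subseteq> cball 0 (B + 1)"
  proof
    fix z assume z: "z \<in> strip e \<inter> shadow K e"
    then obtain s where s: "z + s *\<^sub>R e \<in> K" by (auto simp: shadow_def)
    have "norm (orth_proj e z) \<le> B"
      using norm_orth_proj_le[OF K(2), of "z + s *\<^sub>R e"] B[OF s] by (simp add: orth_proj_shift K)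
    then show "z \<in> cball 0 (B + 1)" using bounded_strip_orth_proj[OF K(2)] z by auto
  qed
  then have "emeasure lborel (strip e \<inter> shadow K e) \<le> emeasure lborel (cball (0::'a) (B + 1))"
    by (intro emeasure_mono) auto
  also have "\<dots> < \<infinity>" using emeasure_lborel_cball_finite by simp
  finally show "emeasure (base_measure K e) (space (base_measure K e)) \<noteq> \<infinity>"
    by (simp add: emeasure_base_measure K)
qed

lemma finite_boundary_measure:
  assumes "compact K" "norm e = 1" "v = e \<or> v = - e"
  shows "finite_measure (boundary_measure K e v)"
proof -
  interpret finite_measure "base_measure K e" by (rule finite_base_measure[OF assms(1,2)])
  have "norm v = 1" using assms by auto
  then show ?thesis
    unfolding boundary_measure_def by (intro finite_measure_distr) (use assms top_point_measurable[of K v] in auto)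
qed

lemma emeasure_boundary_measure:
  assumes K: "compact K" "norm e = 1" "v = e \<or> v = - e" and A: "A \<in> sets borel"
  shows "emeasure (boundary_measure K e v) A = emeasure lborel {z \<in> strip e \<inter> shadow K e. top_point K v z \<in> A}"
proof -
  have "norm v = 1" using K by auto
  then have m: "top_point K v \<in> borel_measurable borel" using K by (intro top_point_measurable) auto
  have "emeasure (boundary_measure K e v) A = emeasure (base_measure K e) (top_point K v -` A)"
    unfolding boundary_measure_def using m A by (subst emeasure_distr) auto
  also have "\<dots> = emeasure lborel (strip e \<inter> shadow K e \<inter> top_point K v -` A)"
    using measurable_sets[OF m A] by (intro emeasure_base_measure K) auto
  also have "strip e \<inter> shadow K e \<inter> top_point K v -` A = {z \<in> strip e \<inter> shadow K e. top_point K v z \<in> A}"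
    by auto
  finally show ?thesis .
qed

lemma AE_base_measure_shadow:
  assumes K: "compact K" "norm e = 1"
  shows "AE z in base_measure K e. z \<in> shadow K e"
proof -
  have [measurable]: "shadow K e \<in> sets borel" by (rule borel_closed[OF closed_shadow[OF K]])
  show ?thesis
    unfolding base_measure_def by (subst AE_density) (auto simp: indicator_def)
qed

lemma AE_boundary_measure_frontier:
  assumes K: "compact K" "norm e = 1" "v = e \<or> v = - e"
  shows "AE y in boundary_measure K e v. y \<in> frontier K"
proof -
  have v: "norm v = 1" "shadow K e = shadow K v" using K shadow_uminus by auto
  show ?thesis
    unfolding boundary_measure_def
    by (subst AE_distr_iff)
      (use AE_base_measure_shadow[OF K(1,2)] top_point_measurable[OF K(1) v(1)] top_point_frontier[OF K(1) v(1)] v(2)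
       in \<open>auto elim!: eventually_mono intro: borel_closed\<close>)
qed

text \<open>\<open>B\<close> collects the base points in the hyperplane of the lines whose end point
  lies in \<open>A\<close>. The relevant part of the slab lies exactly above \<open>B\<close>, so
  the mass of \<open>A\<close> is the area of \<open>B\<close>, which is Hausdorff measure. The last
  inclusion allows comparison with the surface measure of \<open>A\<close> itself.\<close>

lemma boundary_measure_section:
  fixes K :: "(real^'n) set"
  assumes K: "compact K" "norm e = 1" and v: "v = e \<or> v = - e" and A: "A \<in> sets borel"
  defines "B \<equiv> {p. p \<bullet> e = 0 \<and> p \<in> shadow K e \<and> top_point K v p \<in> A}"
  shows "B \<in> sets borel" "emeasure (boundary_measure K e v) A = emeasure hausdorff_surface B"
    "B \<subseteq> orth_proj e ` A"
proof -
  have nv: "norm v = 1" "shadow K e = shadow K v" using K v shadow_uminus by auto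
  note [measurable] = top_point_measurable[OF K(1) nv(1)] A
  have [measurable]: "shadow K e \<in> sets borel" by (rule borel_closed[OF closed_shadow[OF K]])
  show B [measurable]: "B \<in> sets borel" unfolding B_def by measurable
  have shift: "top_point K v (z + c *\<^sub>R e) = top_point K v z \<and> z + c *\<^sub>R e \<in> shadow K e"
    if "z \<in> shadow K e" for z c
  proof -
    have "\<exists>d. c *\<^sub>R e = d *\<^sub>R v" using v by (metis scaleR_minus_left scaleR_minus_right minus_minus)
    then show ?thesis using top_point_shift[OF K(1) nv(1)] that nv(2) by metis
  qed
  have op: "orth_proj e z = z + (- (z \<bullet> e)) *\<^sub>R e" for z by (simp add: orth_proj_def)
  have "{z \<in> strip e \<inter> shadow K e. top_point K v z \<in> A} = {z \<in> strip e. orth_proj e z \<in> B}"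
  proof (intro subset_antisym subsetI)
    fix z assume "z \<in> {z \<in> strip e \<inter> shadow K e. top_point K v z \<in> A}"
    then show "z \<in> {z \<in> strip e. orth_proj e z \<in> B}"
      using shift[of z "- (z \<bullet> e)"] orth_proj_inner[OF K(2), of z] by (simp add: B_def op)
  next
    fix z assume z: "z \<in> {z \<in> strip e. orth_proj e z \<in> B}"
    have "orth_proj e z + (z \<bullet> e) *\<^sub>R e = z" by (simp add: orth_proj_def)
    then show "z \<in> {z \<in> strip e \<inter> shadow K e. top_point K v z \<in> A}"
      using z shift[of "orth_proj e z" "z \<bullet> e"] by (simp add: B_def)
  qed
  then have "emeasure (boundary_measure K e v) A = emeasure (flat_measure e) B"
    by (simp add: emeasure_boundary_measure[OF K v A] emeasure_flat_measure)
  also have "\<dots> = emeasure hausdorff_surface B"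
    by (rule hausdorff_surface_hyperplane[symmetric]) (use K B in \<open>auto simp: B_def\<close>)
  finally show "emeasure (boundary_measure K e v) A = emeasure hausdorff_surface B" .
  show "B \<subseteq> orth_proj e ` A"
  proof
    fix p assume p: "p \<in> B"
    have "orth_proj e (top_point K v p) = orth_proj e p"
      unfolding top_point_def using v orth_proj_shift[OF K(2), of p "height K v p"]
        orth_proj_shift[OF K(2), of p "- height K v p"] by auto
    then have "p = orth_proj e (top_point K v p)" using p by (simp add: B_def orth_proj_id)
    then show "p \<in> orth_proj e ` A" using p unfolding B_def by blast
  qed
qed

text \<open>Orthogonal projection does not increase distances. The estimate passes through the outer
  measure because the projection of a Borel set need not be Borel.\<close>

lemma boundary_measure_le:
  fixes K :: "(real^'n) set"
  assumes K: "compact K" "norm e = 1" and v: "v = e \<or> v = - e" and A: "A \<in> sets borel"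
  shows "emeasure (boundary_measure K e v) A \<le> emeasure hausdorff_surface A"
proof -
  define B where "B = {p. p \<bullet> e = 0 \<and> p \<in> shadow K e \<and> top_point K v p \<in> A}"
  note B = boundary_measure_section[OF assms, folded B_def]
  have "hausdorff_outer (CARD('n) - 1) B \<le> hausdorff_outer (CARD('n) - 1) (orth_proj e ` A)"
    by (rule hausdorff_outer_mono[OF B(3)])
  also have "\<dots> \<le> ennreal (1 ^ (CARD('n) - 1)) * hausdorff_outer (CARD('n) - 1) A"
    by (rule hausdorff_outer_lipschitz) (auto simp: dist_norm orth_proj_diff norm_orth_proj_le K)
  finally show ?thesis
    by (simp add: B(2) emeasure_hausdorff_surface A B(1) divide_right_mono_ennreal)
qed

subsection \<open>Signed areas\<close>


lemma integrable_bounded_support: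
  fixes h :: "'a::euclidean_space \<Rightarrow> real"
  assumes "h \<in> borel_measurable borel" "\<And>y. \<bar>h y\<bar> \<le> B" "\<And>y. y \<notin> S \<Longrightarrow> h y = 0" "bounded S"
  shows "integrable lborel h"
proof -
  obtain r where r: "S \<subseteq> cball 0 r" using assms(4) by (auto simp: bounded_iff subset_iff)
  show ?thesis
  proof (rule integrableI_bounded_set)
    show "emeasure lborel (cball (0::'a) r) < \<infinity>" using emeasure_lborel_cball_finite by simp
    show "AE x in lborel. x \<in> cball 0 r \<longrightarrow> norm (h x) \<le> B" using assms(2) by simp
    have "h x = 0" if "x \<notin> cball 0 r" for x using assms(3) r that by blast
    then show "AE x in lborel. x \<notin> cball 0 r \<longrightarrow> h x = 0" by simp
  qed (use assms in auto)
qed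

text \<open>What leaves at one end and enters at the other determines the change, so continuity
  matters at the two end points only. The first bound does not depend on the interval and later
  dominates the difference quotients of all line sections at once.\<close>

lemma moving_interval_integral:
  fixes g :: "real \<Rightarrow> real"
  assumes g [measurable]: "g \<in> borel_measurable borel" and B: "\<And>s. \<bar>g s\<bar> \<le> B" and ab: "a \<le> b"
  defines "W \<equiv> \<lambda>t. LINT s|lborel. indicator {a + t..b + t} s * g s"
  shows "\<bar>W t - W 0\<bar> \<le> 2 * B * \<bar>t\<bar>"
    and "isCont g a \<Longrightarrow> isCont g b \<Longrightarrow> (W has_real_derivative g b - g a) (at 0)"
proof -
  have si: "set_integrable lborel {x..y} g" for x y
    unfolding set_integrable_def
    by (rule integrable_bounded_support[where S="{x..y}" and B=B])
      (use B order_trans[OF abs_ge_zero B] in \<open>auto simp: indicator_def\<close>)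
  have io: "g integrable_on {x..y}" for x y using set_borel_integral_eq_integral(1)[OF si] .
  have W: "W t = integral {c..b + t} g - integral {c..a + t} g" if "c \<le> a + t" for c t
  proof -
    have "W t = integral {a + t..b + t} g"
      using set_borel_integral_eq_integral(2)[OF si, of "a + t" "b + t"]
      by (simp add: W_def set_lebesgue_integral_def)
    then show ?thesis
      using Henstock_Kurzweil_Integration.integral_combine[of c "a + t" "b + t" g] that ab io by simp
  qed
  have lip: "\<bar>integral {c..y} g - integral {c..x} g\<bar> \<le> B * \<bar>y - x\<bar>" if "c \<le> x" "c \<le> y" for c x y
  proof -
    have *: "\<bar>integral {c..y} g - integral {c..x} g\<bar> \<le> B * (y - x)" if "c \<le> x" "x \<le> y" for x y
    proof -
      have "integral {c..y} g - integral {c..x} g = integral {x..y} g"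
        using Henstock_Kurzweil_Integration.integral_combine[of c x y g] that io by simp
      moreover have "norm (integral {x..y} g) \<le> B * measure lborel {x..y}"
        using has_integral_bound_real[OF _ finite.emptyI integrable_integral[OF io], of B x y] B order_trans[OF abs_ge_zero B]
        by auto
      ultimately show ?thesis using that by simp
    qed
    show ?thesis using *[of x y] *[of y x] that by (cases "x \<le> y") auto
  qed
  \<comment> \<open>The lower limit \<open>a - \<bar>t\<bar>\<close> lies to the left of both
    intervals, whatever the sign of \<open>t\<close>.\<close>
  have "W t - W 0 = (integral {a - \<bar>t\<bar>..b + t} g - integral {a - \<bar>t\<bar>..b} g)
      - (integral {a - \<bar>t\<bar>..a + t} g - integral {a - \<bar>t\<bar>..a} g)"
    using W[of "a - \<bar>t\<bar>" t] W[of "a - \<bar>t\<bar>" 0] by simp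
  moreover have "\<bar>integral {a - \<bar>t\<bar>..b + t} g - integral {a - \<bar>t\<bar>..b} g\<bar> \<le> B * \<bar>t\<bar>"
    using lip[of "a - \<bar>t\<bar>" b "b + t"] ab by simp
  moreover have "\<bar>integral {a - \<bar>t\<bar>..a + t} g - integral {a - \<bar>t\<bar>..a} g\<bar> \<le> B * \<bar>t\<bar>"
    using lip[of "a - \<bar>t\<bar>" a "a + t"] by simp
  ultimately show "\<bar>W t - W 0\<bar> \<le> 2 * B * \<bar>t\<bar>" by linarith
  assume c: "isCont g a" "isCont g b"
  \<comment> \<open>Starting the primitive at \<open>a - 1\<close> makes \<open>a\<close> an
    interior point and covers all shifts with \<open>\<bar>t\<bar> < 1\<close>.\<close>
  define P where "P x = integral {a - 1..x} g" for x
  have dP: "(P has_real_derivative g x) (at x)" if "isCont g x" "a \<le> x" for x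
  proof -
    have "(P has_vector_derivative g x) (at x within ({a - 1..x + 1} - {}))"
      unfolding P_def
      by (rule integral_has_vector_derivative_continuous_at) (use that io continuous_at_imp_continuous_at_within in auto)
    moreover have "at x within {a - 1..x + 1} = at x" using that by (intro at_within_Icc_at) auto
    ultimately show ?thesis by (simp add: has_real_derivative_iff_has_vector_derivative)
  qed
  have "((\<lambda>t. P (b + t) - P (a + t)) has_real_derivative g b - g a) (at 0)"
    using DERIV_diff[OF DERIV_at_within_shift[THEN iffD1, of P "g b" b 0 UNIV] DERIV_at_within_shift[THEN iffD1, of P "g a" a 0 UNIV]]
      dP[OF c(1)] dP[OF c(2)] ab
    by (simp add: surj_plus)
  then show "(W has_real_derivative g b - g a) (at 0)"
  proof (rule has_field_derivative_transform_within_open)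
    show "open {-1<..<1::real}" by simp
    show "P (b + t) - P (a + t) = W t" if "t \<in> {-1<..<1}" for t
      using W[of "a - 1" t] that by (simp add: P_def)
  qed simp
qed

lemma integral_density_indicator:
  fixes f :: "'a \<Rightarrow> real"
  assumes "f \<in> borel_measurable M" "S \<in> sets M"
  shows "integral\<^sup>L (density M (indicator S)) f = (LINT x|M. indicator S x * f x)"
  using integral_density[of f M "indicator S"] assms by (simp add: ennreal_indicator)

lemma integrable_density_indicator:
  fixes f :: "'a \<Rightarrow> real"
  assumes "f \<in> borel_measurable M" "S \<in> sets M"
  shows "integrable (density M (indicator S)) f \<longleftrightarrow> integrable M (\<lambda>x. indicator S x * f x)"
  using integrable_density[of f M "indicator S"] assms by (simp add: ennreal_indicator)

text \<open>
  Integrating along the lines in direction \<open>e\<close> reduces the derivative of \<open>t \<mapsto> \<integral>\<close> of \<open>\<phi>\<close> over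
  \<open>K + t e\<close> to the fundamental theorem of calculus at both end points of each line section.
\<close>

lemma body_integral_shift_derivative:
  fixes K :: "'a::euclidean_space set" and \<phi> :: "'a \<Rightarrow> real"
  assumes K: "compact K" "convex K" and e: "norm e = 1"
    and \<phi> [measurable]: "\<phi> \<in> borel_measurable borel" and B: "\<And>y. \<bar>\<phi> y\<bar> \<le> B"
    and cont: "AE y in boundary_measure K e e. isCont \<phi> y" "AE y in boundary_measure K e (- e). isCont \<phi> y"
  shows "((\<lambda>t. LINT y|lborel. indicator K (y - t *\<^sub>R e) * \<phi> y) has_real_derivative
    (integral\<^sup>L (boundary_measure K e e) \<phi> - integral\<^sup>L (boundary_measure K e (- e)) \<phi>)) (at 0)"
proof -
  have Kb [measurable]: "K \<in> sets borel" using compact_imp_closed[OF K(1)] by auto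
  have sh [measurable]: "shadow K e \<in> sets borel" by (rule borel_closed[OF closed_shadow[OF K(1) e]])
  have ne: "norm (- e) = 1" using e by simp
  note [measurable] = top_point_measurable[OF K(1) e] top_point_measurable[OF K(1) ne]
  interpret base: finite_measure "base_measure K e" by (rule finite_base_measure[OF K(1) e])
  let ?D = "density lborel (indicator (strip e)) :: 'a measure"
  interpret D: sigma_finite_measure ?D by (rule sigma_finite_strip)
  interpret DL: pair_sigma_finite ?D "lborel :: real measure" ..
  define W where "W t z = (LINT s|lborel. indicator K (z + s *\<^sub>R e - t *\<^sub>R e) * \<phi> (z + s *\<^sub>R e))" for t :: real and z
  have Wm [measurable]: "W t \<in> borel_measurable borel" for t unfolding W_def by measurable
  define G where "G t = (LINT y|lborel. indicator K (y - t *\<^sub>R e) * \<phi> y)" for t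
  have G: "G t = (LINT z|base_measure K e. W t z)" and Wint: "integrable (base_measure K e) (W t)" for t
  proof -
    let ?f = "\<lambda>y. indicator K (y - t *\<^sub>R e) * \<phi> y"
    have int: "integrable lborel ?f"
    proof (rule integrable_bounded_support[where S="(+) (t *\<^sub>R e) ` K" and B=B])
      show "bounded ((+) (t *\<^sub>R e) ` K)" using compact_imp_bounded[OF K(1)] by (simp add: bounded_translation)
      show "\<bar>?f y\<bar> \<le> B" for y using B[of y] order_trans[OF abs_ge_zero B] by (auto simp: indicator_def)
      fix y assume "y \<notin> (+) (t *\<^sub>R e) ` K"
      then have "y - t *\<^sub>R e \<notin> K" by (metis add.commute diff_add_cancel image_eqI)
      then show "?f y = 0" by simp
    qed measurable
    let ?T = "\<lambda>(z, s). z + s *\<^sub>R e"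
    have Tm: "?T \<in> ?D \<Otimes>\<^sub>M (lborel :: real measure) \<rightarrow>\<^sub>M borel" by measurable
    have int': "integrable (distr (?D \<Otimes>\<^sub>M lborel) borel ?T) ?f"
      using int by (simp only: lborel_fubini_direction[OF e])
    \<comment> \<open>Lines that miss \<open>K\<close> contribute nothing, which permits the change
      from the slab to the finite measure \<open>base_measure K e\<close> needed for dominated
      convergence.\<close>
    have ind: "indicator (strip e) z * W t z = indicator (strip e \<inter> shadow K e) z * W t z" for z
    proof -
      have "W t z = 0" if "z \<notin> shadow K e"
      proof -
        have "z + s *\<^sub>R e - t *\<^sub>R e \<notin> K" for s
          using that unfolding shadow_def by (metis (mono_tags, lifting) add_diff_eq mem_Collect_eq scaleR_left_diff_distrib)
        then show ?thesis by (simp add: W_def)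
      qed
      then show ?thesis by (auto simp: indicator_def)
    qed
    have "G t = integral\<^sup>L (distr (?D \<Otimes>\<^sub>M lborel) borel ?T) ?f"
      by (simp only: lborel_fubini_direction[OF e] G_def)
    also have "\<dots> = integral\<^sup>L (?D \<Otimes>\<^sub>M lborel) (\<lambda>p. ?f (?T p))"
      by (rule integral_distr[OF Tm]) measurable
    also have "\<dots> = (LINT z|?D. LINT s|lborel. ?f (?T (z, s)))"
      by (rule DL.integral_fst'[symmetric]) (rule integrable_distr[OF Tm int'])
    also have "\<dots> = (LINT z|?D. W t z)" by (simp add: W_def)
    also have "\<dots> = (LINT z|lborel. indicator (strip e) z * W t z)"
      by (rule integral_density_indicator) auto
    also have "\<dots> = (LINT z|lborel. indicator (strip e \<inter> shadow K e) z * W t z)"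
      by (simp only: ind)
    also have "\<dots> = (LINT z|base_measure K e. W t z)"
      unfolding base_measure_def by (rule integral_density_indicator[symmetric]) auto
    finally show "G t = (LINT z|base_measure K e. W t z)" .
    have "integrable ?D (\<lambda>z. LINT s|lborel. ?f (?T (z, s)))"
      by (rule DL.integrable_fst') (rule integrable_distr[OF Tm int'])
    then have "integrable ?D (W t)" by (simp add: W_def[abs_def])
    then show "integrable (base_measure K e) (W t)"
      unfolding base_measure_def by (simp add: integrable_density_indicator ind)
  qed
  \<comment> \<open>By convexity each line meets \<open>K\<close> in an interval. Its lower end is
    the top in direction \<open>- e\<close>, hence the sign in
    \<open>- height K (- e) z\<close>.\<close>
  have sect: "W t z = (LINT s|lborel. indicator {- height K (- e) z + t..height K e z + t} s * \<phi> (z + s *\<^sub>R e))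
      \<and> - height K (- e) z \<le> height K e z" if z: "z \<in> shadow K e" for z t
  proof -
    have z': "z \<in> shadow K (- e)" using z by (simp add: shadow_uminus)
    have top: "z + height K e z *\<^sub>R e \<in> K" and bot: "z + (- height K (- e) z) *\<^sub>R e \<in> K"
      using top_point_in[OF K(1) e z] top_point_in[OF K(1) ne z'] by (auto simp: top_point_def)
    have sec: "z + s *\<^sub>R e \<in> K \<longleftrightarrow> - height K (- e) z \<le> s \<and> s \<le> height K e z" for s
    proof
      assume s: "z + s *\<^sub>R e \<in> K"
      then show "- height K (- e) z \<le> s \<and> s \<le> height K e z"
        using height_ge[OF K(1) e z s] height_ge[OF K(1) ne z', of "- s"] by auto
    next
      assume s: "- height K (- e) z \<le> s \<and> s \<le> height K e z"
      have "convex ((\<lambda>s. z + s *\<^sub>R e) -` K)"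
      proof (rule convexI)
        fix x y u v :: real assume xy: "x \<in> (\<lambda>s. z + s *\<^sub>R e) -` K" "y \<in> (\<lambda>s. z + s *\<^sub>R e) -` K" and uv: "0 \<le> u" "0 \<le> v" "u + v = 1"
        have "u *\<^sub>R (z + x *\<^sub>R e) + v *\<^sub>R (z + y *\<^sub>R e) = (u + v) *\<^sub>R z + (u * x + v * y) *\<^sub>R e"
          by (simp add: algebra_simps)
        then show "u *\<^sub>R x + v *\<^sub>R y \<in> (\<lambda>s. z + s *\<^sub>R e) -` K"
          using convexD[OF K(2), of "z + x *\<^sub>R e" "z + y *\<^sub>R e" u v] xy uv by simp
      qed
      then have "is_interval ((\<lambda>s. z + s *\<^sub>R e) -` K)" by (simp add: is_interval_convex_1)
      then show "z + s *\<^sub>R e \<in> K" using top bot s unfolding is_interval_1 by blast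
    qed
    have "indicator K (z + s *\<^sub>R e - t *\<^sub>R e) = (indicator {- height K (- e) z + t..height K e z + t} s :: real)" for s
      using sec[of "s - t"] by (auto simp: indicator_def algebra_simps)
    then show ?thesis using sec[of "height K e z"] top by (simp add: W_def)
  qed
  have Bq: "\<bar>(W t z - W 0 z) / t\<bar> \<le> 2 * B" if z: "z \<in> shadow K e" and t: "t \<noteq> 0" for t z
  proof -
    have "\<bar>W t z - W 0 z\<bar> \<le> 2 * B * \<bar>t\<bar>"
      using moving_interval_integral(1)[of "\<lambda>s. \<phi> (z + s *\<^sub>R e)" B "- height K (- e) z" "height K e z" t] sect[OF z] B by simp
    then show ?thesis using t by (simp add: abs_divide pos_divide_le_eq)
  qed
  have lim: "((\<lambda>t. (W t z - W 0 z) / t) \<longlongrightarrow> \<phi> (top_point K e z) - \<phi> (top_point K (- e) z)) (at 0)"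
    if z: "z \<in> shadow K e" and c: "isCont \<phi> (top_point K e z)" "isCont \<phi> (top_point K (- e) z)" for z
  proof -
    have "isCont (\<lambda>s. \<phi> (z + s *\<^sub>R e)) s" if "isCont \<phi> (z + s *\<^sub>R e)" for s
      by (rule isCont_o2[where f="\<lambda>s. z + s *\<^sub>R e" and g=\<phi>, OF _ that]) (intro continuous_intros)
    then have "((\<lambda>t. W t z) has_real_derivative \<phi> (z + height K e z *\<^sub>R e) - \<phi> (z + (- height K (- e) z) *\<^sub>R e)) (at 0)"
      using moving_interval_integral(2)[of "\<lambda>s. \<phi> (z + s *\<^sub>R e)" B "- height K (- e) z" "height K e z"]
        sect[OF z] B c by (simp add: top_point_def)
    then show ?thesis by (simp add: DERIV_def top_point_def)
  qed
  have aec: "AE z in base_measure K e. isCont \<phi> (top_point K v z)" if "AE y in boundary_measure K e v. isCont \<phi> y"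
    and v: "top_point K v \<in> borel_measurable borel" for v
  proof -
    have "top_point K v \<in> base_measure K e \<rightarrow>\<^sub>M borel" using v by simp
    then show ?thesis by (rule AE_distrD) (rule that(1)[unfolded boundary_measure_def])
  qed
  have "((\<lambda>t. (G (0 + t) - G 0) / t) \<longlongrightarrow> (LINT z|base_measure K e. \<phi> (top_point K e z) - \<phi> (top_point K (- e) z))) (at 0)"
    unfolding tendsto_at_iff_sequentially
  proof (intro allI impI)
    fix X :: "nat \<Rightarrow> real" assume X: "\<forall>i. X i \<in> UNIV - {0}" "X \<longlonglongrightarrow> 0"
    have lims: "(\<lambda>i. LINT z|base_measure K e. (W (X i) z - W 0 z) / X i) \<longlonglongrightarrow>
        (LINT z|base_measure K e. \<phi> (top_point K e z) - \<phi> (top_point K (- e) z))"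
    proof (rule integral_dominated_convergence[where w="\<lambda>_. 2 * B"])
      show "AE z in base_measure K e. (\<lambda>i. (W (X i) z - W 0 z) / X i) \<longlonglongrightarrow> \<phi> (top_point K e z) - \<phi> (top_point K (- e) z)"
        using AE_base_measure_shadow[OF K(1) e] aec[OF cont(1) top_point_measurable[OF K(1) e]] aec[OF cont(2) top_point_measurable[OF K(1) ne]]
      proof eventually_elim
        case (elim z)
        from lim[OF this] X show ?case unfolding tendsto_at_iff_sequentially by (auto simp: o_def)
      qed
      show "AE z in base_measure K e. norm ((W (X i) z - W 0 z) / X i) \<le> 2 * B" for i
        using AE_base_measure_shadow[OF K(1) e] by eventually_elim (use Bq X in auto)
    qed auto
    have "(LINT z|base_measure K e. (W (X i) z - W 0 z) / X i) = (G (X i) - G 0) / X i" for i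
      using Wint by (simp add: G)
    then show "((\<lambda>t. (G (0 + t) - G 0) / t) \<circ> X) \<longlonglongrightarrow>
        (LINT z|base_measure K e. \<phi> (top_point K e z) - \<phi> (top_point K (- e) z))"
      using lims by (simp only: o_def add_0_left)
  qed
  moreover have "(LINT z|base_measure K e. \<phi> (top_point K e z) - \<phi> (top_point K (- e) z)) =
      integral\<^sup>L (boundary_measure K e e) \<phi> - integral\<^sup>L (boundary_measure K e (- e)) \<phi>"
  proof -
    have "integrable (base_measure K e) (\<lambda>z. \<phi> (top_point K v z))" if "top_point K v \<in> borel_measurable borel" for v
      by (rule base.integrable_const_bound[where B=B]) (use B that in auto)
    then show ?thesis
      unfolding boundary_measure_def
      by (subst (1 2) integral_distr) (auto simp: integral_diff)
  qed
  ultimately show ?thesis unfolding DERIV_def G_def by simp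
qed

section \<open>From directional to total derivatives\<close>

text \<open>Continuity at almost every translated point is enough for dominated convergence, so the
  lemma serves indicator functions of bodies as well as continuous functions.\<close>

lemma isCont_translate_integral:
  fixes M :: "'a::euclidean_space measure" and \<phi> :: "'a \<Rightarrow> real"
  assumes M: "finite_measure M" and [measurable_cong]: "sets M = sets borel"
    and \<phi> [measurable]: "\<phi> \<in> borel_measurable borel" and B: "\<And>y. \<bar>\<phi> y\<bar> \<le> B"
    and cont: "AE y in M. isCont \<phi> (y + x0)"
  shows "isCont (\<lambda>x. LINT y|M. \<phi> (y + x)) x0"
proof -
  interpret finite_measure M by fact
  have "(\<lambda>n. LINT y|M. \<phi> (y + X n)) \<longlonglongrightarrow> (LINT y|M. \<phi> (y + x0))" if X: "X \<longlonglongrightarrow> x0" for X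
  proof (rule integral_dominated_convergence[where w="\<lambda>_. B"])
    show "AE y in M. (\<lambda>n. \<phi> (y + X n)) \<longlonglongrightarrow> \<phi> (y + x0)"
      using cont
    proof eventually_elim
      case (elim y)
      show ?case by (rule isCont_tendsto_compose[OF elim]) (intro tendsto_intros X)
    qed
  qed (use B in auto)
  then show ?thesis by (auto simp: continuous_at_sequentially o_def)
qed

text \<open>The coordinates of the increment \<open>h\<close> are changed one at a time. By the mean
  value theorem each change differs from its linear prediction by at most
  \<open>\<eta> * norm h\<close>, and the choice of \<eta> distributes \<epsilon> over the
  coordinates.\<close>

lemma has_derivative_partials:
  fixes f :: "'a::euclidean_space \<Rightarrow> real"
  assumes U: "open U" "x0 \<in> U"
    and der: "\<And>x i. x \<in> U \<Longrightarrow> i \<in> Basis \<Longrightarrow> ((\<lambda>t. f (x + t *\<^sub>R i)) has_real_derivative D i x) (at 0)"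
    and cont: "\<And>i. i \<in> Basis \<Longrightarrow> isCont (D i) x0"
  shows "(f has_derivative (\<lambda>h. \<Sum>i\<in>Basis. (h \<bullet> i) * D i x0)) (at x0)"
  unfolding has_derivative_at_alt
proof (intro conjI allI impI)
  show "bounded_linear (\<lambda>h. \<Sum>i\<in>Basis. (h \<bullet> i) * D i x0)"
    by (intro bounded_linear_sum bounded_linear_mult_const bounded_linear_inner_left)
  fix \<epsilon> :: real assume "\<epsilon> > 0"
  let ?n = "real DIM('a)"
  define \<eta> where "\<eta> = \<epsilon> / ?n"
  have \<eta>: "\<eta> > 0" using \<open>\<epsilon> > 0\<close> by (simp add: \<eta>_def)
  have "\<forall>i\<in>Basis. \<exists>d>0. \<forall>x. norm (x - x0) < d \<longrightarrow> \<bar>D i x - D i x0\<bar> < \<eta>"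
    using cont \<eta> by (auto simp: continuous_at_eps_delta dist_norm)
  then obtain d where d: "\<And>i. i \<in> Basis \<Longrightarrow> d i > 0"
    "\<And>i x. i \<in> Basis \<Longrightarrow> norm (x - x0) < d i \<Longrightarrow> \<bar>D i x - D i x0\<bar> < \<eta>" by metis
  obtain r where r: "r > 0" "ball x0 r \<subseteq> U" using U by (meson openE)
  define \<delta> where "\<delta> = min r (Min (d ` Basis))"
  have \<delta>: "\<delta> > 0" using r d by (simp add: \<delta>_def)
  have Dd: "\<bar>D i x - D i x0\<bar> < \<eta>" and xU: "x \<in> U" if "i \<in> Basis" "norm (x - x0) < \<delta>" for i x
  proof -
    have "\<delta> \<le> d i" unfolding \<delta>_def using that by (intro min.coboundedI2 Min_le) auto
    then show "\<bar>D i x - D i x0\<bar> < \<eta>" using d(2) that by auto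
    show "x \<in> U" using r that by (auto simp: \<delta>_def dist_norm norm_minus_commute)
  qed
  show "\<exists>d>0. \<forall>y. norm (y - x0) < d \<longrightarrow> norm (f y - f x0 - (\<Sum>i\<in>Basis. ((y - x0) \<bullet> i) * D i x0)) \<le> \<epsilon> * norm (y - x0)"
  proof (intro exI conjI allI impI)
    \<comment> \<open>An intermediate point moves along at most \<open>?n\<close> coordinates, each
      by at most \<open>norm h\<close>, and so stays within \<delta> of \<open>x0\<close>.\<close>
    show "0 < \<delta> / ?n" using \<delta> by simp
    fix y assume y: "norm (y - x0) < \<delta> / ?n"
    define h where "h = y - x0"
    have hi: "\<bar>h \<bullet> i\<bar> \<le> norm h" if "i \<in> Basis" for i using Basis_le_norm[OF that, of h] by simp
    have small: "norm ((\<Sum>i\<in>S. (h \<bullet> i) *\<^sub>R i) + (\<theta> * (h \<bullet> j)) *\<^sub>R j) < \<delta>"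
      if S: "S \<subseteq> Basis" "j \<in> Basis - S" and \<theta>: "0 \<le> \<theta>" "\<theta> \<le> 1" for S \<theta> j
    proof -
      have fS: "finite S" by (rule finite_subset[OF S(1) finite_Basis])
      have "norm ((\<Sum>i\<in>S. (h \<bullet> i) *\<^sub>R i) + (\<theta> * (h \<bullet> j)) *\<^sub>R j) \<le> (\<Sum>i\<in>S. norm ((h \<bullet> i) *\<^sub>R i)) + norm ((\<theta> * (h \<bullet> j)) *\<^sub>R j)"
        by (rule order_trans[OF norm_triangle_ineq add_right_mono[OF norm_sum]])
      also have "\<dots> \<le> (\<Sum>i\<in>S. norm h) + norm h"
      proof (intro add_mono sum_mono)
        show "norm ((h \<bullet> i) *\<^sub>R i) \<le> norm h" if "i \<in> S" for i using hi[of i] that S by auto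
        have "\<theta> * \<bar>h \<bullet> j\<bar> \<le> 1 * norm h" using hi[of j] S \<theta> by (intro mult_mono) auto
        then show "norm ((\<theta> * (h \<bullet> j)) *\<^sub>R j) \<le> norm h" using S \<theta> by (simp add: abs_mult)
      qed
      also have "\<dots> = real (card (insert j S)) * norm h" using S fS by (simp add: algebra_simps)
      also have "\<dots> \<le> ?n * norm h"
        using S by (intro mult_right_mono of_nat_mono card_mono) auto
      also have "\<dots> < \<delta>" using y by (simp add: h_def field_simps)
      finally show ?thesis .
    qed
    have "\<bar>f (x0 + (\<Sum>i\<in>S. (h \<bullet> i) *\<^sub>R i)) - f x0 - (\<Sum>i\<in>S. (h \<bullet> i) * D i x0)\<bar> \<le> real (card S) * \<eta> * norm h"
      if "S \<subseteq> Basis" for S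
      using finite_subset[OF that finite_Basis] that
    proof (induction S rule: finite_induct)
      case (insert j S)
      define p where "p = x0 + (\<Sum>i\<in>S. (h \<bullet> i) *\<^sub>R i)"
      define g where "g t = f (p + (t * (h \<bullet> j)) *\<^sub>R j)" for t
      have j: "j \<in> Basis" using insert by auto
      have pd: "norm (p + (\<theta> * (h \<bullet> j)) *\<^sub>R j - x0) < \<delta>" if "0 \<le> \<theta>" "\<theta> \<le> 1" for \<theta>
        using small[of S j \<theta>] insert that by (auto simp: p_def add.assoc)
      have dg: "(g has_real_derivative D j (p + (t * (h \<bullet> j)) *\<^sub>R j) * (h \<bullet> j)) (at t)" if "0 \<le> t" "t \<le> 1" for t
      proof -
        let ?x = "p + (t * (h \<bullet> j)) *\<^sub>R j"
        have "((\<lambda>s. f (?x + s *\<^sub>R j)) has_real_derivative D j ?x) (at ((t - t) * (h \<bullet> j)))"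
          using der[OF xU[OF j pd[OF that]] j] by simp
        moreover have "((\<lambda>t'. (t' - t) * (h \<bullet> j)) has_real_derivative (h \<bullet> j)) (at t)"
          by (auto intro!: derivative_eq_intros)
        ultimately have "((\<lambda>t'. f (?x + ((t' - t) * (h \<bullet> j)) *\<^sub>R j)) has_real_derivative D j ?x * (h \<bullet> j)) (at t)"
          by (rule DERIV_chain2)
        moreover have "?x + ((t' - t) * (h \<bullet> j)) *\<^sub>R j = p + (t' * (h \<bullet> j)) *\<^sub>R j" for t'
          by (simp add: algebra_simps)
        ultimately show ?thesis by (simp add: g_def[abs_def])
      qed
      have "\<exists>z>0. z < 1 \<and> g 1 - g 0 = (1 - 0) * (D j (p + (z * (h \<bullet> j)) *\<^sub>R j) * (h \<bullet> j))"
        by (rule MVT2) (use dg in auto)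
      then obtain z where z: "0 < z" "z < 1" "g 1 - g 0 = D j (p + (z * (h \<bullet> j)) *\<^sub>R j) * (h \<bullet> j)" by auto
      have "\<bar>g 1 - g 0 - (h \<bullet> j) * D j x0\<bar> = \<bar>D j (p + (z * (h \<bullet> j)) *\<^sub>R j) - D j x0\<bar> * \<bar>h \<bullet> j\<bar>"
        unfolding z(3) by (simp add: abs_mult[symmetric] algebra_simps)
      also have "\<dots> \<le> \<eta> * norm h"
        using z Dd[OF j pd[of z]] hi[OF j] by (intro mult_mono) auto
      finally have 1: "\<bar>g 1 - g 0 - (h \<bullet> j) * D j x0\<bar> \<le> \<eta> * norm h" .
      have 2: "\<bar>g 0 - f x0 - (\<Sum>i\<in>S. (h \<bullet> i) * D i x0)\<bar> \<le> real (card S) * \<eta> * norm h"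
        using insert by (simp add: g_def p_def)
      have "g 1 = f (x0 + (\<Sum>i\<in>insert j S. (h \<bullet> i) *\<^sub>R i))"
        using insert by (simp add: g_def p_def algebra_simps)
      then show ?case using 1 2 insert by (simp add: algebra_simps)
    qed simp
    from this[OF order_refl] show "norm (f y - f x0 - (\<Sum>i\<in>Basis. ((y - x0) \<bullet> i) * D i x0)) \<le> \<epsilon> * norm (y - x0)"
      unfolding euclidean_representation by (simp add: h_def \<eta>_def)
  qed
qed

section \<open>Linearity of the signed area\<close>

definition signed_area :: "'a::euclidean_space set \<Rightarrow> 'a \<Rightarrow> 'a set \<Rightarrow> real" where
  "signed_area K e A = measure (boundary_measure K e e) A - measure (boundary_measure K e (- e)) A"

text \<open>Translating \<open>\<phi>\<close> instead of the body gives a single function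
  \<open>J\<close> whose derivative in a unit direction \<open>v\<close> is the boundary term for
  \<open>v\<close>. The partial derivatives of \<open>J\<close> are continuous because
  \<open>\<phi>\<close> is, so \<open>J\<close> has a total derivative, and this is linear in the
  direction. For a discontinuous \<open>\<phi>\<close> the argument may fail, which is why sets are
  treated afterwards.\<close>

lemma boundary_integral_linear:
  fixes K :: "'a::euclidean_space set" and \<phi> :: "'a \<Rightarrow> real"
  assumes K: "compact K" "convex K" and e: "norm e = 1"
    and B: "\<And>y. \<bar>\<phi> y\<bar> \<le> B" and cont: "\<And>y. isCont \<phi> y"
  defines "I \<equiv> \<lambda>v \<psi>. integral\<^sup>L (boundary_measure K v v) \<psi> - integral\<^sup>L (boundary_measure K v (- v)) \<psi>"
  shows "I e \<phi> = (\<Sum>i\<in>Basis. (e \<bullet> i) * I i \<phi>)"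
proof -
  have Kb [measurable]: "K \<in> sets borel" using compact_imp_closed[OF K(1)] by auto
  have \<phi> [measurable]: "\<phi> \<in> borel_measurable borel"
    using cont by (intro borel_measurable_continuous_onI) (simp add: continuous_on_eq_continuous_at)
  define J where "J x = (LINT y|lborel. indicator K y * \<phi> (y + x))" for x
  have contx: "isCont (\<lambda>y. \<phi> (y + x)) y" for x y
    by (rule isCont_o2[where f="\<lambda>y. y + x" and g=\<phi>]) (intro continuous_intros, rule cont)
  have dJ: "((\<lambda>t. J (x + t *\<^sub>R v)) has_real_derivative I v (\<lambda>y. \<phi> (y + x))) (at 0)" if v: "norm v = 1" for x v
  proof -
    have "J (x + t *\<^sub>R v) = (LINT y|lborel. indicator K (y - t *\<^sub>R v) * \<phi> (y + x))" for t
    proof -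
      have "(\<lambda>y. indicator K (y - t *\<^sub>R v) * \<phi> (y + x)) \<in> borel_measurable borel" by measurable
      from integral_lborel_shift[OF this, of "t *\<^sub>R v"] show ?thesis by (simp add: J_def add_ac)
    qed
    moreover have "((\<lambda>t. LINT y|lborel. indicator K (y - t *\<^sub>R v) * \<phi> (y + x)) has_real_derivative I v (\<lambda>y. \<phi> (y + x))) (at 0)"
      unfolding I_def by (rule body_integral_shift_derivative[OF K v]) (use B contx in auto)
    ultimately show ?thesis by simp
  qed
  have contI: "isCont (\<lambda>x. I v (\<lambda>y. \<phi> (y + x))) x0" if v: "norm v = 1" for v x0
    unfolding I_def
    by (intro continuous_intros isCont_translate_integral[where B=B] finite_boundary_measure K v)
       (use B cont in auto)
  have "(J has_derivative (\<lambda>h. \<Sum>i\<in>Basis. (h \<bullet> i) * I i (\<lambda>y. \<phi> (y + 0)))) (at 0)"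
    by (rule has_derivative_partials[of UNIV]) (use dJ contI in auto)
  then have "(J has_derivative (\<lambda>h. \<Sum>i\<in>Basis. (h \<bullet> i) * I i \<phi>)) (at (0 *\<^sub>R e))" by simp
  moreover have "((\<lambda>t. t *\<^sub>R e) has_derivative (\<lambda>t. t *\<^sub>R e)) (at 0)"
    by (auto intro!: derivative_eq_intros)
  ultimately have "((\<lambda>t. J (t *\<^sub>R e)) has_derivative (\<lambda>t. \<Sum>i\<in>Basis. ((t *\<^sub>R e) \<bullet> i) * I i \<phi>)) (at 0)"
    by (rule has_derivative_compose[rotated])
  moreover have "(\<lambda>t. \<Sum>i\<in>Basis. ((t *\<^sub>R e) \<bullet> i) * I i \<phi>) = (*) (\<Sum>i\<in>Basis. (e \<bullet> i) * I i \<phi>)"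
    by (auto simp: fun_eq_iff sum_distrib_left sum_distrib_right algebra_simps)
  ultimately have "((\<lambda>t. J (t *\<^sub>R e)) has_real_derivative (\<Sum>i\<in>Basis. (e \<bullet> i) * I i \<phi>)) (at 0)"
    by (simp add: has_field_derivative_def)
  then show ?thesis using dJ[OF e, of 0] by (auto intro: DERIV_unique)
qed

text \<open>Closed sets are reached as limits of continuous functions; they are stable under
  intersection and generate the Borel sets, so the identity spreads by complements and disjoint
  unions. Finiteness of the boundary measures permits the differences.\<close>

lemma signed_area_linear:
  fixes K :: "'a::euclidean_space set"
  assumes K: "compact K" "convex K" and e: "norm e = 1" and A: "A \<in> sets borel"
  shows "signed_area K e A = (\<Sum>i\<in>Basis. (e \<bullet> i) * signed_area K i A)"
proof -
  have fin: "finite_measure (boundary_measure K v w)" if "norm v = 1" "w = v \<or> w = - v" for v w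
    using finite_boundary_measure[OF K(1) that] .
  have closed: "signed_area K e C = (\<Sum>i\<in>Basis. (e \<bullet> i) * signed_area K i C)" if C: "closed C" for C
  proof (cases "C = {}")
    case True then show ?thesis by (simp add: signed_area_def)
  next
    case ne: False
    have [measurable]: "C \<in> sets borel" using C by (rule borel_closed)
    \<comment> \<open>These functions are \<open>1\<close> on \<open>C\<close> and vanish at
      distance \<open>1 / m\<close> from it (for positive \<open>m\<close>), so they converge
      pointwise to the indicator of \<open>C\<close>.\<close>
    define \<phi> where "\<phi> m y = max 0 (1 - real m * infdist y C)" for m y
    have cont: "isCont (\<phi> m) y" for m y unfolding \<phi>_def by (intro continuous_intros)
    have meas [measurable]: "\<phi> m \<in> borel_measurable borel" for m
      using cont by (intro borel_measurable_continuous_onI) (simp add: continuous_on_eq_continuous_at)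
    have B: "\<bar>\<phi> m y\<bar> \<le> 1" for m y by (auto simp: \<phi>_def infdist_nonneg)
    have lim: "(\<lambda>m. \<phi> m y) \<longlonglongrightarrow> indicator C y" for y
    proof (cases "y \<in> C")
      case True then show ?thesis by (simp add: \<phi>_def)
    next
      case False
      then have pos: "0 < infdist y C" using C ne by (intro infdist_pos_not_in_closed) auto
      obtain N where N: "1 / infdist y C < real N" using reals_Archimedean2 by blast
      have "\<phi> m y = 0" if "m \<ge> N" for m
      proof -
        have "1 / infdist y C < real m" using N that by linarith
        then show ?thesis using pos by (simp add: \<phi>_def field_simps)
      qed
      then have "\<forall>\<^sub>F m in sequentially. \<phi> m y = indicator C y" using False by (auto simp: eventually_sequentially)
      then show ?thesis by (rule tendsto_eventually)
    qed
    have int: "(\<lambda>m. integral\<^sup>L (boundary_measure K v w) (\<phi> m)) \<longlonglongrightarrow> measure (boundary_measure K v w) C"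
      if "norm v = 1" "w = v \<or> w = - v" for v w
    proof -
      interpret finite_measure "boundary_measure K v w" by (rule fin[OF that])
      have "(\<lambda>m. integral\<^sup>L (boundary_measure K v w) (\<phi> m)) \<longlonglongrightarrow> integral\<^sup>L (boundary_measure K v w) (indicator C)"
        by (rule integral_dominated_convergence[where w="\<lambda>_. 1"]) (use lim B C in auto)
      then show ?thesis using C by simp
    qed
    have "(\<lambda>m. integral\<^sup>L (boundary_measure K e e) (\<phi> m) - integral\<^sup>L (boundary_measure K e (- e)) (\<phi> m)) \<longlonglongrightarrow> signed_area K e C"
      unfolding signed_area_def by (intro tendsto_diff int e) auto
    moreover have "(\<lambda>m. \<Sum>i\<in>Basis. (e \<bullet> i) * (integral\<^sup>L (boundary_measure K i i) (\<phi> m) - integral\<^sup>L (boundary_measure K i (- i)) (\<phi> m)))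
       \<longlonglongrightarrow> (\<Sum>i\<in>Basis. (e \<bullet> i) * signed_area K i C)"
      unfolding signed_area_def by (intro tendsto_intros int) auto
    ultimately show ?thesis
      using boundary_integral_linear[OF K e B cont] LIMSEQ_unique by auto
  qed
  have diff: "signed_area K v (UNIV - A) = signed_area K v UNIV - signed_area K v A" if "norm v = 1" "A \<in> sets borel" for v A
    using finite_measure.finite_measure_compl[OF fin[of v v], of A] finite_measure.finite_measure_compl[OF fin[of v "- v"], of A] that
    by (simp add: signed_area_def)
  have I: "Int_stable (Collect closed :: 'a set set)" by (auto simp: Int_stable_def)
  have "A \<in> sigma_sets UNIV (Collect closed)" using A by (simp add: borel_eq_closed)
  with I have "Int_stable (Collect closed :: 'a set set)" "Collect closed \<subseteq> Pow (UNIV :: 'a set)" "A \<in> sigma_sets UNIV (Collect closed)"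
    by auto
  then show ?thesis
  proof (induction A rule: sigma_sets_induct_disjoint)
    case (basic A) then show ?case using closed by auto
  next
    case empty show ?case by (simp add: signed_area_def)
  next
    case (compl A)
    then have Ab: "A \<in> sets borel" by (simp add: borel_eq_closed)
    \<comment> \<open>The complement is taken inside \<open>UNIV\<close>, which is closed, so the
      identity is already known for the total mass.\<close>
    show ?case
      using compl(2) closed[of UNIV] diff[OF e Ab]
      by (simp add: diff[OF norm_Basis Ab] right_diff_distrib sum_subtractf cong: sum.cong)
  next
    case (union A)
    have Ab: "A i \<in> sets borel" for i using union(2) by (auto simp: borel_eq_closed)
    have s: "(\<lambda>n. signed_area K v (A n)) sums signed_area K v (\<Union>n. A n)" if "norm v = 1" for v
      unfolding signed_area_def
      by (intro sums_diff finite_measure.finite_measure_UNION fin that) (use Ab union(1) in auto)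
    have "(\<lambda>n. \<Sum>i\<in>Basis. (e \<bullet> i) * signed_area K i (A n)) sums (\<Sum>i\<in>Basis. (e \<bullet> i) * signed_area K i (\<Union>n. A n))"
      by (intro sums_sum sums_mult s) auto
    then show ?case using s[OF e] union(3) by (auto intro: sums_unique2)
  qed
qed

subsection \<open>Outer normals\<close>


text \<open>The preimage of \<open>C\<close> under the multivalued Gauss map: one normal in
  \<open>C\<close> suffices. No normal is selected, which keeps the sets closed and lets patches
  overlap at points with several normals.\<close>

definition frontier_with_normal :: "(real^'n) set \<Rightarrow> (real^'n) set \<Rightarrow> (real^'n) set" where
  "frontier_with_normal K C = {y \<in> frontier K. \<exists>w\<in>C. is_outer_unit_normal K y w}"

text \<open>The set is the projection of the pairs of a boundary point and a normal in
  \<open>C\<close>. These pairs form a compact set because normals have length one.\<close>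

lemma closed_frontier_with_normal:
  assumes K: "compact K" and C: "closed C"
  shows "closed (frontier_with_normal K C)"
proof -
  define P where "P = (frontier K \<times> (C \<inter> sphere 0 1)) \<inter> (\<Inter>z\<in>K. {p. snd p \<bullet> (z - fst p) \<le> 0})"
  have "compact (frontier K \<times> (C \<inter> sphere 0 1))"
    by (intro compact_Times compact_frontier K closed_Int_compact C) simp
  then have "compact P" unfolding P_def
    by (intro compact_Int_closed closed_INT ballI closed_Collect_le continuous_intros)
  then have "compact (fst ` P)" by (intro compact_continuous_image continuous_intros)
  moreover have "fst ` P = frontier_with_normal K C"
  proof (rule set_eqI)
    fix y
    have "y \<in> fst ` P \<longleftrightarrow> (\<exists>w. (y, w) \<in> P)" by force
    also have "\<dots> \<longleftrightarrow> y \<in> frontier_with_normal K C"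
      by (auto simp: P_def frontier_with_normal_def is_outer_unit_normal_def)
    finally show "y \<in> fst ` P \<longleftrightarrow> y \<in> frontier_with_normal K C" .
  qed
  ultimately show ?thesis by (simp add: compact_imp_closed)
qed

lemma outer_unit_normal_exists:
  assumes K: "convex_body K" and y: "y \<in> frontier K"
  shows "\<exists>w. is_outer_unit_normal K y w"
proof -
  have c: "convex K" "compact K" "interior K \<noteq> {}" using K by (auto simp: convex_body_def)
  have "y \<in> K" "y \<notin> interior K" using y frontier_subset_closed[of K] compact_imp_closed[OF c(2)] by (auto simp: frontier_def)
  then have "y \<notin> rel_interior K" using c by (simp add: rel_interior_nonempty_interior)
  then obtain a where a: "a \<noteq> 0" "\<And>z. z \<in> K \<Longrightarrow> a \<bullet> y \<le> a \<bullet> z"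
    using supporting_hyperplane_rel_boundary[OF c(1) \<open>y \<in> K\<close>] by metis
  have "is_outer_unit_normal K y (- (a /\<^sub>R norm a))"
    using a by (auto simp: is_outer_unit_normal_def inner_diff_right divide_simps)
  then show ?thesis by blast
qed

lemma frontier_with_normal_borel: "compact K \<Longrightarrow> closed C \<Longrightarrow> frontier_with_normal K C \<in> sets borel"
  by (intro borel_closed closed_frontier_with_normal)

text \<open>\<open>A\<close> need not be a Borel set: outside the sigma-algebra
  \<open>emeasure\<close> is \<open>0\<close> by convention.\<close>

lemma emeasure_lborel_negligible:
  assumes "negligible S" "A \<subseteq> S"
  shows "emeasure lborel A = 0"
proof -
  have "negligible A" using assms negligible_subset by blast
  show ?thesis
  proof (cases "A \<in> sets lborel")
    case True
    then show ?thesis using \<open>negligible A\<close> by (auto simp: negligible_iff_null_sets null_sets_def)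
  qed (simp add: emeasure_notin_sets)
qed

section \<open>Projection of patches with almost constant normal\<close>

text \<open>Chords of a patch are almost orthogonal to \<open>u\<close>: a chord points to the inner
  side of the supporting hyperplane at each of its two ends, and both normals are within \<epsilon>
  of \<open>u\<close>. The two ends provide the two signs.\<close>

lemma patch_inner_bound:
  fixes K :: "(real^'n) set"
  assumes A: "A \<subseteq> frontier_with_normal K (cball u \<epsilon>)" and K: "closed K" and ab: "a \<in> A" "b \<in> A"
  shows "\<bar>(a - b) \<bullet> u\<bar> \<le> \<epsilon> * norm (a - b)"
proof -
  have *: "u \<bullet> (b - a) \<le> \<epsilon> * norm (b - a)" if ab: "a \<in> A" "b \<in> A" for a b
  proof -
    obtain w where w: "is_outer_unit_normal K a w" "norm (u - w) \<le> \<epsilon>"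
      using A ab by (auto simp: frontier_with_normal_def dist_norm)
    have "b \<in> K" using ab A frontier_subset_closed[OF K] by (auto simp: frontier_with_normal_def)
    then have "w \<bullet> (b - a) \<le> 0" using w by (simp add: is_outer_unit_normal_def)
    then have "u \<bullet> (b - a) \<le> (u - w) \<bullet> (b - a)" by (simp add: inner_diff_left)
    also have "\<dots> \<le> norm (u - w) * norm (b - a)" by (rule norm_cauchy_schwarz)
    also have "\<dots> \<le> \<epsilon> * norm (b - a)" using w by (intro mult_right_mono) auto
    finally show ?thesis .
  qed
  have "(a - b) \<bullet> u \<le> \<epsilon> * norm (a - b)" using *[OF ab(2,1)] by (simp add: inner_commute norm_minus_commute)
  moreover have "- ((a - b) \<bullet> u) \<le> \<epsilon> * norm (a - b)"
    using *[OF ab] by (simp add: inner_commute[of _ u] norm_minus_commute inner_diff_right)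
  ultimately show ?thesis by (simp add: abs_le_iff)
qed

text \<open>The normal at \<open>a\<close> has a positive component along \<open>u\<close>, so a
  line in direction \<open>u\<close> leaves \<open>K\<close> at \<open>a\<close>.\<close>

lemma patch_top_point:
  fixes K :: "(real^'n) set"
  assumes A: "A \<subseteq> frontier_with_normal K (cball u \<epsilon>)" and K: "compact K" and u: "norm u = 1" and \<epsilon>: "\<epsilon> < 1" and a: "a \<in> A"
  shows "top_point K u a = a" "a \<in> shadow K u"
proof -
  have aK: "a \<in> K" using a A frontier_subset_closed[OF compact_imp_closed[OF K]] by (auto simp: frontier_with_normal_def)
  then have "a + 0 *\<^sub>R u \<in> K" by simp
  then show "a \<in> shadow K u" unfolding shadow_def by blast
  obtain w where w: "is_outer_unit_normal K a w" "norm (u - w) \<le> \<epsilon>"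
    using A a by (auto simp: frontier_with_normal_def dist_norm)
  have "u \<bullet> u - w \<bullet> u = (u - w) \<bullet> u" by (simp add: inner_diff_left)
  also have "\<dots> \<le> norm (u - w) * norm u" by (rule norm_cauchy_schwarz)
  finally have wu: "w \<bullet> u > 0" using w u \<epsilon> by (simp add: dot_square_norm)
  have "height K u a = 0"
  proof (rule height_eqI)
    fix t assume "a + t *\<^sub>R u \<in> K"
    then have "w \<bullet> (a + t *\<^sub>R u - a) \<le> 0" using w unfolding is_outer_unit_normal_def by blast
    then show "t \<le> 0" using wu by (simp add: mult_le_0_iff)
  qed (use aK in simp)
  then show "top_point K u a = a" by (simp add: top_point_def)
qed

text \<open>On a patch whose normals are close to \<open>u\<close> the projection along \<open>u\<close> is almost an isometry.\<close>

lemma patch_surface_le: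
  fixes K :: "(real^'n) set"
  assumes A: "A \<subseteq> frontier_with_normal K (cball u \<epsilon>)" "A \<in> sets borel"
    and K: "compact K" and u: "norm u = 1" and \<epsilon>: "0 \<le> \<epsilon>" "\<epsilon> < 1"
  shows "emeasure hausdorff_surface A \<le> ennreal ((1 / (1 - \<epsilon>\<^sup>2)) ^ (CARD('n) - 1)) * emeasure (boundary_measure K u u) A"
proof -
  define B where "B = {p. p \<bullet> u = 0 \<and> p \<in> shadow K u \<and> top_point K u p \<in> A}"
  note B = boundary_measure_section[OF K u _ A(2), of u, folded B_def]
  have e2: "0 < 1 - \<epsilon>\<^sup>2" using \<epsilon> by (simp add: power_less_one_iff abs_square_less_1)
  have inv: "top_point K u (orth_proj u a) = a" "orth_proj u a \<in> B" if a: "a \<in> A" for a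
  proof -
    have "orth_proj u a = a + (- (a \<bullet> u)) *\<^sub>R u" by (simp add: orth_proj_def)
    then show "top_point K u (orth_proj u a) = a"
      using top_point_shift(1)[OF K u] patch_top_point[OF A(1) K u \<epsilon>(2) a] by metis
    moreover have "orth_proj u a \<in> shadow K u"
      using \<open>orth_proj u a = _\<close> top_point_shift(2)[OF K u] patch_top_point[OF A(1) K u \<epsilon>(2) a] by metis
    ultimately show "orth_proj u a \<in> B" using a by (simp add: B_def orth_proj_inner u)
  qed
  have Beq: "B = orth_proj u ` A" using inv(2) B(3) by auto
  have AB: "A = top_point K u ` B" unfolding Beq using inv(1) by force
  have "emeasure hausdorff_surface (top_point K u ` B) \<le> ennreal ((1 / (1 - \<epsilon>\<^sup>2)) ^ (CARD('n) - 1)) * emeasure hausdorff_surface B"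
  proof (rule emeasure_hausdorff_surface_lipschitz)
    show "0 < 1 / (1 - \<epsilon>\<^sup>2)" using e2 by simp
    show "B \<in> sets borel" using B(1) by simp
    show "top_point K u ` B \<in> sets borel" using A(2) AB by simp
    fix x y assume "x \<in> B" "y \<in> B"
    then obtain a b where ab: "a \<in> A" "b \<in> A" "x = orth_proj u a" "y = orth_proj u b" unfolding Beq by blast
    \<comment> \<open>Pythagoras would give the factor \<open>sqrt (1 - \<epsilon>\<^sup>2)\<close>;
      the smaller \<open>1 - \<epsilon>\<^sup>2\<close> avoids the root and still loses only second
      order.\<close>
    have "((1 - \<epsilon>\<^sup>2) * norm (a - b))\<^sup>2 \<le> (1 - \<epsilon>\<^sup>2) * (norm (a - b))\<^sup>2"
      using e2 mult_right_mono[of "(1 - \<epsilon>\<^sup>2)\<^sup>2" "1 - \<epsilon>\<^sup>2" "(norm (a - b))\<^sup>2"] by (simp add: power_mult_distrib power2_eq_square[of "1 - \<epsilon>\<^sup>2"] mult_left_le)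
    also have "\<dots> \<le> (norm (a - b))\<^sup>2 - ((a - b) \<bullet> u)\<^sup>2"
      using power_mono[OF patch_inner_bound[OF A(1) compact_imp_closed[OF K] ab(1,2)], of 2]
      by (simp add: power_mult_distrib algebra_simps)
    also have "\<dots> = (norm (orth_proj u (a - b)))\<^sup>2" by (simp add: norm_orth_proj u)
    finally have "(1 - \<epsilon>\<^sup>2) * norm (a - b) \<le> norm (orth_proj u (a - b))" by (rule power2_le_imp_le) simp
    then show "dist (top_point K u x) (top_point K u y) \<le> 1 / (1 - \<epsilon>\<^sup>2) * dist x y"
      using e2 by (simp add: ab inv dist_norm orth_proj_diff field_simps)
  qed
  then show ?thesis using B(2) AB by simp
qed

text \<open>Line sections that consist of a single point project to the boundary of a convex set.\<close>

lemma patch_bottom_null: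
  fixes K :: "(real^'n) set"
  assumes A: "A \<subseteq> frontier_with_normal K (cball u \<epsilon>)" "A \<in> sets borel"
    and K: "convex_body K" and u: "norm u = 1" and \<epsilon>: "\<epsilon> < 1"
  shows "emeasure (boundary_measure K u (- u)) A = 0"
proof -
  have Kc: "compact K" "convex K" "interior K \<noteq> {}" using K by (auto simp: convex_body_def)
  have nu: "norm (- u) = 1" using u by simp
  \<comment> \<open>A line that meets the interior has a section of positive length, so one-point
    sections occur only outside this open convex cylinder. The rest of the shadow lies in its
    frontier.\<close>
  define S where "S = shadow (interior K) u"
  have S: "S = (\<Union>s. (+) (s *\<^sub>R u) ` interior K)"
  proof (intro subset_antisym subsetI)
    fix z assume "z \<in> S"
    then obtain s where "z + s *\<^sub>R u \<in> interior K" by (auto simp: S_def shadow_def)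
    moreover have "z = (- s) *\<^sub>R u + (z + s *\<^sub>R u)" by simp
    ultimately show "z \<in> (\<Union>s. (+) (s *\<^sub>R u) ` interior K)" by blast
  next
    fix z assume "z \<in> (\<Union>s. (+) (s *\<^sub>R u) ` interior K)"
    then obtain s y where "z = s *\<^sub>R u + y" "y \<in> interior K" by blast
    then have "z + (- s) *\<^sub>R u \<in> interior K" by simp
    then show "z \<in> S" unfolding S_def shadow_def by blast
  qed
  have opS: "open S" unfolding S by (intro open_UN ballI open_translation) simp
  have cvS: "convex S"
  proof (rule convexI)
    fix x y :: "real^'n" and a b :: real assume xy: "x \<in> S" "y \<in> S" and ab: "0 \<le> a" "0 \<le> b" "a + b = 1"
    then obtain s t where "x + s *\<^sub>R u \<in> interior K" "y + t *\<^sub>R u \<in> interior K" by (auto simp: S_def shadow_def)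
    then have "a *\<^sub>R (x + s *\<^sub>R u) + b *\<^sub>R (y + t *\<^sub>R u) \<in> interior K"
      using convexD[OF convex_interior[OF Kc(2)]] ab by blast
    then have "(a *\<^sub>R x + b *\<^sub>R y) + (a * s + b * t) *\<^sub>R u \<in> interior K" by (simp add: algebra_simps)
    then show "a *\<^sub>R x + b *\<^sub>R y \<in> S" unfolding S_def shadow_def by blast
  qed
  have neg: "negligible (frontier S)" by (rule negligible_convex_frontier[OF cvS])
  have clS: "z \<in> closure S" if z: "z \<in> shadow K u" for z
  proof -
    obtain s where s: "z + s *\<^sub>R u \<in> K" using z by (auto simp: shadow_def)
    have "K = closure (interior K)" using convex_closure_interior[OF Kc(2,3)] compact_imp_closed[OF Kc(1)] by simp
    then have "z + s *\<^sub>R u \<in> closure (interior K)" using s by simp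
    then have "(- s) *\<^sub>R u + (z + s *\<^sub>R u) \<in> (+) ((- s) *\<^sub>R u) ` closure (interior K)" by blast
    also have "\<dots> = closure ((+) ((- s) *\<^sub>R u) ` interior K)" by (rule closure_translation[symmetric])
    also have "\<dots> \<subseteq> closure S" unfolding S by (intro closure_mono) blast
    finally show ?thesis by simp
  qed
  have deg: "z \<notin> S" if z: "z \<in> shadow K u" and eq: "top_point K u z = top_point K (- u) z" for z
  proof
    assume "z \<in> S"
    then obtain s where "z + s *\<^sub>R u \<in> interior K" by (auto simp: S_def shadow_def)
    then obtain r where r: "r > 0" "cball (z + s *\<^sub>R u) r \<subseteq> K" by (auto simp: mem_interior_cball)
    have "z + s *\<^sub>R u + r *\<^sub>R u \<in> K" "z + s *\<^sub>R u - r *\<^sub>R u \<in> K" using r u by (auto simp: dist_norm)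
    then have "z + (s + r) *\<^sub>R u \<in> K" "z + (r - s) *\<^sub>R (- u) \<in> K" by (simp_all add: algebra_simps)
    then have "s + r \<le> height K u z" "r - s \<le> height K (- u) z"
      using height_ge[OF Kc(1) u z] height_ge[OF Kc(1) nu, of z] z by (auto simp: shadow_uminus)
    moreover have "(height K u z + height K (- u) z) *\<^sub>R u = 0"
      using eq by (simp add: top_point_def algebra_simps)
    then have "height K u z + height K (- u) z = 0" using u by auto
    ultimately show False using r by simp
  qed
  have "{z \<in> strip u \<inter> shadow K u. top_point K (- u) z \<in> A} \<subseteq> frontier S"
  proof
    fix z assume z: "z \<in> {z \<in> strip u \<inter> shadow K u. top_point K (- u) z \<in> A}"
    then have zs: "z \<in> shadow K u" by simp
    \<comment> \<open>A point of the patch is the upper end of its line. Here it is also the lower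
      end, so the section is a single point.\<close>
    have "top_point K (- u) z = z + (- height K (- u) z) *\<^sub>R u" by (simp add: top_point_def)
    then have "top_point K u (top_point K (- u) z) = top_point K u z" using top_point_shift(1)[OF Kc(1) u zs] by metis
    moreover have "top_point K u (top_point K (- u) z) = top_point K (- u) z"
      using z by (intro patch_top_point[OF A(1) Kc(1) u \<epsilon>]) simp
    ultimately show "z \<in> frontier S" using deg[OF zs] clS[OF zs] opS by (simp add: frontier_def interior_open)
  qed
  then show ?thesis
    using emeasure_lborel_negligible[OF neg] by (simp add: emeasure_boundary_measure Kc u A)
qed

lemma sphere_finite_net:
  assumes "r > 0"
  obtains I where "finite I" "I \<subseteq> sphere (0::real^'n) 1" "\<And>w. norm w = 1 \<Longrightarrow> \<exists>u\<in>I. norm (w - u) \<le> r"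
proof -
  have "seq_compact (sphere (0::real^'n) 1)" by (simp add: compact_imp_seq_compact)
  then obtain I where I: "finite I" "I \<subseteq> sphere (0::real^'n) 1" "sphere 0 1 \<subseteq> (\<Union>x\<in>I. ball x r)"
    using seq_compact_imp_totally_bounded[of "sphere (0::real^'n) 1"] assms by blast
  have "\<exists>u\<in>I. norm (w - u) \<le> r" if "norm w = 1" for w
  proof -
    have "w \<in> sphere 0 1" using that by simp
    then obtain u where "u \<in> I" "w \<in> ball u r" using I by blast
    then show ?thesis by (auto simp: dist_norm norm_minus_commute intro!: bexI[of _ u] less_imp_le)
  qed
  then show ?thesis using that I by blast
qed

lemma frontier_patch_cover:
  assumes K: "convex_body K" and I: "\<And>w. norm w = 1 \<Longrightarrow> \<exists>u\<in>I. norm (w - u) \<le> r"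
  shows "frontier K \<subseteq> (\<Union>u\<in>I. frontier_with_normal K (cball u r))"
proof
  fix y assume y: "y \<in> frontier K"
  obtain w where w: "is_outer_unit_normal K y w" using outer_unit_normal_exists[OF K y] by blast
  then obtain u where "u \<in> I" "norm (w - u) \<le> r" using I by (auto simp: is_outer_unit_normal_def)
  moreover from this have "w \<in> cball u r" by (simp add: dist_norm norm_minus_commute)
  ultimately show "y \<in> (\<Union>u\<in>I. frontier_with_normal K (cball u r))"
    using w y unfolding frontier_with_normal_def by blast
qed

section \<open>Signed area against surface area on patches\<close>

text \<open>Finitely many patches of radius \<open>1/2\<close> cover the boundary, and the surface
  measure of each is at most a constant times its finite projected area.\<close>

lemma surface_frontier_finite:
  fixes K :: "(real^'n) set"
  assumes K: "convex_body K"
  shows "emeasure hausdorff_surface (frontier K) < \<infinity>"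
proof -
  have Kc: "compact K" using K by (auto simp: convex_body_def)
  obtain I where I: "finite I" "I \<subseteq> sphere (0::real^'n) 1" "\<And>w. norm w = 1 \<Longrightarrow> \<exists>u\<in>I. norm (w - u) \<le> 1/2"
    by (rule sphere_finite_net[of "1/2"]) auto
  let ?P = "\<lambda>u. frontier_with_normal K (cball u (1/2))"
  have Pb: "?P u \<in> sets borel" for u by (rule frontier_with_normal_borel[OF Kc]) simp
  have "emeasure hausdorff_surface (frontier K) \<le> emeasure hausdorff_surface (\<Union>u\<in>I. ?P u)"
    using frontier_patch_cover[OF K I(3)] I(1) Pb by (intro emeasure_mono) auto
  also have "\<dots> \<le> (\<Sum>u\<in>I. emeasure hausdorff_surface (?P u))"
    using I(1) Pb by (intro emeasure_subadditive_finite) auto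
  also have "\<dots> < \<infinity>"
  proof -
    have "emeasure hausdorff_surface (?P u) < top" if "u \<in> I" for u
    proof -
      have u: "norm u = 1" using that I by auto
      interpret finite_measure "boundary_measure K u u" by (rule finite_boundary_measure) (use Kc u in auto)
      have "emeasure hausdorff_surface (?P u) \<le> ennreal ((1 / (1 - (1/2)\<^sup>2)) ^ (CARD('n) - 1)) * emeasure (boundary_measure K u u) (?P u)"
        by (rule patch_surface_le) (use Pb Kc u in auto)
      also have "\<dots> < top" by (auto simp: ennreal_mult_eq_top_iff less_top[symmetric] emeasure_finite)
      finally show ?thesis .
    qed
    then show ?thesis using I(1) by simp
  qed
  finally show ?thesis .
qed

lemma fmeasurable_surface:
  fixes K :: "(real^'n) set"
  assumes K: "convex_body K" and A: "A \<in> sets borel" "A \<subseteq> frontier K"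
  shows "A \<in> fmeasurable hausdorff_surface"
proof (rule fmeasurableI)
  have "frontier K \<in> sets hausdorff_surface" by simp
  then have "emeasure hausdorff_surface A \<le> emeasure hausdorff_surface (frontier K)"
    using A by (intro emeasure_mono) auto
  then show "emeasure hausdorff_surface A < \<infinity>" using surface_frontier_finite[OF K] by simp
qed (use A in simp)

lemma measure_boundary_measure_le:
  fixes K :: "(real^'n) set"
  assumes K: "convex_body K" and e: "norm e = 1" "v = e \<or> v = - e" and A: "A \<in> sets borel" "A \<subseteq> frontier K"
  shows "measure (boundary_measure K e v) A \<le> measure hausdorff_surface A"
  using boundary_measure_le[OF _ e A(1), of K] K fmeasurable_surface[OF K A]
  unfolding measure_def convex_body_def by (intro enn2real_mono) (auto simp: fmeasurable_def)

lemma abs_signed_area_le: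
  fixes K :: "(real^'n) set"
  assumes K: "convex_body K" and e: "norm e = 1" and A: "A \<in> sets borel" "A \<subseteq> frontier K"
  shows "\<bar>signed_area K e A\<bar> \<le> measure hausdorff_surface A"
  using measure_boundary_measure_le[OF K e disjI1[OF refl] A] measure_boundary_measure_le[OF K e disjI2[OF refl] A]
    measure_nonneg[of "boundary_measure K e e" A] measure_nonneg[of "boundary_measure K e (- e)" A]
  unfolding signed_area_def by linarith

text \<open>The Lipschitz constant enters with the power \<open>CARD('n) - 1\<close>, and
  Bernoulli's inequality turns this power into a loss of order \<epsilon> squared. The measure for
  the opposite side vanishes on the patch, so nothing is subtracted.\<close>

lemma patch_signed_area_ge:
  fixes K :: "(real^'n) set"
  assumes A: "A \<subseteq> frontier_with_normal K (cball u \<epsilon>)" "A \<in> sets borel"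
    and K: "convex_body K" and u: "norm u = 1" and \<epsilon>: "0 \<le> \<epsilon>" "\<epsilon> < 1"
  shows "(1 - real CARD('n) * \<epsilon>\<^sup>2) * measure hausdorff_surface A \<le> signed_area K u A"
proof -
  have Kc: "compact K" using K by (simp add: convex_body_def)
  have AF: "A \<subseteq> frontier K" using A(1) by (auto simp: frontier_with_normal_def)
  have e2: "0 < 1 - \<epsilon>\<^sup>2" "\<epsilon>\<^sup>2 \<ge> 0" using \<epsilon> by (simp_all add: power_less_one_iff abs_square_less_1)
  let ?m = "CARD('n) - 1"
  interpret finite_measure "boundary_measure K u u" by (rule finite_boundary_measure) (use Kc u in auto)
  have "ennreal (measure hausdorff_surface A) \<le> ennreal ((1 / (1 - \<epsilon>\<^sup>2)) ^ ?m) * ennreal (measure (boundary_measure K u u) A)"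
    using patch_surface_le[OF A Kc u \<epsilon>] fmeasurable_surface[OF K A(2) AF]
    by (simp add: emeasure_eq_measure2 emeasure_eq_measure)
  then have "measure hausdorff_surface A \<le> (1 / (1 - \<epsilon>\<^sup>2)) ^ ?m * measure (boundary_measure K u u) A"
    using e2 by (simp add: ennreal_mult[symmetric])
  then have le: "(1 - \<epsilon>\<^sup>2) ^ ?m * measure hausdorff_surface A \<le> measure (boundary_measure K u u) A"
    using e2 by (simp add: power_one_over divide_simps mult.commute)
  have "1 - real CARD('n) * \<epsilon>\<^sup>2 \<le> 1 - real ?m * \<epsilon>\<^sup>2"
    using e2 by (simp add: mult_right_mono)
  also have "\<dots> \<le> (1 - \<epsilon>\<^sup>2) ^ ?m"
    using Bernoulli_inequality[of "- \<epsilon>\<^sup>2" ?m] e2 by simp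
  finally have "(1 - real CARD('n) * \<epsilon>\<^sup>2) * measure hausdorff_surface A \<le> (1 - \<epsilon>\<^sup>2) ^ ?m * measure hausdorff_surface A"
    by (rule mult_right_mono) simp
  moreover have "measure (boundary_measure K u (- u)) A = 0"
    using patch_bottom_null[OF A K u \<epsilon>(2)] by (simp add: measure_def)
  ultimately show ?thesis using le by (simp add: signed_area_def)
qed

text \<open>
  The signed areas of a set form a vector whose length is at most the surface measure \<open>\<sigma>\<close>. If its
  component in direction \<open>u\<close> is almost \<open>\<sigma>\<close>, it is close to \<open>\<sigma> u\<close>.
\<close>

lemma patch_signed_area:
  fixes K :: "(real^'n) set"
  assumes A: "A \<subseteq> frontier_with_normal K (cball u \<epsilon>)" "A \<in> sets borel"
    and K: "convex_body K" and u: "norm u = 1" and \<epsilon>: "0 \<le> \<epsilon>" "\<epsilon> < 1" and e: "norm e = 1"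
  shows "\<bar>signed_area K e A - (u \<bullet> e) * measure hausdorff_surface A\<bar> \<le> sqrt (2 * real CARD('n)) * \<epsilon> * measure hausdorff_surface A"
proof -
  have Kc: "compact K" "convex K" using K by (auto simp: convex_body_def)
  have AF: "A \<subseteq> frontier K" using A(1) by (auto simp: frontier_with_normal_def)
  define s where "s = measure hausdorff_surface A"
  have s0: "s \<ge> 0" by (simp add: s_def)
  \<comment> \<open>Linearity makes \<open>q\<close> the vector of signed areas for all unit
    directions at once. Testing it in its own direction bounds its length by
    \<open>s\<close>.\<close>
  define q where "q = (\<Sum>i\<in>Basis. signed_area K i A *\<^sub>R i)"
  have q: "q \<bullet> v = signed_area K v A" if v: "norm v = 1" for v
    by (subst signed_area_linear[OF Kc v A(2)]) (simp add: q_def inner_sum_left inner_commute[of v] mult.commute)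
  have nq: "norm q \<le> s"
  proof (cases "q = 0")
    case False
    have nv: "norm (q /\<^sub>R norm q) = 1" using False by simp
    have "q \<bullet> (q /\<^sub>R norm q) \<le> s" using abs_signed_area_le[OF K nv A(2) AF] by (simp only: q[OF nv] s_def)
    moreover have "q \<bullet> (q /\<^sub>R norm q) = norm q"
      using False by (simp add: dot_square_norm power2_eq_square)
    ultimately show ?thesis by simp
  qed (simp add: s0)
  have qu: "(1 - real CARD('n) * \<epsilon>\<^sup>2) * s \<le> q \<bullet> u"
    using patch_signed_area_ge[OF A K u \<epsilon>] by (simp add: q[OF u] s_def)
  \<comment> \<open>Since \<open>norm q \<le> s\<close> and \<open>q \<bullet> u\<close> falls short
    of \<open>s\<close> by at most \<open>n * \<epsilon>\<^sup>2 * s\<close>, with \<open>n\<close>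
    the dimension, the square is at most \<open>2 * n * \<epsilon>\<^sup>2 * s\<^sup>2\<close>. Its
    root is the asserted bound.\<close>
  have "(norm (q - s *\<^sub>R u))\<^sup>2 = (norm q)\<^sup>2 - 2 * s * (q \<bullet> u) + s\<^sup>2"
  proof -
    have "u \<bullet> u = 1" using u by (simp add: norm_eq_1)
    then show ?thesis
      unfolding power2_norm_eq_inner inner_diff_left inner_diff_right inner_scaleR_left inner_scaleR_right inner_commute[of u q]
      by (simp add: power2_eq_square algebra_simps)
  qed
  also have "\<dots> \<le> s\<^sup>2 - 2 * s * ((1 - real CARD('n) * \<epsilon>\<^sup>2) * s) + s\<^sup>2"
  proof -
    have "(norm q)\<^sup>2 \<le> s\<^sup>2" by (rule power_mono[OF nq]) simp
    moreover have "2 * s * ((1 - real CARD('n) * \<epsilon>\<^sup>2) * s) \<le> 2 * s * (q \<bullet> u)"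
      by (rule mult_left_mono[OF qu]) (use s0 in simp)
    ultimately show ?thesis by linarith
  qed
  also have "\<dots> = (sqrt (2 * real CARD('n)) * \<epsilon> * s)\<^sup>2"
    by (simp add: power_mult_distrib power2_eq_square algebra_simps)
  finally have d: "norm (q - s *\<^sub>R u) \<le> sqrt (2 * real CARD('n)) * \<epsilon> * s"
    by (rule power2_le_imp_le) (use s0 \<epsilon> in auto)
  have "\<bar>(q - s *\<^sub>R u) \<bullet> e\<bar> \<le> norm (q - s *\<^sub>R u)"
    using Cauchy_Schwarz_ineq2[of "q - s *\<^sub>R u" e] e by simp
  then show ?thesis using d by (simp add: inner_diff_left q[OF e] s_def mult.commute)
qed

section \<open>Points with several normals\<close>

definition singular_points :: "(real^'n) set \<Rightarrow> (real^'n) set" where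
  "singular_points K = {y \<in> frontier K. \<not> (\<exists>!w. is_outer_unit_normal K y w)}"

text \<open>On a set with normals near \<open>u\<close> and also normals near \<open>v\<close>, the
  vector of signed areas is close to both \<open>s u\<close> and \<open>s v\<close>. If
  \<open>u\<close> and \<open>v\<close> are farther apart than the two errors together, then
  \<open>s = 0\<close>. Finite nets at each scale leave countably many such pairs.\<close>

lemma singular_points_null:
  fixes K :: "(real^'n) set"
  assumes K: "convex_body K"
  shows "singular_points K \<in> null_sets hausdorff_surface"
proof -
  have Kc: "compact K" using K by (simp add: convex_body_def)
  define C where "C = sqrt (2 * real CARD('n))"
  have "1 \<le> real CARD('n)" by (simp add: Suc_leI)
  then have "1 \<le> 2 * real CARD('n)" by linarith
  then have C1: "C \<ge> 1" by (simp add: C_def)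
  define r where "r m = 1 / real (m + 2)" for m :: nat
  have r: "0 < r m" "r m < 1" for m by (simp_all add: r_def)
  have "\<exists>I. finite I \<and> I \<subseteq> sphere (0::real^'n) 1 \<and> (\<forall>w. norm w = 1 \<longrightarrow> (\<exists>u\<in>I. norm (w - u) \<le> r m))" for m
    using sphere_finite_net[OF r(1)[of m]] by metis
  then obtain I where I: "\<And>m. finite (I m)" "\<And>m. I m \<subseteq> sphere (0::real^'n) 1"
    "\<And>m w. norm w = 1 \<Longrightarrow> \<exists>u\<in>I m. norm (w - u) \<le> r m" by metis
  let ?P = "\<lambda>m u. frontier_with_normal K (cball u (r m))"
  \<comment> \<open>Above the threshold \<open>2 * C * r m\<close> the two patches meet in a null
    set; since \<open>C \<ge> 1\<close>, normals within \<open>r m\<close> of \<open>u\<close> and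
    \<open>v\<close> are then also distinct. This yields an equality with \<open>Z\<close>, hence
    measurability of the singular points.\<close>
  define Z where "Z = (\<Union>m. \<Union>(u, v)\<in>{(u, v) \<in> I m \<times> I m. norm (u - v) > 2 * C * r m}. ?P m u \<inter> ?P m v)"
  have "singular_points K = Z"
  proof (intro subset_antisym subsetI)
    fix y assume y: "y \<in> singular_points K"
    then have yF: "y \<in> frontier K" by (simp add: singular_points_def)
    obtain w where w: "is_outer_unit_normal K y w" using outer_unit_normal_exists[OF K yF] by blast
    obtain w' where w': "is_outer_unit_normal K y w'" "w \<noteq> w'" using y w unfolding singular_points_def by blast
    define d where "d = norm (w - w')"
    have "d > 0" using w' by (simp add: d_def)
    \<comment> \<open>Replacing both normals by points of the net costs \<open>2 * r m\<close> on
      top of the threshold \<open>2 * C * r m\<close>.\<close>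
    obtain m where m: "(2 * C + 2) / d < real m" using reals_Archimedean2 by blast
    then have "(2 * C + 2) / d < real (m + 2)" by simp
    then have md: "(2 * C + 2) * r m < d" using \<open>d > 0\<close> by (simp add: r_def field_simps)
    obtain u v where uv: "u \<in> I m" "norm (w - u) \<le> r m" "v \<in> I m" "norm (w' - v) \<le> r m"
      using I(3) w w' unfolding is_outer_unit_normal_def by metis
    have "w - w' = ((w - u) + (u - v)) - (w' - v)" by simp
    then have "d \<le> norm (w - u) + norm (u - v) + norm (w' - v)"
      using norm_triangle_ineq4[of "(w - u) + (u - v)" "w' - v"] norm_triangle_ineq[of "w - u" "u - v"]
      unfolding d_def by simp
    then have "norm (u - v) > 2 * C * r m" using uv md by (simp add: algebra_simps)
    moreover have "y \<in> ?P m u" "y \<in> ?P m v"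
      using yF w w'(1) uv unfolding frontier_with_normal_def
      by (auto simp: dist_norm norm_minus_commute)
    ultimately show "y \<in> Z" unfolding Z_def using uv by blast
  next
    fix y assume "y \<in> Z"
    then obtain m u v where uv: "norm (u - v) > 2 * C * r m" "y \<in> ?P m u" "y \<in> ?P m v" unfolding Z_def by blast
    obtain w w' where w: "is_outer_unit_normal K y w" "norm (u - w) \<le> r m" "is_outer_unit_normal K y w'" "norm (v - w') \<le> r m"
      using uv by (auto simp: frontier_with_normal_def dist_norm)
    have "w \<noteq> w'"
    proof
      assume "w = w'"
      then have "norm (u - v) \<le> norm (u - w) + norm (v - w')"
        using norm_triangle_ineq4[of "u - w" "v - w'"] by simp
      then have "norm (u - v) \<le> 2 * 1 * r m" using w by simp
      also have "\<dots> \<le> 2 * C * r m" using C1 r[of m] by (intro mult_right_mono) auto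
      finally show False using uv by simp
    qed
    then show "y \<in> singular_points K" using w uv(2) unfolding singular_points_def frontier_with_normal_def by blast
  qed
  moreover have "Z \<in> null_sets hausdorff_surface"
    unfolding Z_def
  proof (intro null_sets_UN null_sets_UN' countable_finite)
    fix m
    show "finite {(u, v) \<in> I m \<times> I m. norm (u - v) > 2 * C * r m}"
      by (rule finite_subset[of _ "I m \<times> I m"]) (use I in auto)
    fix p assume "p \<in> {(u, v) \<in> I m \<times> I m. norm (u - v) > 2 * C * r m}"
    then obtain u v where p: "p = (u, v)" "u \<in> I m" "v \<in> I m" "norm (u - v) > 2 * C * r m" by auto
    have nuv: "norm u = 1" "norm v = 1" using p(2,3) I(2)[of m] by auto
    define A where "A = ?P m u \<inter> ?P m v"
    have Ab: "A \<in> sets borel" unfolding A_def by (intro sets.Int frontier_with_normal_borel Kc) auto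
    have AF: "A \<subseteq> frontier K" by (auto simp: A_def frontier_with_normal_def)
    define s where "s = measure hausdorff_surface A"
    define e where "e = (u - v) /\<^sub>R norm (u - v)"
    have uv0: "norm (u - v) > 0" using p(4) C1 r[of m] by (smt (verit) mult_nonneg_nonneg)
    have e: "norm e = 1" using uv0 by (simp add: e_def)
    have "\<bar>signed_area K e A - (u \<bullet> e) * s\<bar> \<le> C * r m * s" "\<bar>signed_area K e A - (v \<bullet> e) * s\<bar> \<le> C * r m * s"
      unfolding s_def C_def
      by (rule patch_signed_area; use Ab K nuv r[of m] e in \<open>auto simp: A_def\<close>)+
    then have "(u \<bullet> e) * s - (v \<bullet> e) * s \<le> 2 * (C * r m * s)" by linarith
    moreover have "(u - v) \<bullet> e = norm (u - v)"
      using uv0 by (simp add: e_def dot_square_norm power2_eq_square)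
    then have "u \<bullet> e - v \<bullet> e = norm (u - v)" by (simp only: inner_diff_left)
    then have "norm (u - v) * s = (u \<bullet> e) * s - (v \<bullet> e) * s" by (metis left_diff_distrib)
    ultimately have "(norm (u - v) - 2 * C * r m) * s \<le> 0" by (simp add: algebra_simps)
    moreover have "s \<ge> 0" by (simp add: s_def)
    ultimately have "s = 0" using p(4) by (simp add: mult_le_0_iff)
    then have "emeasure hausdorff_surface A = 0"
      using fmeasurable_surface[OF K Ab AF] by (simp add: s_def emeasure_eq_measure2)
    then show "(case p of (u, v) \<Rightarrow> ?P m u \<inter> ?P m v) \<in> null_sets hausdorff_surface"
      using Ab by (simp add: p A_def null_sets_def)
  qed
  ultimately show ?thesis by simp
qed


section \<open>Signed area as an integral of the normal\<close>

lemma outer_normal_unique: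
  assumes "y \<in> frontier K" "y \<notin> singular_points K" "is_outer_unit_normal K y w"
  shows "outer_normal K y = w"
proof -
  have ex: "\<exists>!w. is_outer_unit_normal K y w" using assms by (auto simp: singular_points_def)
  then show ?thesis using assms(3) by (auto simp: outer_normal_def intro: the1_equality)
qed

lemma norm_outer_normal_le: "norm (outer_normal K y) \<le> 1"
proof (cases "\<exists>!w. is_outer_unit_normal K y w")
  case True
  then have "is_outer_unit_normal K y (outer_normal K y)" using theI'[OF True] by (simp add: outer_normal_def)
  then show ?thesis by (simp add: is_outer_unit_normal_def)
qed (simp add: outer_normal_def)

lemma singular_points_borel [measurable]: "convex_body K \<Longrightarrow> singular_points K \<in> sets borel"
  using singular_points_null[of K] by (auto simp: null_sets_def)

text \<open>At regular points the normal lies in a closed set \<open>C\<close> iff the point belongs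
  to the closed set \<open>frontier_with_normal K C\<close>; elsewhere the function is
  \<open>0\<close>. So preimages of complements of open sets are computed.\<close>

lemma outer_normal_measurable:
  fixes K :: "(real^'n) set"
  assumes K: "convex_body K"
  shows "(\<lambda>y. indicator (frontier K) y *\<^sub>R outer_normal K y) \<in> borel_measurable borel"
proof (rule borel_measurableI)
  let ?f = "\<lambda>y. indicator (frontier K) y *\<^sub>R outer_normal K y"
  have Kc: "compact K" using K by (simp add: convex_body_def)
  define R where "R = frontier K - singular_points K"
  have Rb: "R \<in> sets borel" unfolding R_def using K by (intro sets.Diff singular_points_borel borel_closed) auto
  fix U :: "(real^'n) set" assume "open U"
  define D where "D = - U"
  have clC: "closed D" using \<open>open U\<close> by (auto simp: D_def)
  have zero: "?f y = 0" if "y \<notin> R" for y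
    using that by (auto simp: R_def singular_points_def outer_normal_def indicator_def)
  have zero': "?f y \<in> C \<longleftrightarrow> 0 \<in> C" if "y \<notin> R" for y C by (simp only: zero[OF that])
  have RN: "?f y \<in> C \<longleftrightarrow> y \<in> frontier_with_normal K C" if y: "y \<in> R" for y C
  proof -
    obtain w where w: "is_outer_unit_normal K y w" using outer_unit_normal_exists[OF K, of y] y by (auto simp: R_def)
    have N: "outer_normal K y = w'" if "is_outer_unit_normal K y w'" for w'
      using outer_normal_unique[OF _ _ that] y by (auto simp: R_def)
    have "?f y = w" using N[OF w] y by (simp add: R_def)
    then show ?thesis using N w y by (auto simp: frontier_with_normal_def R_def)
  qed
  have "?f -` D = (R \<inter> frontier_with_normal K D) \<union> (if 0 \<in> D then - R else {})"
  proof (rule set_eqI)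
    fix y
    show "y \<in> ?f -` D \<longleftrightarrow> y \<in> (R \<inter> frontier_with_normal K D) \<union> (if 0 \<in> D then - R else {})"
      using zero'[of y D] RN[of y D] by (cases "y \<in> R") (simp_all del: scaleR_eq_0_iff)
  qed
  then have "?f -` D \<in> sets borel"
    using Rb frontier_with_normal_borel[OF Kc clC] by auto
  then have "- (?f -` D) \<in> sets borel" by auto
  then show "?f -` U \<inter> space borel \<in> sets borel" by (simp add: D_def vimage_Compl)
qed

lemma outer_normal_measurable_on:
  fixes K :: "(real^'n) set"
  assumes K: "convex_body K" and A: "A \<in> sets borel" "A \<subseteq> frontier K"
  shows "(\<lambda>y. indicator A y * (outer_normal K y \<bullet> e)) \<in> borel_measurable borel"
proof -
  note [measurable] = outer_normal_measurable[OF K] A(1)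
  have eq: "(\<lambda>y. indicator A y * (outer_normal K y \<bullet> e)) = (\<lambda>y. indicator A y * ((indicator (frontier K) y *\<^sub>R outer_normal K y) \<bullet> e))"
    using A(2) by (auto simp: fun_eq_iff indicator_def)
  show ?thesis unfolding eq by measurable
qed

lemma integrable_surface_bounded:
  fixes K :: "(real^'n) set" and f :: "real^'n \<Rightarrow> real"
  assumes K: "convex_body K" and A: "A \<in> sets borel" "A \<subseteq> frontier K"
    and f: "f \<in> borel_measurable borel" "\<And>y. y \<notin> A \<Longrightarrow> f y = 0" "\<And>y. \<bar>f y\<bar> \<le> B"
  shows "integrable hausdorff_surface f"
proof (rule integrableI_bounded_set[where A=A and B=B])
  show "emeasure hausdorff_surface A < \<infinity>" using fmeasurable_surface[OF K A] by (simp add: fmeasurable_def)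
qed (use A f in auto)

lemma integrable_outer_normal:
  fixes K :: "(real^'n) set"
  assumes K: "convex_body K" and A: "A \<in> sets borel" "A \<subseteq> frontier K"
  shows "integrable hausdorff_surface (\<lambda>y. indicator A y * (outer_normal K y \<bullet> e))"
proof (rule integrable_surface_bounded[OF K A outer_normal_measurable_on[OF K A], where B="norm e"])
  fix y
  have "\<bar>outer_normal K y \<bullet> e\<bar> \<le> norm (outer_normal K y) * norm e" by (rule Cauchy_Schwarz_ineq2)
  also have "\<dots> \<le> 1 * norm e" by (intro mult_right_mono norm_outer_normal_le) simp
  finally show "\<bar>indicator A y * (outer_normal K y \<bullet> e)\<bar> \<le> norm e" by (simp add: indicator_def)
qed simp

text \<open>The counterpart of \<open>patch_signed_area\<close> for the integral: both quantities
  are compared with \<open>u \<bullet> e\<close> times the area. At singular points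
  \<open>outer_normal\<close> says nothing about the patch, but these form a null set.\<close>

lemma patch_normal_integral:
  fixes K :: "(real^'n) set"
  assumes A: "A \<subseteq> frontier_with_normal K (cball u r)" "A \<in> sets borel"
    and K: "convex_body K" and e: "norm e = 1" and r: "0 \<le> r"
  shows "\<bar>(LINT y|hausdorff_surface. indicator A y * (outer_normal K y \<bullet> e)) - (u \<bullet> e) * measure hausdorff_surface A\<bar>
    \<le> r * measure hausdorff_surface A"
proof -
  have AF: "A \<subseteq> frontier K" using A(1) by (auto simp: frontier_with_normal_def)
  have iA: "integrable hausdorff_surface (\<lambda>y. indicator A y * c :: real)" for c
    by (rule integrable_surface_bounded[OF K A(2) AF, where B="\<bar>c\<bar>"]) (use A in \<open>auto simp: indicator_def\<close>)
  have mA: "(LINT y|hausdorff_surface. indicator A y * c) = c * measure hausdorff_surface A" for c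
    using A(2) by simp
  note iN = integrable_outer_normal[OF K A(2) AF, of e]
  have "(LINT y|hausdorff_surface. indicator A y * (outer_normal K y \<bullet> e)) - (u \<bullet> e) * measure hausdorff_surface A
     = (LINT y|hausdorff_surface. indicator A y * (outer_normal K y \<bullet> e) - indicator A y * (u \<bullet> e))"
    by (subst Bochner_Integration.integral_diff[OF iN iA]) (simp only: mA)
  also have "\<bar>\<dots>\<bar> \<le> (LINT y|hausdorff_surface. \<bar>indicator A y * (outer_normal K y \<bullet> e) - indicator A y * (u \<bullet> e)\<bar>)"
    by (rule integral_abs_bound)
  also have "\<dots> \<le> (LINT y|hausdorff_surface. indicator A y * r)"
  proof (rule integral_mono_AE)
    show "integrable hausdorff_surface (\<lambda>y. \<bar>indicator A y * (outer_normal K y \<bullet> e) - indicator A y * (u \<bullet> e)\<bar>)"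
      by (intro integrable_abs Bochner_Integration.integrable_diff iN iA)
    show "integrable hausdorff_surface (\<lambda>y. indicator A y * r)" by (rule iA)
    have "AE y in hausdorff_surface. y \<notin> singular_points K" by (rule AE_not_in[OF singular_points_null[OF K]])
    then show "AE y in hausdorff_surface. \<bar>indicator A y * (outer_normal K y \<bullet> e) - indicator A y * (u \<bullet> e)\<bar> \<le> indicator A y * r"
    proof eventually_elim
      case (elim y)
      show ?case
      proof (cases "y \<in> A")
        case True
        then obtain w where w: "is_outer_unit_normal K y w" "norm (w - u) \<le> r"
          using A(1) by (auto simp: frontier_with_normal_def dist_norm norm_minus_commute)
        have "outer_normal K y = w" using outer_normal_unique[OF _ elim w(1)] True AF by auto
        then have "\<bar>outer_normal K y \<bullet> e - u \<bullet> e\<bar> \<le> norm (w - u)"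
          using Cauchy_Schwarz_ineq2[of "w - u" e] e by (simp add: inner_diff_left)
        then show ?thesis using True w(2) by simp
      qed simp
    qed
  qed
  finally show ?thesis by (simp only: mA)
qed

text \<open>Both sides are additive in \<open>A\<close>, and on a patch of radius \<open>r\<close>
  they differ by at most \<open>c * r\<close> times the area of the patch. The areas of disjoint
  pieces add up, so the total error is \<open>c * r * s A\<close> for any number of patches, and
  \<open>r\<close> may tend to \<open>0\<close>.\<close>

lemma signed_area_eq_integral:
  fixes K :: "(real^'n) set"
  assumes K: "convex_body K" and A: "A \<in> sets borel" "A \<subseteq> frontier K" and e: "norm e = 1"
  shows "signed_area K e A = (LINT y|hausdorff_surface. indicator A y * (outer_normal K y \<bullet> e))"
proof -
  have Kc: "compact K" using K by (simp add: convex_body_def)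
  define I where "I A = (LINT y|hausdorff_surface. indicator A y * (outer_normal K y \<bullet> e))" for A
  define s where "s A = measure hausdorff_surface A" for A :: "(real^'n) set"
  define c where "c = sqrt (2 * real CARD('n)) + 1"
  have split: "I (A \<inter> P) + I (A - P) = I A" "s (A \<inter> P) + s (A - P) = s A"
    "signed_area K e (A \<inter> P) + signed_area K e (A - P) = signed_area K e A"
    if A: "A \<in> sets borel" "A \<subseteq> frontier K" and P: "P \<in> sets borel" for A P
  proof -
    have sub: "A \<inter> P \<subseteq> frontier K" "A - P \<subseteq> frontier K" "A \<inter> P \<in> sets borel" "A - P \<in> sets borel" using A P by auto
    have "I A = (LINT y|hausdorff_surface. indicator (A \<inter> P) y * (outer_normal K y \<bullet> e) + indicator (A - P) y * (outer_normal K y \<bullet> e))"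
      unfolding I_def by (intro Bochner_Integration.integral_cong) (auto simp: indicator_def)
    also have "\<dots> = I (A \<inter> P) + I (A - P)"
      unfolding I_def by (intro Bochner_Integration.integral_add integrable_outer_normal K sub)
    finally show "I (A \<inter> P) + I (A - P) = I A" by simp
    have U: "(A \<inter> P) \<union> (A - P) = A" "(A \<inter> P) \<inter> (A - P) = {}" by auto
    have "s ((A \<inter> P) \<union> (A - P)) = s (A \<inter> P) + s (A - P)"
      unfolding s_def using fmeasurable_surface[OF K sub(3,1)] fmeasurable_surface[OF K sub(4,2)] U(2)
      by (intro measure_Un3[THEN trans]) simp_all
    then show "s (A \<inter> P) + s (A - P) = s A" using U by simp
    have "measure (boundary_measure K e v) ((A \<inter> P) \<union> (A - P)) = measure (boundary_measure K e v) (A \<inter> P) + measure (boundary_measure K e v) (A - P)"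
      if "v = e \<or> v = - e" for v
      by (rule finite_measure.finite_measure_Union[OF finite_boundary_measure[OF Kc e that]]) (use sub in auto)
    then show "signed_area K e (A \<inter> P) + signed_area K e (A - P) = signed_area K e A"
      using U by (simp add: signed_area_def)
  qed
  \<comment> \<open>Patches of a net overlap, so they are split off one by one:
    \<open>A \<inter> P\<close> is estimated directly and \<open>A - P\<close> by the induction
    hypothesis.\<close>
  have est: "\<bar>signed_area K e A - I A\<bar> \<le> c * r * s A"
    if r: "0 \<le> r" "r < 1" and J: "finite J" "\<And>u. u \<in> J \<Longrightarrow> norm u = 1"
      and A: "A \<in> sets borel" "A \<subseteq> (\<Union>u\<in>J. frontier_with_normal K (cball u r))" for r J A
    using J A
  proof (induction J arbitrary: A rule: finite_induct)
    case empty
    then show ?case by (simp add: signed_area_def I_def s_def)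
  next
    case (insert u J)
    define P where "P = frontier_with_normal K (cball u r)"
    have Pb: "P \<in> sets borel" unfolding P_def by (rule frontier_with_normal_borel[OF Kc]) simp
    have AF: "A \<subseteq> frontier K" using insert.prems(3) by (auto simp: frontier_with_normal_def)
    have u: "norm u = 1" using insert by simp
    have AP: "A \<inter> P \<in> sets borel" "A \<inter> P \<subseteq> frontier_with_normal K (cball u r)" using insert.prems(2) Pb by (auto simp: P_def)
    have "\<bar>signed_area K e (A \<inter> P) - (u \<bullet> e) * s (A \<inter> P)\<bar> \<le> sqrt (2 * real CARD('n)) * r * s (A \<inter> P)"
      unfolding s_def by (rule patch_signed_area[OF AP(2,1) K u r e])
    moreover have "\<bar>I (A \<inter> P) - (u \<bullet> e) * s (A \<inter> P)\<bar> \<le> r * s (A \<inter> P)"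
      unfolding s_def I_def by (rule patch_normal_integral[OF AP(2,1) K e r(1)])
    ultimately have 1: "\<bar>signed_area K e (A \<inter> P) - I (A \<inter> P)\<bar> \<le> c * r * s (A \<inter> P)"
      by (simp add: c_def algebra_simps)
    have 2: "\<bar>signed_area K e (A - P) - I (A - P)\<bar> \<le> c * r * s (A - P)"
      by (rule insert.IH) (use insert.prems Pb in \<open>auto simp: P_def\<close>)
    have "c * r * s A = c * r * s (A \<inter> P) + c * r * s (A - P)"
      using split(2)[OF insert.prems(2) AF Pb] by (metis distrib_left)
    then show ?case
      using 1 2 split(1,3)[OF insert.prems(2) AF Pb] by linarith
  qed
  have bound: "\<bar>signed_area K e A - I A\<bar> \<le> c * r * s A" if r: "0 < r" "r < 1" for r
  proof -
    obtain J where J: "finite J" "J \<subseteq> sphere (0::real^'n) 1" "\<And>w. norm w = 1 \<Longrightarrow> \<exists>u\<in>J. norm (w - u) \<le> r"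
      by (rule sphere_finite_net[OF r(1)]) auto
    show ?thesis
      by (rule est[OF _ _ J(1)]) (use J(2) r A frontier_patch_cover[OF K J(3)] in auto)
  qed
  have "(\<lambda>m. c * (1 / real (m + 2)) * s A) \<longlonglongrightarrow> c * 0 * s A"
    by (intro tendsto_intros LIMSEQ_ignore_initial_segment lim_1_over_n)
  then have "\<bar>signed_area K e A - I A\<bar> \<le> c * 0 * s A"
  proof (rule LIMSEQ_le_const, intro exI allI impI)
    fix m :: nat
    show "\<bar>signed_area K e A - I A\<bar> \<le> c * (1 / real (m + 2)) * s A" by (rule bound) auto
  qed
  then show ?thesis by (simp add: I_def)
qed

lemma surface_measure_integral:
  fixes K :: "(real^'n) set"
  assumes K: "convex_body K" and B: "B \<in> sets borel" "B \<subseteq> frontier K" and e: "norm e = 1"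
  shows "set_integrable (surface_measure K) B (\<lambda>y. outer_normal K y \<bullet> e)"
    and "(LINT y : B | surface_measure K. outer_normal K y \<bullet> e) = signed_area K e B"
proof -
  have F: "frontier K \<inter> space hausdorff_surface \<in> sets hausdorff_surface" by simp
  have eq: "indicator (frontier K) y *\<^sub>R (indicator B y *\<^sub>R (outer_normal K y \<bullet> e)) = indicator B y * (outer_normal K y \<bullet> e)" for y
    using B(2) by (auto simp: indicator_def)
  show "set_integrable (surface_measure K) B (\<lambda>y. outer_normal K y \<bullet> e)"
    unfolding set_integrable_def surface_measure_def integrable_restrict_space[OF F] eq
    by (rule integrable_outer_normal[OF K B])
  show "(LINT y : B | surface_measure K. outer_normal K y \<bullet> e) = signed_area K e B"
    unfolding set_lebesgue_integral_def surface_measure_def integral_restrict_space[OF F] eq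
    by (rule signed_area_eq_integral[OF K B e, symmetric])
qed

section \<open>Common boundary points of two bodies\<close>

text \<open>A point has diameter \<open>0\<close>, and its weight vanishes only for a positive
  exponent. In dimension one surface measure counts points.\<close>

lemma hausdorff_surface_singleton:
  fixes y :: "real^'n"
  assumes "CARD('n) \<noteq> 1"
  shows "{y} \<in> null_sets hausdorff_surface"
proof -
  have d: "CARD('n) - 1 > 0" using assms zero_less_card_finite[where 'a='n] by linarith
  have "hausdorff_pre (CARD('n) - 1) \<epsilon> {y} = 0" if "\<epsilon> > 0" for \<epsilon>
  proof -
    have "hausdorff_pre (CARD('n) - 1) \<epsilon> {y} \<le> (\<Sum>i::nat. cover_weight (CARD('n) - 1) {y})"
      by (rule hausdorff_pre_le) (use that in auto)
    also have "\<dots> = 0" using d by (simp add: power_0_left)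
    finally show ?thesis by simp
  qed
  then have "hausdorff_outer (CARD('n) - 1) {y} = 0"
    unfolding hausdorff_outer_def by (intro antisym SUP_least) auto
  then show ?thesis by (simp add: null_sets_def emeasure_hausdorff_surface)
qed

text \<open>
  Every normal of \<open>K\<close> or \<open>L\<close> at a common boundary point is a normal of \<open>K \<inter> L\<close>. So at a regular
  point of \<open>K \<inter> L\<close> the two bodies have the same normal.
\<close>

lemma common_frontier_subset:
  fixes K L :: "(real^'n) set"
  assumes K: "convex_body K" and L: "convex_body L"
  shows "frontier K \<inter> frontier L \<subseteq> singular_points (K \<inter> L) \<union>
    {y \<in> frontier K \<inter> frontier L. \<exists>w. is_outer_unit_normal K y w \<and> is_outer_unit_normal L y w}"
proof
  fix y assume y: "y \<in> frontier K \<inter> frontier L"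
  have cl: "closed K" "closed L" using K L by (auto simp: convex_body_def compact_imp_closed)
  obtain w w' where w: "is_outer_unit_normal K y w" "is_outer_unit_normal L y w'"
    using outer_unit_normal_exists[OF K] outer_unit_normal_exists[OF L] y by blast
  then have w2: "is_outer_unit_normal (K \<inter> L) y w" "is_outer_unit_normal (K \<inter> L) y w'"
    by (auto simp: is_outer_unit_normal_def)
  have "y \<in> K \<inter> L" "y \<notin> interior (K \<inter> L)"
    using y frontier_subset_closed[OF cl(1)] frontier_subset_closed[OF cl(2)] by (auto simp: frontier_def)
  then have yF: "y \<in> frontier (K \<inter> L)" by (simp add: frontier_def closure_def)
  show "y \<in> singular_points (K \<inter> L) \<union>
    {y \<in> frontier K \<inter> frontier L. \<exists>w. is_outer_unit_normal K y w \<and> is_outer_unit_normal L y w}"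
  proof (cases "w = w'")
    case True then show ?thesis using w y by auto
  next
    case False then show ?thesis using w2 yF unfolding singular_points_def by blast
  qed
qed

text \<open>Both points lie in the face of \<open>K\<close> with normal \<open>w\<close>, hence so
  does the segment between them. A face contains no interior point, since from there one could move
  further in direction \<open>w\<close>.\<close>

lemma strictly_convex_support_unique:
  fixes K :: "(real^'n) set"
  assumes sc: "strictly_convex K" and K: "convex_body K"
    and w: "is_outer_unit_normal K a w" "is_outer_unit_normal K b w" and ab: "a \<in> K" "b \<in> K"
  shows "a = b"
proof (rule ccontr)
  assume "a \<noteq> b"
  have wa: "w \<bullet> z \<le> w \<bullet> a" "w \<bullet> z \<le> w \<bullet> b" if "z \<in> K" for z
    using w that by (auto simp: is_outer_unit_normal_def inner_diff_right)
  then have eq: "w \<bullet> a = w \<bullet> b" using ab by (meson antisym)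
  have "closed_segment a b \<subseteq> frontier K"
  proof
    fix p assume p: "p \<in> closed_segment a b"
    have pK: "p \<in> K" using p ab K closed_segment_subset[of a K b] by (auto simp: convex_body_def)
    obtain u where u: "p = (1 - u) *\<^sub>R a + u *\<^sub>R b" using p by (auto simp: closed_segment_def)
    have wp: "w \<bullet> p = w \<bullet> a" by (simp add: u inner_add_right eq algebra_simps)
    have "p \<notin> interior K"
    proof
      assume "p \<in> interior K"
      then obtain r where r: "r > 0" "cball p r \<subseteq> K" by (auto simp: mem_interior_cball)
      have nw: "norm w = 1" using w by (simp add: is_outer_unit_normal_def)
      have "p + r *\<^sub>R w \<in> K" using r nw by (auto simp: dist_norm)
      then have "w \<bullet> (p + r *\<^sub>R w) \<le> w \<bullet> a" by (rule wa)
      then show False using r nw wp by (simp add: inner_add_right dot_square_norm)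
    qed
    then show "p \<in> frontier K" using pK by (auto simp: frontier_def closure_def)
  qed
  then show False using sc \<open>a \<noteq> b\<close> by (auto simp: strictly_convex_def)
qed

lemma homothet_convex_body:
  fixes K :: "(real^'n) set"
  assumes K: "convex_body K" and \<tau>: "\<tau> > 0"
  shows "convex_body (homothet x \<tau> K)"
proof -
  have eq: "homothet x \<tau> K = (+) x ` ((*\<^sub>R) \<tau>) ` K" by (auto simp: homothet_def)
  have "interior ((*\<^sub>R) \<tau> ` K) = (*\<^sub>R) \<tau> ` interior K"
    using \<tau> by (intro interior_injective_linear_image) (auto simp: inj_on_def linear_iff algebra_simps)
  then have "interior (homothet x \<tau> K) \<noteq> {}"
    using K unfolding eq by (simp add: interior_translation convex_body_def)
  then show ?thesis
    using K unfolding eq convex_body_def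
    by (auto intro!: compact_translation compact_scaling convex_translation convex_scaling)
qed

lemma convex_body_inter_homothet:
  fixes K :: "(real^'n) set"
  assumes K: "convex_body K" and \<tau>: "\<tau> > 0" and pos: "overlap K \<tau> x > 0"
  shows "convex_body (K \<inter> homothet x \<tau> K)"
proof -
  have L: "convex_body (homothet x \<tau> K)" by (rule homothet_convex_body[OF K \<tau>])
  have cv: "convex (K \<inter> homothet x \<tau> K)" using K L by (auto simp: convex_body_def intro: convex_Int)
  have "interior (K \<inter> homothet x \<tau> K) \<noteq> {}"
  proof
    assume "interior (K \<inter> homothet x \<tau> K) = {}"
    then have "negligible (K \<inter> homothet x \<tau> K)" using cv by (simp add: negligible_convex_interior)
    then have "measure lebesgue (K \<inter> homothet x \<tau> K) = 0" by (simp add: negligible_imp_measure0)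
    then show False using pos by (simp add: overlap_def)
  qed
  then show ?thesis using cv K L by (auto simp: convex_body_def intro: compact_Int)
qed

text \<open>At a contact point \<open>y\<close> with common normal \<open>w\<close>, the point
  \<open>y\<close> and its preimage \<open>z\<close> under the homothety both support
  \<open>K\<close> with normal \<open>w\<close>, so strict convexity gives \<open>y = z\<close>. The
  homothety has at most one fixed point unless it is the identity, and one point is a null set in
  dimension at least two. Points without a common normal are singular for the intersection.\<close>

lemma common_frontier_homothet_null:
  fixes K :: "(real^'n) set"
  assumes K: "convex_body K" and \<tau>: "\<tau> > 0" and sc: "strictly_convex K"
    and pos: "overlap K \<tau> x > 0" and x1: "\<tau> = 1 \<longrightarrow> x \<noteq> 0"
    and x2: "CARD('n) = 1 \<longrightarrow> x \<notin> (\<lambda>y. (1 - \<tau>) *\<^sub>R y) ` frontier K"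
  shows "frontier K \<inter> frontier (homothet x \<tau> K) \<in> null_sets hausdorff_surface"
proof -
  define L where "L = homothet x \<tau> K"
  have L: "convex_body L" unfolding L_def by (rule homothet_convex_body[OF K \<tau>])
  have KL: "convex_body (K \<inter> L)" unfolding L_def by (rule convex_body_inter_homothet[OF K \<tau> pos])
  define T where "T = {y \<in> frontier K \<inter> frontier L. \<exists>w. is_outer_unit_normal K y w \<and> is_outer_unit_normal L y w}"
  have T: "y = x + \<tau> *\<^sub>R y" if y: "y \<in> T" for y
  proof -
    have "y \<in> K" "y \<in> L" using y K L frontier_subset_closed[of K] frontier_subset_closed[of L]
      by (auto simp: T_def convex_body_def compact_imp_closed)
    then obtain z where z: "y = x + \<tau> *\<^sub>R z" "z \<in> K" by (auto simp: L_def homothet_def)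
    obtain w where w: "is_outer_unit_normal K y w" "is_outer_unit_normal L y w" using y by (auto simp: T_def)
    have "w \<bullet> (k - z) \<le> 0" if "k \<in> K" for k
    proof -
      have "x + \<tau> *\<^sub>R k \<in> L" using that by (auto simp: L_def homothet_def)
      then have "w \<bullet> (x + \<tau> *\<^sub>R k - y) \<le> 0" using w(2) unfolding is_outer_unit_normal_def by blast
      moreover have "x + \<tau> *\<^sub>R k - y = \<tau> *\<^sub>R (k - z)" by (simp add: z(1) algebra_simps)
      ultimately show ?thesis using \<tau> by (simp add: mult_le_0_iff)
    qed
    then have "is_outer_unit_normal K z w" using w(1) by (simp add: is_outer_unit_normal_def)
    then have "y = z" using strictly_convex_support_unique[OF sc K w(1)] \<open>y \<in> K\<close> z(2) by blast
    then show ?thesis using z(1) by simp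
  qed
  have "T \<in> null_sets hausdorff_surface"
  proof (cases "T = {}")
    case False
    then obtain y where y: "y \<in> T" by blast
    have xy: "x = (1 - \<tau>) *\<^sub>R y" using T[OF y] by (simp add: algebra_simps)
    have n1: "CARD('n) \<noteq> 1" using xy x2 y by (auto simp: T_def)
    have t1: "\<tau> \<noteq> 1" using xy x1 by auto
    have "T = {y}"
    proof (intro subset_antisym subsetI)
      fix z assume "z \<in> T"
      then have "x = (1 - \<tau>) *\<^sub>R z" using T by (metis add_diff_cancel_right' scaleR_left_diff_distrib scaleR_one)
      then have "(1 - \<tau>) *\<^sub>R z = (1 - \<tau>) *\<^sub>R y" using xy by metis
      then show "z \<in> {y}" using t1 by auto
    qed (use y in simp)
    then show ?thesis using hausdorff_surface_singleton[OF n1] by simp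
  qed simp
  then have "singular_points (K \<inter> L) \<union> T \<in> null_sets hausdorff_surface"
    using singular_points_null[OF KL] by (rule null_sets.Un[rotated])
  moreover have "frontier K \<inter> frontier L \<subseteq> singular_points (K \<inter> L) \<union> T"
    using common_frontier_subset[OF K L] by (simp add: T_def)
  moreover have "frontier K \<inter> frontier L \<in> sets hausdorff_surface" by simp
  ultimately show ?thesis unfolding L_def[symmetric] by (metis null_sets_subset)
qed

subsection \<open>The overlap function\<close>


text \<open>The rate at which the volume of \<open>K \<inter> (x + M)\<close> changes when
  \<open>x\<close> moves along \<open>e\<close>. The boundary of \<open>M\<close> stays fixed and
  \<open>x\<close> enters through the integrand only, so continuity in \<open>x\<close> follows by
  dominated convergence.\<close>

definition shift_flux :: "(real^'n) set \<Rightarrow> (real^'n) set \<Rightarrow> real^'n \<Rightarrow> real^'n \<Rightarrow> real" where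
  "shift_flux K M e x = (LINT y|boundary_measure M e e. indicator K (y + x))
     - (LINT y|boundary_measure M e (- e). indicator K (y + x))"

lemma isCont_indicator_off_frontier:
  assumes "y \<notin> frontier K"
  shows "isCont (indicator K :: 'a::t2_space \<Rightarrow> real) y"
proof -
  have "y \<in> interior K \<or> y \<in> - closure K" using assms by (auto simp: frontier_def)
  then show ?thesis
  proof
    assume "y \<in> interior K"
    then have "\<forall>\<^sub>F z in nhds y. indicator K z = (1::real)"
      by (intro eventually_nhds[THEN iffD2] exI[of _ "interior K"]) (use interior_subset[of K] in \<open>auto simp: indicator_def\<close>)
    then show ?thesis by (subst isCont_cong) auto
  next
    assume "y \<in> - closure K"
    then have "\<forall>\<^sub>F z in nhds y. indicator K z = (0::real)"
      by (intro eventually_nhds[THEN iffD2] exI[of _ "- closure K"]) (use closure_subset[of K] in \<open>auto simp: indicator_def\<close>)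
    then show ?thesis by (subst isCont_cong) auto
  qed
qed

lemma translate_image_eq_vimage: "(+) x ` S = (\<lambda>y. y - x) -` S" for x :: "'a::ab_group_add"
  by (auto simp: image_iff intro!: bexI[of _ "_ - x"])

lemma measure_inter_translate:
  fixes K M :: "'a::euclidean_space set"
  assumes "closed K" "closed M"
  shows "measure lebesgue (K \<inter> (+) x ` M) = (LINT y|lborel. indicator M y * indicator K (y + x))"
proof -
  let ?S = "K \<inter> (+) x ` M"
  have S: "?S \<in> sets borel" using assms by (intro borel_closed closed_Int closed_translation)
  have "measure lebesgue ?S = (LINT y|lborel. indicator ?S y)" using S by simp
  also have "\<dots> = (LINT y|lborel. indicator ?S (y + x))"
    by (rule integral_lborel_shift[symmetric]) (use S in simp)
  also have "\<dots> = (LINT y|lborel. indicator M y * indicator K (y + x))"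
    by (intro Bochner_Integration.integral_cong) (auto simp: translate_image_eq_vimage indicator_def)
  finally show ?thesis .
qed

text \<open>Null sets of surface measure are null sets of projected area. So the indicator of
  \<open>K\<close> is continuous almost everywhere on the translated boundary of \<open>M\<close>,
  although it jumps.\<close>

lemma AE_boundary_measure_contact:
  fixes K M :: "(real^'n) set"
  assumes M: "convex_body M" and e: "norm e = 1" "v = e \<or> v = - e"
    and null: "frontier K \<inter> (+) x ` frontier M \<in> null_sets hausdorff_surface"
  shows "AE y in boundary_measure M e v. y + x \<notin> frontier K"
proof -
  have Mc: "compact M" using M by (simp add: convex_body_def)
  define Z where "Z = {y \<in> frontier M. y + x \<in> frontier K}"
  have clZ: "closed Z"
  proof -
    have "closed ((\<lambda>y. y + x) -` frontier K)" by (intro closed_vimage continuous_intros) simp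
    moreover have "Z = frontier M \<inter> (\<lambda>y. y + x) -` frontier K" by (auto simp: Z_def)
    ultimately show ?thesis by (auto intro: closed_Int)
  qed
  have img: "(\<lambda>y. y + x) ` Z = frontier K \<inter> (+) x ` frontier M"
    by (auto simp: Z_def add.commute image_iff)
  have "emeasure hausdorff_surface ((\<lambda>y. y + x) ` Z) = emeasure hausdorff_surface Z"
    by (rule emeasure_hausdorff_surface_isometry) (use clZ null in \<open>auto simp: img null_sets_def\<close>)
  then have "emeasure hausdorff_surface Z = 0" using null by (simp add: img null_sets_def)
  then have "emeasure (boundary_measure M e v) Z = 0"
    using boundary_measure_le[OF Mc e, of Z] clZ by auto
  then have "Z \<in> null_sets (boundary_measure M e v)" using clZ by (simp add: null_sets_def)
  then have "AE y in boundary_measure M e v. y \<notin> Z" by (rule AE_not_in)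
  then show ?thesis
    using AE_boundary_measure_frontier[OF Mc e] by eventually_elim (auto simp: Z_def)
qed

lemma shift_flux_derivative:
  fixes K M :: "(real^'n) set"
  assumes K: "convex_body K" and M: "convex_body M" and e: "norm e = 1"
    and null: "frontier K \<inter> (+) x ` frontier M \<in> null_sets hausdorff_surface"
  shows "((\<lambda>t. measure lebesgue (K \<inter> (+) (x + t *\<^sub>R e) ` M)) has_real_derivative shift_flux K M e x) (at 0)"
proof -
  have Mc: "compact M" "convex M" and Kc: "compact K" using M K by (auto simp: convex_body_def)
  have [measurable]: "K \<in> sets borel" "M \<in> sets borel"
    using compact_imp_closed[OF Kc] compact_imp_closed[OF Mc(1)] by auto
  have eq: "measure lebesgue (K \<inter> (+) (x + t *\<^sub>R e) ` M) = (LINT y|lborel. indicator M (y - t *\<^sub>R e) * indicator K (y + x))" for t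
  proof -
    have "(\<lambda>y. indicator M (y - t *\<^sub>R e) * indicator K (y + x) :: real) \<in> borel_measurable borel" by measurable
    from integral_lborel_shift[OF this, of "t *\<^sub>R e"] show ?thesis
      using measure_inter_translate[OF compact_imp_closed[OF Kc] compact_imp_closed[OF Mc(1)], of "x + t *\<^sub>R e"]
      by (simp add: add_ac)
  qed
  have cont: "AE y in boundary_measure M e v. isCont (\<lambda>y. indicator K (y + x) :: real) y" if "v = e \<or> v = - e" for v
    using AE_boundary_measure_contact[OF M e that null]
  proof eventually_elim
    case (elim y)
    show ?case
      by (rule isCont_o2[where f="\<lambda>y. y + x" and g="indicator K"])
        (intro continuous_intros, rule isCont_indicator_off_frontier[OF elim])
  qed
  have "((\<lambda>t. LINT y|lborel. indicator M (y - t *\<^sub>R e) * indicator K (y + x)) has_real_derivative shift_flux K M e x) (at 0)"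
    unfolding shift_flux_def
    by (rule body_integral_shift_derivative[OF Mc e, where B=1]) (use cont in \<open>auto simp: indicator_def[abs_def]\<close>)
  then show ?thesis by (simp only: eq)
qed

lemma isCont_shift_flux:
  fixes K M :: "(real^'n) set"
  assumes K: "convex_body K" and M: "convex_body M" and e: "norm e = 1"
    and null: "frontier K \<inter> (+) x ` frontier M \<in> null_sets hausdorff_surface"
  shows "isCont (shift_flux K M e) x"
proof -
  have Mc: "compact M" and Kc: "compact K" using M K by (auto simp: convex_body_def)
  have [measurable]: "K \<in> sets borel" using compact_imp_closed[OF Kc] by auto
  have "isCont (\<lambda>x. LINT y|boundary_measure M e v. indicator K (y + x) :: real) x" if v: "v = e \<or> v = - e" for v
  proof (rule isCont_translate_integral[where B=1])
    show "finite_measure (boundary_measure M e v)" by (rule finite_boundary_measure[OF Mc e v])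
    show "AE y in boundary_measure M e v. isCont (indicator K :: _ \<Rightarrow> real) (y + x)"
      using AE_boundary_measure_contact[OF M e v null] by eventually_elim (rule isCont_indicator_off_frontier)
  qed (auto simp: indicator_def)
  then show ?thesis unfolding shift_flux_def[abs_def] by (intro continuous_intros) auto
qed

lemma shift_flux_0:
  fixes K M :: "(real^'n) set"
  assumes K: "convex_body K" and M: "convex_body M" and e: "norm e = 1"
  shows "shift_flux K M e 0 = signed_area M e (K \<inter> frontier M)"
proof -
  have Mc: "compact M" using M by (auto simp: convex_body_def)
  have [measurable]: "K \<in> sets borel" "K \<inter> frontier M \<in> sets borel"
    using K by (auto simp: convex_body_def compact_imp_closed)
  have "(LINT y|boundary_measure M e v. indicator K (y + 0)) = measure (boundary_measure M e v) (K \<inter> frontier M)"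
    if v: "v = e \<or> v = - e" for v
  proof -
    have "(LINT y|boundary_measure M e v. indicator K (y + 0)) = (LINT y|boundary_measure M e v. indicator (K \<inter> frontier M) y :: real)"
    proof (rule integral_cong_AE)
      show "AE y in boundary_measure M e v. indicator K (y + 0) = (indicator (K \<inter> frontier M) y :: real)"
        using AE_boundary_measure_frontier[OF Mc e v] by eventually_elim (auto simp: indicator_def)
    qed measurable
    then show ?thesis by simp
  qed
  then show ?thesis by (simp add: shift_flux_def signed_area_def)
qed

section \<open>Partial derivatives and continuity of the overlap\<close>

lemma homothet_translate: "homothet x \<tau> K = (+) x ` homothet 0 \<tau> K"
  by (auto simp: homothet_def)

lemma frontier_translate: "frontier ((+) x ` S) = (+) x ` frontier S" for x :: "'a::real_normed_vector"
  unfolding frontier_def closure_translation interior_translation by (auto simp: translate_image_eq_vimage)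

lemma overlap_eq: "overlap K \<tau> x = measure lebesgue (K \<inter> (+) x ` homothet 0 \<tau> K)"
  by (simp add: overlap_def homothet_translate[of x])

lemma overlap_derivative:
  fixes K :: "(real^'n) set"
  assumes K: "convex_body K" and \<tau>: "\<tau> > 0" and e: "norm e = 1"
    and null: "frontier K \<inter> frontier (homothet x \<tau> K) \<in> null_sets hausdorff_surface"
  shows "((\<lambda>t. overlap K \<tau> (x + t *\<^sub>R e)) has_real_derivative
      signed_area (homothet x \<tau> K) e (K \<inter> frontier (homothet x \<tau> K))) (at 0)"
    and "((\<lambda>t. overlap K \<tau> (x + t *\<^sub>R e)) has_real_derivative
      - signed_area K e (homothet x \<tau> K \<inter> frontier K)) (at 0)"
proof -
  let ?L = "homothet x \<tau> K"
  have L: "convex_body ?L" by (rule homothet_convex_body[OF K \<tau>])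
  have ov: "overlap K \<tau> (x + t *\<^sub>R e) = measure lebesgue (K \<inter> (+) (0 + t *\<^sub>R e) ` ?L)" for t
  proof -
    have "homothet (x + t *\<^sub>R e) \<tau> K = (+) (t *\<^sub>R e) ` ?L"
      unfolding homothet_def image_image by (intro image_cong) (simp_all add: algebra_simps)
    then show ?thesis by (simp add: overlap_def)
  qed
  show "((\<lambda>t. overlap K \<tau> (x + t *\<^sub>R e)) has_real_derivative signed_area ?L e (K \<inter> frontier ?L)) (at 0)"
    using shift_flux_derivative[OF K L e, of 0] null unfolding ov shift_flux_0[OF K L e] by simp
  \<comment> \<open>Only the relative position of the two bodies matters: moving the homothetic copy
    by \<open>t\<close> has the same effect as moving \<open>K\<close> by \<open>- t\<close>. This
    exchanges the roles of the bodies and produces the minus sign.\<close>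
  have ov': "overlap K \<tau> (x + t *\<^sub>R e) = measure lebesgue (?L \<inter> (+) (0 + (- t) *\<^sub>R e) ` K)" for t
  proof -
    have "K \<inter> (+) (t *\<^sub>R e) ` ?L = (+) (t *\<^sub>R e) ` (?L \<inter> (+) (0 + (- t) *\<^sub>R e) ` K)"
      by (auto simp: translate_image_eq_vimage)
    then show ?thesis unfolding ov by (simp add: measure_translation)
  qed
  have "((\<lambda>t. measure lebesgue (?L \<inter> (+) (0 + t *\<^sub>R e) ` K)) has_real_derivative signed_area K e (?L \<inter> frontier K)) (at (- 0))"
    using shift_flux_derivative[OF L K e, of 0] null unfolding shift_flux_0[OF L K e] by (simp add: Int_commute)
  then have "((\<lambda>t. measure lebesgue (?L \<inter> (+) (0 + (- t) *\<^sub>R e) ` K)) has_real_derivative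
      signed_area K e (?L \<inter> frontier K) * - 1) (at 0)"
    by (rule DERIV_chain2[where g=uminus]) (auto intro!: derivative_eq_intros)
  then show "((\<lambda>t. overlap K \<tau> (x + t *\<^sub>R e)) has_real_derivative - signed_area K e (?L \<inter> frontier K)) (at 0)"
    unfolding ov' by simp
qed

text \<open>The boundary of a convex body is a Lebesgue null set, so continuity holds also at the
  positions where differentiability may fail.\<close>

lemma isCont_overlap:
  fixes K :: "(real^'n) set"
  assumes K: "convex_body K" and \<tau>: "\<tau> > 0"
  shows "isCont (overlap K \<tau>) x"
proof -
  define M where "M = homothet 0 \<tau> K"
  have M: "convex_body M" unfolding M_def by (rule homothet_convex_body[OF K \<tau>])
  have Mc: "compact M" and Kc: "compact K" "convex K" using M K by (auto simp: convex_body_def)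
  have [measurable]: "K \<in> sets borel" "M \<in> sets borel"
    using compact_imp_closed[OF Kc(1)] compact_imp_closed[OF Mc] by auto
  let ?D = "density lborel (indicator M) :: (real^'n) measure"
  have fin: "finite_measure ?D"
  proof
    have "emeasure ?D (space ?D) \<le> emeasure lborel M" by (simp add: emeasure_density)
    also have "\<dots> < \<infinity>" by (rule emeasure_compact_finite[OF Mc])
    finally show "emeasure ?D (space ?D) \<noteq> \<infinity>" by simp
  qed
  have eq: "overlap K \<tau> x = (LINT y|?D. indicator K (y + x))" for x
  proof -
    have "overlap K \<tau> x = (LINT y|lborel. indicator M y * indicator K (y + x))"
      unfolding overlap_eq M_def[symmetric] using Kc(1) Mc by (intro measure_inter_translate compact_imp_closed)
    also have "\<dots> = (LINT y|?D. indicator K (y + x))"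
      by (rule integral_density_indicator[symmetric]) auto
    finally show ?thesis .
  qed
  have "isCont (\<lambda>x. LINT y|?D. indicator K (y + x) :: real) x"
  proof (rule isCont_translate_integral[where B=1])
    have neg: "negligible (frontier ((+) (- x) ` K))"
      by (intro negligible_convex_frontier convex_translation Kc)
    then have "emeasure lborel (frontier ((+) (- x) ` K)) = 0" by (rule emeasure_lborel_negligible) simp
    then have "AE y in lborel. y \<notin> frontier ((+) (- x) ` K)"
      by (intro AE_not_in) (simp add: null_sets_def)
    then have "AE y in lborel. y + x \<notin> frontier K"
    proof eventually_elim
      case (elim y)
      then show ?case unfolding frontier_translate unfolding translate_image_eq_vimage by simp
    qed
    then have "AE y in lborel. isCont (indicator K :: _ \<Rightarrow> real) (y + x)"
      by eventually_elim (rule isCont_indicator_off_frontier)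
    then show "AE y in ?D. isCont (indicator K :: _ \<Rightarrow> real) (y + x)"
      by (subst AE_density) auto
    show "finite_measure ?D" by (rule fin)
  qed (auto simp: indicator_def)
  then show ?thesis by (simp only: eq[abs_def])
qed

section \<open>Linear growth of the overlap\<close>

lemma compact_interpolation:
  fixes A B :: "'a::real_normed_vector set"
  assumes "compact A" "compact B"
  shows "compact {a *\<^sub>R x + b *\<^sub>R y |x y. x \<in> A \<and> y \<in> B}"
proof -
  have "{a *\<^sub>R x + b *\<^sub>R y |x y. x \<in> A \<and> y \<in> B} = {u + v |u v. u \<in> (*\<^sub>R) a ` A \<and> v \<in> (*\<^sub>R) b ` B}"
    by blast
  then show ?thesis using assms by (simp only: compact_sums compact_scaling)
qed

text \<open>
  Contracting the convex hull \<open>C\<close> of \<open>A\<close> and \<open>b\<close> towards \<open>b\<close> by the factor \<open>1 - t\<close> maps \<open>C - A\<close> onto a set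
  that covers the part of \<open>C\<close> not reached by the interpolation between \<open>A\<close> and \<open>B\<close>.
\<close>

lemma interpolation_measure_growth:
  fixes A B :: "'a::euclidean_space set"
  assumes A: "compact A" "convex A" "interior A \<noteq> {}" and B: "compact B" "convex B"
    and AB: "A \<subseteq> B" and b: "b \<in> B" "b \<notin> A"
  shows "\<exists>c>0. \<forall>t\<in>{0..1}. measure lebesgue A + c * t \<le>
    measure lebesgue {(1 - t) *\<^sub>R x + t *\<^sub>R y |x y. x \<in> A \<and> y \<in> B}"
proof -
  have Ane: "A \<noteq> {}" using A(3) by auto
  define C where "C = convex hull (insert b A)"
  have C: "z \<in> C \<longleftrightarrow> (\<exists>a\<in>A. \<exists>s. 0 \<le> s \<and> s \<le> 1 \<and> z = b + s *\<^sub>R (a - b))" for z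
  proof -
    have "z \<in> C \<longleftrightarrow> (\<exists>u v a. 0 \<le> u \<and> 0 \<le> v \<and> u + v = 1 \<and> a \<in> A \<and> z = u *\<^sub>R b + v *\<^sub>R a)"
      unfolding C_def convex_hull_insert[OF Ane] by (auto simp: hull_same[of convex A] A(2))
    also have "\<dots> \<longleftrightarrow> (\<exists>a\<in>A. \<exists>s. 0 \<le> s \<and> s \<le> 1 \<and> z = b + s *\<^sub>R (a - b))"
    proof
      assume "\<exists>u v a. 0 \<le> u \<and> 0 \<le> v \<and> u + v = 1 \<and> a \<in> A \<and> z = u *\<^sub>R b + v *\<^sub>R a"
      then obtain u v a where "0 \<le> u" "0 \<le> v" "u + v = 1" "a \<in> A" "z = u *\<^sub>R b + v *\<^sub>R a" by blast
      moreover have "u = 1 - v" using \<open>u + v = 1\<close> by simp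
      ultimately show "\<exists>a\<in>A. \<exists>s. 0 \<le> s \<and> s \<le> 1 \<and> z = b + s *\<^sub>R (a - b)"
        by (intro bexI[of _ a] exI[of _ v]) (auto simp: algebra_simps)
    next
      assume "\<exists>a\<in>A. \<exists>s. 0 \<le> s \<and> s \<le> 1 \<and> z = b + s *\<^sub>R (a - b)"
      then obtain a s where "a \<in> A" "0 \<le> s" "s \<le> 1" "z = b + s *\<^sub>R (a - b)" by blast
      then show "\<exists>u v a. 0 \<le> u \<and> 0 \<le> v \<and> u + v = 1 \<and> a \<in> A \<and> z = u *\<^sub>R b + v *\<^sub>R a"
        by (intro exI[of _ "1 - s"] exI[of _ s] exI[of _ a]) (auto simp: algebra_simps)
    qed
    finally show ?thesis .
  qed
  have Cc: "compact C" unfolding C_def using A by (intro compact_convex_hull compact_insert)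
  have AC: "A \<subseteq> C" "b \<in> C" unfolding C_def using hull_subset[of "insert b A" convex] by auto
  define E where "E = C - A"
  have lm: "A \<in> lmeasurable" "C \<in> lmeasurable" "E \<in> lmeasurable"
    using A Cc by (auto simp: E_def lmeasurable_compact intro: fmeasurable.Diff)
  have CA: "measure lebesgue C = measure lebesgue A + measure lebesgue E"
    using measure_Un3[of A lebesgue E] lm AC by (auto simp: E_def Un_absorb1)
  \<comment> \<open>\<open>b\<close> is a limit of interior points of \<open>C\<close> and has
    positive distance from the closed set \<open>A\<close>, so \<open>C - A\<close> contains a
    non-empty open set.\<close>
  have Epos: "measure lebesgue E > 0"
  proof -
    have "interior A \<subseteq> interior C" by (rule interior_mono[OF AC(1)])
    then have "interior C \<noteq> {}" using A(3) by auto
    then have "closure (interior C) = C"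
      using convex_closure_interior[of C] Cc by (simp add: C_def compact_imp_closed)
    then have "b \<in> closure (interior C)" using AC by simp
    moreover have opA: "open (- A)" using compact_imp_closed[OF A(1)] by auto
    ultimately have "interior C \<inter> - A \<noteq> {}" using b(2) open_Int_closure_eq_empty[OF opA, of "interior C"] by auto
    then have "\<not> negligible (interior C \<inter> - A)" using opA by (intro open_not_negligible) auto
    moreover have "interior C \<inter> - A \<subseteq> E" using interior_subset[of C] by (auto simp: E_def)
    ultimately have "\<not> negligible E" using negligible_subset by blast
    then show ?thesis using lm(3) negligible_iff_measure[of E] measure_nonneg[of lebesgue E] by (auto simp: less_le)
  qed
  show ?thesis
  proof (intro exI[of _ "measure lebesgue E"] conjI ballI Epos)
    fix t :: real assume t: "t \<in> {0..1}"
    define T where "T = {(1 - t) *\<^sub>R x + t *\<^sub>R y |x y. x \<in> A \<and> y \<in> B}"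
    have lT: "T \<in> lmeasurable"
      unfolding T_def by (intro lmeasurable_compact compact_interpolation A B)
    have sub: "C - T \<subseteq> (\<lambda>z. (1 - t) *\<^sub>R z + t *\<^sub>R b) ` E"
    proof
      fix z assume z: "z \<in> C - T"
      then obtain a s where as: "a \<in> A" "0 \<le> s" "s \<le> 1" "z = b + s *\<^sub>R (a - b)" using C by blast
      \<comment> \<open>Otherwise \<open>z\<close> is so close to \<open>a\<close> on the segment
        from \<open>b\<close> that it is an interpolation of \<open>a\<close> with a further point
        \<open>y\<close> of that segment, hence in \<open>T\<close>.\<close>
      have "s \<le> 1 - t"
      proof (rule ccontr)
        assume "\<not> s \<le> 1 - t"
        then have st: "1 - t < s" "0 < t" using as by auto
        define y where "y = ((1 - s) / t) *\<^sub>R b + ((s - (1 - t)) / t) *\<^sub>R a"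
        have "y \<in> B"
          unfolding y_def by (rule convexD[OF B(2) b(1)]) (use as AB st in \<open>auto simp: field_simps\<close>)
        moreover have "z = (1 - t) *\<^sub>R a + t *\<^sub>R y"
        proof -
          have "t *\<^sub>R y = (1 - s) *\<^sub>R b + (s - (1 - t)) *\<^sub>R a"
            unfolding y_def scaleR_add_right scaleR_scaleR using st by simp
          then show ?thesis by (simp add: as(4) algebra_simps)
        qed
        ultimately show False using z as(1) by (auto simp: T_def)
      qed
      have "t \<noteq> 1"
      proof
        assume t1: "t = 1"
        then have "z = b" using \<open>s \<le> 1 - t\<close> as by simp
        then have "z = (1 - t) *\<^sub>R a + t *\<^sub>R b" using t1 by simp
        then show False using z as(1) b(1) unfolding T_def by blast
      qed
      then have t1: "1 - t > 0" using t by simp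
      define w where "w = b + (s / (1 - t)) *\<^sub>R (a - b)"
      have "(1 - t) *\<^sub>R w = (1 - t) *\<^sub>R b + s *\<^sub>R (a - b)"
        unfolding w_def scaleR_add_right scaleR_scaleR using t1 by simp
      then have wz: "(1 - t) *\<^sub>R w + t *\<^sub>R b = z" by (simp add: as(4) algebra_simps)
      have "s / (1 - t) \<le> 1" using \<open>s \<le> 1 - t\<close> t1 by simp
      then have "w \<in> C" unfolding C w_def using as t1
        by (intro bexI[of _ a] exI[of _ "s / (1 - t)"]) auto
      moreover have "w \<notin> A" using wz z b(1) unfolding T_def by blast
      ultimately have "w \<in> E" by (simp add: E_def)
      then show "z \<in> (\<lambda>z. (1 - t) *\<^sub>R z + t *\<^sub>R b) ` E" using wz by blast
    qed
    have "measure lebesgue (C - T) \<le> measure lebesgue ((\<lambda>z. (1 - t) *\<^sub>R z + t *\<^sub>R b) ` E)"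
    proof (rule measure_mono_fmeasurable[OF sub])
      show "C - T \<in> sets lebesgue" using lm lT by auto
      let ?h = "\<lambda>z. (1 - t) *\<^sub>R z + t *\<^sub>R b"
      show "?h ` E \<in> lmeasurable"
      \<comment> \<open>At \<open>t = 1\<close> the contraction collapses to the point
        \<open>b\<close> and is no longer injective.\<close>
      proof (cases "t = 1")
        case True
        then have "?h ` E \<subseteq> {b}" by auto
        then show ?thesis using negligible_subset[OF negligible_sing] by (blast intro: negligible_imp_measurable)
      next
        case False
        then have "inj ?h" by (auto simp: inj_on_def)
        then have "?h ` E = ?h ` C - ?h ` A" unfolding E_def by (rule image_set_diff)
        moreover have "compact (?h ` C)" "compact (?h ` A)"
          by (intro compact_continuous_image continuous_intros Cc A)+
        ultimately show ?thesis by (simp add: fmeasurable.Diff lmeasurable_compact)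
      qed
    qed
    also have "\<dots> = (1 - t) ^ DIM('a) * measure lebesgue E"
      using t by (simp add: measure_lebesgue_affine)
    \<comment> \<open>One factor \<open>1 - t\<close> of the volume scaling already gives growth
      linear in \<open>t\<close>.\<close>
    also have "\<dots> \<le> (1 - t) * measure lebesgue E"
      using t power_decreasing[of 1 "DIM('a)" "1 - t"] by (intro mult_right_mono) (auto simp: Suc_leI)
    finally have 1: "measure lebesgue (C - T) \<le> (1 - t) * measure lebesgue E" .
    have "measure lebesgue C \<le> measure lebesgue (T \<union> (C - T))"
      using lm lT by (intro measure_mono_fmeasurable) (auto intro: fmeasurable.Un fmeasurable.Diff)
    also have "\<dots> \<le> measure lebesgue T + measure lebesgue (C - T)"
      using lm lT by (intro measure_Un_le) auto
    finally show "measure lebesgue A + measure lebesgue E * t \<le> measure lebesgue T"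
      using 1 CA by (simp add: algebra_simps)
  qed
qed

text \<open>The homothety with fixed point \<open>y \<in> K\<close> maps \<open>K\<close> into
  itself or onto a superset. The smaller body is then fully contained in the larger one, so the
  overlap attains its maximum.\<close>

lemma overlap_center:
  fixes K :: "(real^'n) set"
  assumes K: "convex_body K" and \<tau>: "\<tau> > 0" and y: "y \<in> K"
  shows "\<tau> \<le> 1 \<Longrightarrow> homothet ((1 - \<tau>) *\<^sub>R y) \<tau> K \<subseteq> K"
    and "1 \<le> \<tau> \<Longrightarrow> K \<subseteq> homothet ((1 - \<tau>) *\<^sub>R y) \<tau> K"
    and "overlap K \<tau> ((1 - \<tau>) *\<^sub>R y) = min 1 (\<tau> ^ CARD('n)) * measure lebesgue K"
proof -
  have cv: "convex K" using K by (simp add: convex_body_def)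
  show 1: "homothet ((1 - \<tau>) *\<^sub>R y) \<tau> K \<subseteq> K" if "\<tau> \<le> 1"
    unfolding homothet_def using convexD[OF cv y] \<tau> that by auto
  show 2: "K \<subseteq> homothet ((1 - \<tau>) *\<^sub>R y) \<tau> K" if "1 \<le> \<tau>"
  proof
    fix k assume k: "k \<in> K"
    have "(1 - 1 / \<tau>) *\<^sub>R y + (1 / \<tau>) *\<^sub>R k \<in> K" by (rule convexD[OF cv y k]) (use \<tau> that in auto)
    moreover have "k = (1 - \<tau>) *\<^sub>R y + \<tau> *\<^sub>R ((1 - 1 / \<tau>) *\<^sub>R y + (1 / \<tau>) *\<^sub>R k)"
      using \<tau> by (simp add: scaleR_add_right algebra_simps)
    ultimately show "k \<in> homothet ((1 - \<tau>) *\<^sub>R y) \<tau> K" unfolding homothet_def by blast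
  qed
  have m: "measure lebesgue (homothet x \<tau> K) = \<tau> ^ CARD('n) * measure lebesgue K" for x
    using measure_lebesgue_affine[of \<tau> x K] \<tau> by (simp add: homothet_def add.commute)
  show "overlap K \<tau> ((1 - \<tau>) *\<^sub>R y) = min 1 (\<tau> ^ CARD('n)) * measure lebesgue K"
  proof (cases "\<tau> \<le> 1")
    case True
    then have "\<tau> ^ CARD('n) \<le> 1" using \<tau> by (simp add: power_le_one)
    then show ?thesis using 1[OF True] m by (simp add: overlap_def Int_absorb1)
  next
    case False
    then have "1 \<le> \<tau> ^ CARD('n)" by (simp add: one_le_power)
    then show ?thesis using 2 False by (simp add: overlap_def Int_absorb2)
  qed
qed

text \<open>The way leads straight to a position \<open>x0\<close> of full containment. By convexity
  the intersection at time \<open>t\<close> contains the interpolation between the initial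
  intersection and the final one, which is the smaller body. Linear growth is all that a non-zero
  gradient requires.\<close>

lemma overlap_growth:
  fixes K :: "(real^'n) set"
  assumes K: "convex_body K" and \<tau>: "\<tau> > 0"
    and x: "0 < overlap K \<tau> x" "overlap K \<tau> x < min 1 (\<tau> ^ CARD('n)) * measure lebesgue K"
  shows "\<exists>c h. c > 0 \<and> (\<forall>t\<in>{0..1}. overlap K \<tau> x + c * t \<le> overlap K \<tau> (x + t *\<^sub>R h))"
proof -
  have Kc: "compact K" "convex K" using K by (auto simp: convex_body_def)
  obtain y where y: "y \<in> K" using K interior_subset[of K] by (auto simp: convex_body_def)
  define x0 where "x0 = (1 - \<tau>) *\<^sub>R y"
  define h where "h = x0 - x"
  let ?L = "\<lambda>x. homothet x \<tau> K"
  have L: "convex_body (?L x)" for x by (rule homothet_convex_body[OF K \<tau>])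
  then have Lc: "compact (?L x)" "convex (?L x)" for x by (auto simp: convex_body_def)
  define A where "A = K \<inter> ?L x"
  have A: "compact A" "convex A" "interior A \<noteq> {}"
    using convex_body_inter_homothet[OF K \<tau> x(1)] by (auto simp: A_def convex_body_def)
  have mL: "measure lebesgue (?L x) = measure lebesgue (?L x0)" for x
    using measure_lebesgue_affine[of \<tau> x K] measure_lebesgue_affine[of \<tau> x0 K] by (simp add: homothet_def add.commute)
  have comb: "(1 - t) *\<^sub>R (x + \<tau> *\<^sub>R k) + t *\<^sub>R (x0 + \<tau> *\<^sub>R l) \<in> ?L (x + t *\<^sub>R h)"
    if "k \<in> K" "l \<in> K" "0 \<le> t" "t \<le> 1" for k l t
  proof -
    have "(1 - t) *\<^sub>R k + t *\<^sub>R l \<in> K" by (rule convexD[OF Kc(2) that(1,2)]) (use that in auto)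
    moreover have "(1 - t) *\<^sub>R (x + \<tau> *\<^sub>R k) + t *\<^sub>R (x0 + \<tau> *\<^sub>R l) = (x + t *\<^sub>R h) + \<tau> *\<^sub>R ((1 - t) *\<^sub>R k + t *\<^sub>R l)"
      by (simp add: h_def algebra_simps)
    ultimately show ?thesis unfolding homothet_def by blast
  qed
  \<comment> \<open>For \<open>\<tau> > 1\<close> the final intersection is \<open>K\<close>, which
    contains \<open>A\<close>. For \<open>\<tau> \<le> 1\<close> it is \<open>?L x0\<close>, which
    need not contain \<open>A\<close>, so its translate \<open>?L x\<close> is taken instead and the
    displacement \<open>t h\<close> is restored through \<open>d\<close>.\<close>
  have "\<exists>B d. compact B \<and> convex B \<and> A \<subseteq> B \<and> measure lebesgue A < measure lebesgue B \<and>
    (\<forall>t. 0 \<le> t \<and> t \<le> 1 \<longrightarrow> (\<forall>a\<in>A. \<forall>b\<in>B. (1 - t) *\<^sub>R a + t *\<^sub>R b + t *\<^sub>R d \<in> K \<inter> ?L (x + t *\<^sub>R h)))"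
  proof (cases "\<tau> \<le> 1")
    case True
    have sub: "?L x0 \<subseteq> K" unfolding x0_def by (rule overlap_center(1)[OF K \<tau> y True])
    have "(1 - t) *\<^sub>R a + t *\<^sub>R b + t *\<^sub>R h \<in> K \<inter> ?L (x + t *\<^sub>R h)" if t: "0 \<le> t" "t \<le> 1" and ab: "a \<in> A" "b \<in> ?L x" for t a b
    proof -
      obtain k l where kl: "k \<in> K" "a = x + \<tau> *\<^sub>R k" "l \<in> K" "b = x + \<tau> *\<^sub>R l" using ab by (auto simp: A_def homothet_def)
      have eq: "(1 - t) *\<^sub>R a + t *\<^sub>R b + t *\<^sub>R h = (1 - t) *\<^sub>R a + t *\<^sub>R (x0 + \<tau> *\<^sub>R l)"
        by (simp add: h_def kl algebra_simps)
      have "x0 + \<tau> *\<^sub>R l \<in> K" using sub kl(3) by (auto simp: homothet_def)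
      then have "(1 - t) *\<^sub>R a + t *\<^sub>R (x0 + \<tau> *\<^sub>R l) \<in> K"
        using ab t by (intro convexD[OF Kc(2)]) (auto simp: A_def)
      then show ?thesis using comb[OF kl(1,3) t] unfolding eq by (simp add: kl(2))
    qed
    moreover have "measure lebesgue A < measure lebesgue (?L x)"
    proof -
      have "measure lebesgue (?L x) = overlap K \<tau> x0" using mL[of x] sub by (simp add: overlap_def Int_absorb1)
      then show ?thesis using x(2) overlap_center(3)[OF K \<tau> y] by (simp add: A_def x0_def overlap_def)
    qed
    ultimately show ?thesis by (intro exI[of _ "?L x"] exI[of _ h]) (auto simp: A_def Lc)
  next
    case False
    have sub: "K \<subseteq> ?L x0" unfolding x0_def by (rule overlap_center(2)[OF K \<tau> y]) (use False in simp)
    have "(1 - t) *\<^sub>R a + t *\<^sub>R b + t *\<^sub>R 0 \<in> K \<inter> ?L (x + t *\<^sub>R h)" if t: "0 \<le> t" "t \<le> 1" and ab: "a \<in> A" "b \<in> K" for t a b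
    proof -
      obtain k where k: "k \<in> K" "a = x + \<tau> *\<^sub>R k" using ab by (auto simp: A_def homothet_def)
      obtain l where l: "l \<in> K" "b = x0 + \<tau> *\<^sub>R l" using ab sub by (auto simp: homothet_def)
      have "(1 - t) *\<^sub>R a + t *\<^sub>R b \<in> K"
        using ab t by (intro convexD[OF Kc(2)]) (auto simp: A_def)
      then show ?thesis using comb[OF k(1) l(1) t] by (simp add: k(2) l(2))
    qed
    moreover have "measure lebesgue A < measure lebesgue K"
    proof -
      have "min 1 (\<tau> ^ CARD('n)) * measure lebesgue K \<le> 1 * measure lebesgue K"
        by (intro mult_right_mono) auto
      then show ?thesis using x(2) by (simp add: A_def overlap_def)
    qed
    ultimately show ?thesis by (intro exI[of _ K] exI[of _ 0]) (auto simp: A_def Kc)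
  qed
  then obtain B d where B: "compact B" "convex B" "A \<subseteq> B" "measure lebesgue A < measure lebesgue B"
    and Bd: "\<And>t a b. 0 \<le> t \<Longrightarrow> t \<le> 1 \<Longrightarrow> a \<in> A \<Longrightarrow> b \<in> B \<Longrightarrow> (1 - t) *\<^sub>R a + t *\<^sub>R b + t *\<^sub>R d \<in> K \<inter> ?L (x + t *\<^sub>R h)"
    by blast
  obtain b where b: "b \<in> B" "b \<notin> A" using B(3,4) by (metis less_irrefl subset_antisym subsetI)
  obtain c where c: "c > 0" "\<And>t. t \<in> {0..1} \<Longrightarrow> measure lebesgue A + c * t \<le>
    measure lebesgue {(1 - t) *\<^sub>R x + t *\<^sub>R y |x y. x \<in> A \<and> y \<in> B}"
    using interpolation_measure_growth[OF A B(1,2,3) b] by blast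
  have "overlap K \<tau> x + c * t \<le> overlap K \<tau> (x + t *\<^sub>R h)" if t: "0 \<le> t" "t \<le> 1" for t
  proof -
    let ?T = "{(1 - t) *\<^sub>R x + t *\<^sub>R y |x y. x \<in> A \<and> y \<in> B}"
    have T: "compact ?T" by (intro compact_interpolation A B)
    have "overlap K \<tau> x + c * t \<le> measure lebesgue ?T" using c(2)[of t] t by (simp add: A_def overlap_def)
    also have "\<dots> = measure lebesgue ((+) (t *\<^sub>R d) ` ?T)" by (simp add: measure_translation)
    also have "\<dots> \<le> measure lebesgue (K \<inter> ?L (x + t *\<^sub>R h))"
    proof (rule measure_mono_fmeasurable)
      show "(+) (t *\<^sub>R d) ` ?T \<subseteq> K \<inter> ?L (x + t *\<^sub>R h)" using Bd[OF t] by (auto simp: add.commute)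
      show "(+) (t *\<^sub>R d) ` ?T \<in> sets lebesgue" using T by (intro fmeasurableD lmeasurable_compact compact_translation)
      show "K \<inter> ?L (x + t *\<^sub>R h) \<in> lmeasurable" using Kc Lc by (intro lmeasurable_compact compact_Int)
    qed
    finally show ?thesis by (simp add: overlap_def)
  qed
  then show ?thesis using c(1) by (intro exI[of _ c] exI[of _ h]) auto
qed

section \<open>Regular level sets of the overlap\<close>

lemma convolution_body_C1_boundary:
  fixes K :: "(real^'n) set"
  assumes K: "convex_body K" and \<tau>: "\<tau> > 0" and sc: "strictly_convex K"
    and \<delta>: "0 < \<delta>" "\<delta> < min 1 (\<tau> ^ CARD('n)) * measure lebesgue K"
  shows "C1_boundary (convolution_body K \<delta> \<tau>)"
proof -
  define m where "m = min 1 (\<tau> ^ CARD('n)) * measure lebesgue K"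
  define F where "F = overlap K \<tau>"
  define S where "S = convolution_body K \<delta> \<tau>"
  have S: "S = {x. \<delta> \<le> F x}" by (simp add: S_def convolution_body_def F_def)
  have contF: "continuous_on A F" for A
    using isCont_overlap[OF K \<tau>] by (simp add: F_def continuous_at_imp_continuous_on)
  \<comment> \<open>Positive overlap makes the intersection a convex body; overlap below the maximum
    \<open>m\<close> provides both a direction of growth and the exclusion of the exceptional
    positions.\<close>
  define U where "U = {x. 0 < F x \<and> F x < m}"
  have opU: "open U"
    unfolding U_def by (intro open_Collect_conj open_Collect_less contF continuous_intros)
  define M where "M = homothet 0 \<tau> K"
  have M: "convex_body M" unfolding M_def by (rule homothet_convex_body[OF K \<tau>])
  have null: "frontier K \<inter> (+) x ` frontier M \<in> null_sets hausdorff_surface" if x: "x \<in> U" for x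
  proof -
    have "frontier K \<inter> frontier (homothet x \<tau> K) \<in> null_sets hausdorff_surface"
    proof (rule common_frontier_homothet_null[OF K \<tau> sc])
      \<comment> \<open>All exceptional positions have the form \<open>(1 - \<tau>) y\<close> with
        \<open>y \<in> K\<close>, where the overlap equals \<open>m\<close>.\<close>
      have nc: "x \<noteq> (1 - \<tau>) *\<^sub>R y" if "y \<in> K" for y
        using overlap_center(3)[OF K \<tau> that] x by (auto simp: U_def F_def m_def)
      obtain y where "y \<in> K" using K interior_subset[of K] by (auto simp: convex_body_def)
      then show "\<tau> = 1 \<longrightarrow> x \<noteq> 0" using nc by force
      have "frontier K \<subseteq> K" using K by (auto simp: convex_body_def compact_imp_closed frontier_subset_closed)
      then show "CARD('n) = 1 \<longrightarrow> x \<notin> (\<lambda>y. (1 - \<tau>) *\<^sub>R y) ` frontier K" using nc by auto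
    qed (use x in \<open>simp add: U_def F_def\<close>)
    then show ?thesis by (simp add: homothet_translate[of x] frontier_translate M_def)
  qed
  define G where "G x = (\<Sum>i\<in>Basis. shift_flux K M i x *\<^sub>R i)" for x
  have Gh: "(\<Sum>i\<in>Basis. (h \<bullet> i) * shift_flux K M i x) = G x \<bullet> h" for x h
    by (simp add: G_def inner_sum_left inner_commute[of h] mult.commute)
  have cont: "isCont (shift_flux K M i) x" if "x \<in> U" "i \<in> Basis" for x i
    by (rule isCont_shift_flux[OF K M _ null[OF that(1)]]) (use that in simp)
  have contG: "continuous_on U G"
    unfolding G_def by (intro continuous_intros continuous_at_imp_continuous_on ballI cont)
  have dF: "(F has_derivative (\<lambda>h. G x \<bullet> h)) (at x)" if x: "x \<in> U" for x
  proof -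
    have "((\<lambda>t. F (z + t *\<^sub>R i)) has_real_derivative shift_flux K M i z) (at 0)" if "z \<in> U" "i \<in> Basis" for z i
      using shift_flux_derivative[OF K M _ null[OF that(1)], of i] that by (simp add: F_def overlap_eq M_def)
    from has_derivative_partials[OF opU x this cont[OF x]] show ?thesis by (simp add: Gh)
  qed
  have dF_line: "((\<lambda>t. F (x + t *\<^sub>R h)) has_real_derivative G x \<bullet> h) (at 0)" if x: "x \<in> U" for x h
  proof -
    have "((\<lambda>t. x + t *\<^sub>R h) has_derivative (\<lambda>t. t *\<^sub>R h)) (at 0)"
      by (auto intro!: derivative_eq_intros)
    moreover have "(F has_derivative (\<lambda>h. G x \<bullet> h)) (at (x + 0 *\<^sub>R h))" using dF[OF x] by simp
    ultimately have "((\<lambda>t. F (x + t *\<^sub>R h)) has_derivative (\<lambda>t. G x \<bullet> (t *\<^sub>R h))) (at 0)"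
      by (rule has_derivative_compose)
    moreover have "(\<lambda>t. G x \<bullet> (t *\<^sub>R h)) = (*) (G x \<bullet> h)" by (auto simp: fun_eq_iff)
    ultimately show ?thesis by (simp add: has_field_derivative_def)
  qed
  have inc: "\<exists>h. G x \<bullet> h > 0" if x: "x \<in> U" for x
  proof -
    have ox: "0 < overlap K \<tau> x" "overlap K \<tau> x < min 1 (\<tau> ^ CARD('n)) * measure lebesgue K"
      using x by (auto simp: U_def F_def m_def)
    obtain c h where hc: "c > 0" "\<forall>t\<in>{0..1}. F x + c * t \<le> F (x + t *\<^sub>R h)"
      using overlap_growth[OF K \<tau> ox] unfolding F_def by blast
    have "((\<lambda>t. (F (x + t *\<^sub>R h) - F x) / t) \<longlongrightarrow> G x \<bullet> h) (at 0)"
      using dF_line[OF x, of h] by (simp add: DERIV_def)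
    \<comment> \<open>Growth is known for positive \<open>t\<close> only, so the derivative is read
      as a limit from the right.\<close>
    then have "((\<lambda>t. (F (x + t *\<^sub>R h) - F x) / t) \<longlongrightarrow> G x \<bullet> h) (at_right 0)"
      by (rule tendsto_within_subset) auto
    moreover have "\<forall>\<^sub>F t in at_right 0. c \<le> (F (x + t *\<^sub>R h) - F x) / t"
      unfolding eventually_at_right_field
    proof (intro exI[of _ 1] conjI allI impI)
      fix t :: real assume "0 < t" "t < 1"
      then show "c \<le> (F (x + t *\<^sub>R h) - F x) / t" using bspec[OF hc(2), of t] by (simp add: field_simps)
    qed simp
    ultimately have "c \<le> G x \<bullet> h" by (rule tendsto_lowerbound) simp
    then show ?thesis using hc(1) by (intro exI[of _ h]) simp
  qed
  have clS: "closed S" unfolding S by (intro closed_Collect_le contF continuous_intros)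
  have frF: "F y = \<delta>" if y: "y \<in> frontier S" for y
  proof -
    have yS: "y \<in> S" "y \<notin> interior S" using y clS by (auto simp: frontier_def)
    have "open {x. \<delta> < F x}" by (intro open_Collect_less contF continuous_intros)
    then have "{x. \<delta> < F x} \<subseteq> interior S" by (intro interior_maximal) (auto simp: S)
    then have "\<not> \<delta> < F y" using yS(2) by blast
    then show ?thesis using yS(1) by (simp add: S)
  qed
  have frU: "y \<in> frontier S \<longleftrightarrow> F y = \<delta>" if y: "y \<in> U" for y
  proof
    assume "y \<in> frontier S"
    then show "F y = \<delta>" by (rule frF)
  next
    assume Fy: "F y = \<delta>"
    \<comment> \<open>Going back against a direction of increase, \<open>F\<close> falls below
      \<delta> arbitrarily close to \<open>y\<close>, so the level set contains no interior points
      of \<open>S\<close>.\<close>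
    obtain h where h: "G y \<bullet> h > 0" using inc[OF y] by blast
    have "y \<notin> interior S"
    proof
      assume "y \<in> interior S"
      then obtain r where r: "r > 0" "cball y r \<subseteq> S" by (auto simp: mem_interior_cball)
      obtain d where d: "d > 0" "\<And>s. 0 < s \<Longrightarrow> s < d \<Longrightarrow> F (y + (0 - s) *\<^sub>R h) < F (y + 0 *\<^sub>R h)"
        using DERIV_pos_inc_left[OF dF_line[OF y, of h] h] by auto
      define s where "s = min (d / 2) (r / (norm h + 1))"
      have s: "0 < s" "s < d" "s \<le> r / (norm h + 1)" using d r by (auto simp: s_def min_less_iff_disj add_nonneg_pos)
      have "s * norm h \<le> s * (norm h + 1)" using s by (simp add: algebra_simps)
      also have "\<dots> \<le> r"
      proof -
        have "0 < norm h + 1" by (simp add: add_nonneg_pos)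
        then show ?thesis using s(3) by (simp add: pos_le_divide_eq)
      qed
      finally have "y + (0 - s) *\<^sub>R h \<in> cball y r" using s by (simp add: dist_norm)
      then have "y + (0 - s) *\<^sub>R h \<in> S" using r(2) by blast
      then have "\<delta> \<le> F (y + (0 - s) *\<^sub>R h)" by (simp only: S mem_Collect_eq)
      then show False using d(2)[OF s(1,2)] Fy by simp
    qed
    moreover have "y \<in> S" using Fy by (simp add: S)
    ultimately show "y \<in> frontier S" by (auto simp: frontier_def closure_def)
  qed
  show ?thesis
    unfolding C1_boundary_def S_def[symmetric]
  \<comment> \<open>One neighbourhood and one function serve all boundary points. The sign of
    \<open>\<delta> - F x\<close> places the body where the function is non-positive.\<close>
  proof (rule ballI, rule exI[of _ U], rule exI[of _ "\<lambda>x. \<delta> - F x"], rule exI[of _ "\<lambda>y. - G y"], intro conjI)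
    fix p assume p: "p \<in> frontier S"
    have "F p = \<delta>" by (rule frF[OF p])
    then show "p \<in> U" using \<delta> by (simp add: U_def m_def)
    show "open U" by (rule opU)
    show "\<forall>y\<in>U. ((\<lambda>x. \<delta> - F x) has_derivative (\<lambda>h. - G y \<bullet> h)) (at y)"
      using dF by (auto intro!: derivative_eq_intros)
    show "continuous_on U (\<lambda>y. - G y)" by (intro continuous_intros contG)
    show "\<forall>y\<in>U. - G y \<noteq> 0" using inc by fastforce
    show "S \<inter> U = {y \<in> U. \<delta> - F y \<le> 0}" by (auto simp: S)
    show "frontier S \<inter> U = {y \<in> U. \<delta> - F y = 0}" using frU by auto
  qed
qed

theorem theorem2p4:
  fixes K :: "(real^'n) set" and \<tau> :: real
  assumes "convex_body K" and "\<tau> > 0" and "strictly_convex K"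
  shows
    "(\<forall>\<delta>. 0 < \<delta> \<and> \<delta> < min 1 (\<tau> ^ CARD('n)) * measure lebesgue K
        \<longrightarrow> C1_boundary (convolution_body K \<delta> \<tau>)) \<and>
     (\<forall>x j. overlap K \<tau> x > 0
        \<longrightarrow> (\<tau> = 1 \<longrightarrow> x \<noteq> 0)
        \<longrightarrow> (CARD('n) = 1 \<longrightarrow> x \<notin> (\<lambda>y. (1 - \<tau>) *\<^sub>R y) ` frontier K)
        \<longrightarrow>
        set_integrable (surface_measure (homothet x \<tau> K)) (K \<inter> frontier (homothet x \<tau> K))
          (\<lambda>y. outer_normal (homothet x \<tau> K) y \<bullet> axis j 1) \<and>
        set_integrable (surface_measure K) (homothet x \<tau> K \<inter> frontier K)
          (\<lambda>y. outer_normal K y \<bullet> axis j 1) \<and>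
        ((\<lambda>t. overlap K \<tau> (x + t *\<^sub>R axis j 1)) has_real_derivative
          (LINT y : K \<inter> frontier (homothet x \<tau> K) | surface_measure (homothet x \<tau> K).
             outer_normal (homothet x \<tau> K) y \<bullet> axis j 1)) (at 0) \<and>
        (LINT y : K \<inter> frontier (homothet x \<tau> K) | surface_measure (homothet x \<tau> K).
             outer_normal (homothet x \<tau> K) y \<bullet> axis j 1)
          = - (LINT y : homothet x \<tau> K \<inter> frontier K | surface_measure K.
             outer_normal K y \<bullet> axis j 1))"
proof (intro conjI allI impI)
  show "C1_boundary (convolution_body K \<delta> \<tau>)" if "0 < \<delta> \<and> \<delta> < min 1 (\<tau> ^ CARD('n)) * measure lebesgue K" for \<delta>
    using convolution_body_C1_boundary[OF assms] that by blast
  fix x j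
  assume x: "overlap K \<tau> x > 0" "\<tau> = 1 \<longrightarrow> x \<noteq> 0" "CARD('n) = 1 \<longrightarrow> x \<notin> (\<lambda>y. (1 - \<tau>) *\<^sub>R y) ` frontier K"
  let ?L = "homothet x \<tau> K" and ?e = "axis j 1 :: real^'n"
  have e: "norm ?e = 1" by simp
  have L: "convex_body ?L" by (rule homothet_convex_body[OF assms(1,2)])
  have cl: "closed K" "closed ?L" using assms(1) L by (auto simp: convex_body_def compact_imp_closed)
  have B: "K \<inter> frontier ?L \<in> sets borel" "?L \<inter> frontier K \<in> sets borel"
    using cl by (auto intro!: borel_closed closed_Int)
  note null = common_frontier_homothet_null[OF assms x]
  note d = overlap_derivative[OF assms(1,2) e null]
  note IL = surface_measure_integral[OF L B(1) Int_lower2 e]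
  note IK = surface_measure_integral[OF assms(1) B(2) Int_lower2 e]
  show "set_integrable (surface_measure ?L) (K \<inter> frontier ?L) (\<lambda>y. outer_normal ?L y \<bullet> ?e)" by (rule IL(1))
  show "set_integrable (surface_measure K) (?L \<inter> frontier K) (\<lambda>y. outer_normal K y \<bullet> ?e)" by (rule IK(1))
  show "((\<lambda>t. overlap K \<tau> (x + t *\<^sub>R ?e)) has_real_derivative
      (LINT y : K \<inter> frontier ?L | surface_measure ?L. outer_normal ?L y \<bullet> ?e)) (at 0)"
    unfolding IL(2) by (rule d(1))
  \<comment> \<open>Both integrals, the second with its sign, are the derivative of the same
    function, obtained once by moving the homothetic copy and once by moving
    \<open>K\<close>.\<close>
  show "(LINT y : K \<inter> frontier ?L | surface_measure ?L. outer_normal ?L y \<bullet> ?e)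
      = - (LINT y : ?L \<inter> frontier K | surface_measure K. outer_normal K y \<bullet> ?e)"
    unfolding IL(2) IK(2) by (rule DERIV_unique[OF d])
qed

end
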